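(* Let $\Theta\subset\mathbb{R}$ be compact and let $\Phi:\mathbb{R}\to\mathbb{R}$ be a $C^2$ function for which there exist constants $C_1>0$ and $C_2>0$ such that $$|\xi||\Phi''(\xi)|\ge C_1\quad\text{and}\quad |\xi||\Phi''(\xi)|\ge C_2|\Phi'(\xi)|\qquad\text{for all } |\xi|\ge 1.$$ If $s>\frac{\beta(\Theta)+1}{4}$, then for every $f\in H^s(\mathbb{R})$, $$\lim_{\substack{(y,t)\to(x,0)\\ y-x\in t\Theta}}S_tf(y)=f(x)\qquad\text{for almost every } x\in\mathbb{R},$$ where $t\Theta=\{t\theta:\theta\in\Theta\}$ and $t\in[-1,1]$.
   Context: The Fourier transform is $\widehat f(\xi)=\int_{\mathbb{R}}e^{-ix\xi}f(x)\,dx$ (extended to $L^2(\mathbb{R})$ as usual). $H^s(\mathbb{R})$ is the Sobolev space with norm $\|f\|_{H^s(\mathbb{R})}=\|(1-\Delta)^{s/2}f\|_{L^2(\mathbb{R})}$. The evolution operator is $$S_tf(x)=\frac{1}{2\pi}\int_{\mathbb{R}}e^{i(x\xi+t\Phi(\xi))}\widehat f(\xi)\,d\xi .$$ The integral converges absolutely when $\widehat f\in L^1(\mathbb{R})$. For general $f\in H^s(\mathbb{R})$, $s\ge 0$, the pointwise value $S_tf(x)$ is understood as $\lim_{N\to\infty}\frac{1}{2\pi}\int_{|\xi|\le 2^N}e^{i(x\xi+t\Phi(\xi))}\widehat f(\xi)\,d\xi$ (with $N\in\mathbb{N}$) where this limit exists, and as $0$ otherwise. $\beta(\Theta)$ is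 the upper Minkowski dimension of $\Theta$: $\beta(\Theta)=\inf\{r>0:\limsup_{\delta\to0}N(\Theta,\delta)\delta^r=0\}$, where $N(\Theta,\delta)$ is the smallest number of intervals of length $\delta$ which cover $\Theta$. *)

theory Defs
  imports "HOL-Analysis.Analysis"
begin

definition L2 :: "(real \<Rightarrow> complex) set" where
  "L2 = {f. f \<in> borel_measurable lebesgue \<and> integrable lebesgue (\<lambda>x. (cmod (f x))\<^sup>2)}"

definition fourier_integral :: "(real \<Rightarrow> complex) \<Rightarrow> real \<Rightarrow> complex" where
  "fourier_integral f \<xi> = (LINT x|lebesgue. exp (- \<i> * complex_of_real (x * \<xi>)) * f x)"

(* For f in L2 the truncations of f to [-R, R] are in L1 and L2 and converge to f in L2,
   so g is the Plancherel extension of the Fourier transform; it is determined up to a null set. *)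
definition is_fourier_L2 :: "(real \<Rightarrow> complex) \<Rightarrow> (real \<Rightarrow> complex) \<Rightarrow> bool" where
  "is_fourier_L2 f g \<longleftrightarrow> g \<in> L2 \<and>
     ((\<lambda>R. \<integral>\<^sup>+ \<xi>. ennreal ((cmod (g \<xi> -
              fourier_integral (\<lambda>x. indicator {-R..R} x *\<^sub>R f x) \<xi>))\<^sup>2) \<partial>lebesgue)
        \<longlongrightarrow> 0) at_top"

(* The choice of representative is immaterial: the transform is only used under integrals. *)
definition fourier :: "(real \<Rightarrow> complex) \<Rightarrow> real \<Rightarrow> complex" where
  "fourier f = (SOME g. is_fourier_L2 f g)"

(* Intended for s \<ge> 0, where the Sobolev space is contained in L2; the operator
   (1 - \<Delta>) powr (s/2) is the Fourier multiplier with symbol (1 + \<xi>^2) powr (s/2). *)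
definition Sobolev :: "real \<Rightarrow> (real \<Rightarrow> complex) set" where
  "Sobolev s = {f \<in> L2. (\<lambda>\<xi>. (1 + \<xi>\<^sup>2) powr (s / 2) *\<^sub>R fourier f \<xi>) \<in> L2}"

definition evolution_partial ::
    "(real \<Rightarrow> real) \<Rightarrow> real \<Rightarrow> (real \<Rightarrow> complex) \<Rightarrow> real \<Rightarrow> nat \<Rightarrow> complex" where
  "evolution_partial \<Phi> t f x N =
     1 / (2 * complex_of_real pi) *
     (LINT \<xi>:{- (2 ^ N)..2 ^ N}|lebesgue.
        exp (\<i> * complex_of_real (x * \<xi> + t * \<Phi> \<xi>)) * fourier f \<xi>)"

definition evolution ::
    "(real \<Rightarrow> real) \<Rightarrow> real \<Rightarrow> (real \<Rightarrow> complex) \<Rightarrow> real \<Rightarrow> complex" where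
  "evolution \<Phi> t f x =
     (if convergent (evolution_partial \<Phi> t f x) then lim (evolution_partial \<Phi> t f x) else 0)"

(* The set A consists of left endpoints. Closed intervals suffice: replacing an interval by its
   closure preserves its length. The minimum exists for bounded \<Theta> and \<delta> > 0. *)
definition covering_number :: "real set \<Rightarrow> real \<Rightarrow> nat" where
  "covering_number \<Theta> \<delta> =
     (LEAST n. \<exists>A. finite A \<and> card A = n \<and> \<Theta> \<subseteq> (\<Union>a\<in>A. {a..a + \<delta>}))"

definition upper_Minkowski_dim :: "real set \<Rightarrow> real" where
  "upper_Minkowski_dim \<Theta> =
     Inf {r. r > 0 \<and>
       Limsup (at_right 0) (\<lambda>\<delta>. ereal (real (covering_number \<Theta> \<delta>) * \<delta> powr r)) = 0}"

definition C2_function :: "(real \<Rightarrow> real) \<Rightarrow> bool" where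
  "C2_function \<Phi> \<longleftrightarrow>
     (\<forall>x. \<Phi> differentiable at x) \<and> (\<forall>x. deriv \<Phi> differentiable at x) \<and>
     continuous_on UNIV (deriv (deriv \<Phi>))"

end

theory Submission
  imports Defs "HOL-Probability.Characteristic_Functions" "HOL-Probability.Sinc_Integral"
begin

text \<open>
Let \<open>g\<close> be the Fourier transform of \<open>f\<close>, cut into the dyadic blocks \<open>l < \<bar>\<xi>\<bar> \<le> 2 l\<close> with \<open>l = 2 ^ n\<close>. Up to the
factor \<open>1 / (2 pi)\<close>, consecutive partial integrals of the evolution differ by the block integral
\<open>wave \<Phi> g (dyadic_block l)\<close>. Suppose that for almost every \<open>x\<close> the values of these blocks at \<open>x + t \<theta>\<close> and
time \<open>t\<close> are bounded by a geometric sequence, uniformly in \<open>t \<in> [-1, 1]\<close> and \<open>\<theta> \<in> \<Theta>\<close>. Then the partial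
integrals, which are continuous, converge uniformly on the approach region, and the limit at \<open>(x, 0)\<close>
may be taken inside (\<open>evolution_tendsto_at_point\<close>). What remains is the limit of the partial inversion
integrals at time \<open>0\<close>, and this is \<open>f x\<close> for almost every \<open>x\<close> (\<open>AE_limit_of_partial_integrals\<close>).

The geometric bound (\<open>dyadic_maximal_decay\<close>) comes from an \<open>L\<^sup>2\<close> estimate for the maximal function of a
single block. Cut \<open>\<Theta>\<close> into pieces of length \<open>1 / sqrt l\<close>. For \<open>r\<close> slightly above the dimension, at most
\<open>l powr (r / 2)\<close> of them are needed once \<open>l\<close> is large. On one piece the square of the maximal function has
an integral over \<open>[-R, R]\<close> of at most \<open>C sqrt l\<close> times the integral of \<open>\<bar>g\<bar>\<^sup>2\<close> over the block, which in turn
is at most \<open>l powr (- 2 s)\<close> times the square of the Sobolev norm. The total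
\<open>l powr (r / 2 + 1 / 2 - 2 s)\<close> is geometrically small because \<open>r\<close> can be chosen with
\<open>s > (r + 1) / 4\<close>.

The estimate for one piece (\<open>linearized_maximal_estimate\<close>) is a \<open>T T\<^sup>*\<close> argument. The kernel of \<open>T T\<^sup>*\<close> at
two points with difference \<open>u\<close> is the integral over the block of \<open>cis (z \<xi> + \<tau> \<Phi> \<xi>)\<close>, where \<open>\<tau>\<close> is the
difference of the times and \<open>\<bar>z - u\<bar> \<le> M \<bar>\<tau>\<bar> + 1 / sqrt l\<close> if \<open>\<Theta> \<subseteq> [-M, M]\<close>. The two hypotheses on \<open>\<Phi>\<close> and van der Corput's
method bound it by a multiple of \<open>sqrt (l / \<bar>u\<bar>)\<close> when \<open>\<bar>u\<bar> \<ge> 8 / sqrt l\<close> (\<open>kernel_bound\<close>), and closer to the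
diagonal the length \<open>2 l\<close> of the block is a sufficient bound. The integral over \<open>u\<close> is of order \<open>sqrt l\<close>,
and Schur's test concludes.

The Fourier transform on \<open>L\<^sup>2\<close> is built from two facts. The inequality in Plancherel's theorem
(\<open>Plancherel_upper\<close>) is another instance of the same \<open>T T\<^sup>*\<close> argument, and together with the Riesz-Fischer
argument it yields the transform of every square integrable function. The inversion
formula is established in the mean over intervals (\<open>weak_inversion\<close>), where the Dirichlet kernel integrates
to the sine integral; this determines the pointwise limit almost everywhere.
\<close>

section \<open>Oscillatory integrals\<close>

lemma has_vector_derivative_cis_compose:
  assumes "(f has_real_derivative f') (at x within S)"
  shows "((\<lambda>x. cis (f x)) has_vector_derivative (\<i> * of_real f' * cis (f x))) (at x within S)"
proof -
  have 1: "((\<lambda>x. \<i> * of_real (f x)) has_vector_derivative (\<i> * of_real f')) (at x within S)"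
    by (intro has_vector_derivative_mult_right has_vector_derivative_of_real) (use assms in \<open>simp add: has_real_derivative_iff_has_vector_derivative\<close>)
  have 2: "(exp has_field_derivative exp (\<i> * of_real (f x))) (at (\<i> * of_real (f x)) within (\<lambda>x. \<i> * of_real (f x)) ` S)"
    by (rule DERIV_subset[OF DERIV_exp]) simp
  from field_vector_diff_chain_within[OF 1 2] show ?thesis
    by (simp add: cis_conv_exp o_def)
qed

text \<open>
First derivative test: integrate \<open>cis \<phi>\<close> by parts against \<open>1 / \<phi>'\<close>. Since \<open>\<phi>'\<close> is monotone, the
total variation of \<open>1 / \<phi>'\<close> is the difference of its end values, and only the size of \<open>\<phi>'\<close> enters
the bound.
\<close>
lemma van_der_Corput_first:
  fixes \<phi> \<phi>' \<phi>'' :: "real \<Rightarrow> real"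
  assumes ab: "a \<le> b" and \<mu>: "\<mu> > 0"
    and d1: "\<And>x. x \<in> {a..b} \<Longrightarrow> (\<phi> has_real_derivative \<phi>' x) (at x)"
    and d2: "\<And>x. x \<in> {a..b} \<Longrightarrow> (\<phi>' has_real_derivative \<phi>'' x) (at x)"
    and c2: "continuous_on {a..b} \<phi>''"
    and nn: "\<And>x. x \<in> {a..b} \<Longrightarrow> \<phi>'' x \<ge> 0"
    and lb: "\<And>x. x \<in> {a..b} \<Longrightarrow> \<bar>\<phi>' x\<bar> \<ge> \<mu>"
  shows "cmod (integral {a..b} (\<lambda>x. cis (\<phi> x))) \<le> 4 / \<mu>"
proof -
  \<comment> \<open>The boundary term of the integration by parts.\<close>
  define F where "F = (\<lambda>x. (1 / \<phi>' x) *\<^sub>R (- \<i> * cis (\<phi> x)))"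
  define g where "g = (\<lambda>x. \<phi>'' x / (\<phi>' x)\<^sup>2)"
  have nz: "\<phi>' x \<noteq> 0" if "x \<in> {a..b}" for x using lb[OF that] \<mu> by auto
  have inv: "((\<lambda>x. 1 / \<phi>' x) has_real_derivative - g x) (at x within {a..b})" if "x \<in> {a..b}" for x
  proof -
    have "(\<phi>' has_real_derivative \<phi>'' x) (at x within {a..b})"
      using d2[OF that] by (rule DERIV_subset) simp
    from DERIV_inverse_fun[OF this nz[OF that]] show ?thesis
      by (simp add: g_def divide_inverse power2_eq_square)
  qed
  have Fd: "(F has_vector_derivative (cis (\<phi> x) + g x *\<^sub>R (\<i> * cis (\<phi> x)))) (at x within {a..b})"
    if "x \<in> {a..b}" for x
  proof -
    have "((\<lambda>x. cis (\<phi> x)) has_vector_derivative (\<i> * of_real (\<phi>' x) * cis (\<phi> x))) (at x within {a..b})"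
      by (rule has_vector_derivative_cis_compose) (rule DERIV_subset[OF d1[OF that]], simp)
    from has_vector_derivative_mult_right[OF this, of "- \<i>"]
    have "((\<lambda>x. - \<i> * cis (\<phi> x)) has_vector_derivative (of_real (\<phi>' x) * cis (\<phi> x))) (at x within {a..b})"
      by (simp add: algebra_simps)
    from has_vector_derivative_scaleR[OF inv[OF that] this]
    show ?thesis unfolding F_def using nz[OF that]
      by (simp add: scaleR_conv_of_real algebra_simps)
  qed
  have c1: "continuous_on {a..b} \<phi>'"
    using d2 by (meson DERIV_isCont continuous_at_imp_continuous_on)
  have cg: "continuous_on {a..b} g" unfolding g_def
    by (intro continuous_intros c1 c2) (use nz in auto)
  have c0: "continuous_on {a..b} \<phi>"
    using d1 by (meson DERIV_isCont continuous_at_imp_continuous_on)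
  have i1: "((\<lambda>x. cis (\<phi> x) + g x *\<^sub>R (\<i> * cis (\<phi> x))) has_integral (F b - F a)) {a..b}"
    by (rule fundamental_theorem_of_calculus[OF ab Fd])
  have int2: "(\<lambda>x. g x *\<^sub>R (\<i> * cis (\<phi> x))) integrable_on {a..b}"
    by (intro integrable_continuous_interval continuous_intros cg c0)
  have int1: "(\<lambda>x. cis (\<phi> x)) integrable_on {a..b}"
    by (intro integrable_continuous_interval continuous_intros c0)
  have ig: "(g has_integral (1 / \<phi>' a - 1 / \<phi>' b)) {a..b}"
  proof -
    have "((\<lambda>x. - g x) has_integral (1 / \<phi>' b - 1 / \<phi>' a)) {a..b}"
      by (rule fundamental_theorem_of_calculus[OF ab])
         (use inv in \<open>auto simp: has_real_derivative_iff_has_vector_derivative\<close>)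
    from has_integral_neg[OF this] show ?thesis by simp
  qed
  have eq: "integral {a..b} (\<lambda>x. cis (\<phi> x)) = F b - F a - integral {a..b} (\<lambda>x. g x *\<^sub>R (\<i> * cis (\<phi> x)))"
    using integral_unique[OF i1] Henstock_Kurzweil_Integration.integral_add[OF int1 int2] by (simp add: algebra_simps)
  have ainv: "\<bar>1 / \<phi>' x\<bar> \<le> 1 / \<mu>" if "x \<in> {a..b}" for x
    using lb[OF that] \<mu> by (simp add: frac_le)
  have bF: "cmod (F x) \<le> 1 / \<mu>" if "x \<in> {a..b}" for x
    using ainv[OF that] unfolding F_def by (simp add: norm_mult)
  have "cmod (integral {a..b} (\<lambda>x. g x *\<^sub>R (\<i> * cis (\<phi> x)))) \<le> integral {a..b} g"
    by (rule Henstock_Kurzweil_Integration.integral_norm_bound_integral[OF int2])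
       (use ig nn in \<open>auto simp: norm_mult g_def has_integral_integrable\<close>)
  also have "\<dots> \<le> 2 / \<mu>"
    using integral_unique[OF ig] abs_le_D1[OF ainv[of a]] abs_le_D2[OF ainv[of b]] ab by simp
  finally have "cmod (integral {a..b} (\<lambda>x. cis (\<phi> x))) \<le> 1/\<mu> + 1/\<mu> + 2/\<mu>"
    unfolding eq using bF[of a] bF[of b] ab
      norm_triangle_ineq4[of "F b - F a" "integral {a..b} (\<lambda>x. g x *\<^sub>R (\<i> * cis (\<phi> x)))"]
      norm_triangle_ineq4[of "F b" "F a"] by simp
  thus ?thesis by simp
qed

text \<open>
The point \<open>c\<close> is where the increasing function \<open>\<phi>'\<close> changes sign, or an end point if it does not.
Moving away from \<open>c\<close>, \<open>\<phi>'\<close> grows with slope at least \<open>\<rho>\<close> until it has reached size \<open>\<mu>\<close>, and by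
monotonicity it never falls below \<open>\<mu>\<close> again.
\<close>
lemma convex_phase_turning_point:
  fixes \<phi>' \<phi>'' :: "real \<Rightarrow> real"
  assumes ab: "a \<le> b" and \<rho>: "\<rho> > 0"
    and d2: "\<And>x. x \<in> {a..b} \<Longrightarrow> (\<phi>' has_real_derivative \<phi>'' x) (at x)"
    and nn: "\<And>x. x \<in> {a..b} \<Longrightarrow> \<phi>'' x \<ge> 0"
    and lb: "\<And>x. x \<in> {a..b} \<Longrightarrow> \<bar>\<phi>' x\<bar> < \<mu> \<Longrightarrow> \<phi>'' x \<ge> \<rho>"
  obtains c where "c \<in> {a..b}" "\<And>x. x \<in> {a..b} \<Longrightarrow> \<bar>\<phi>' x\<bar> \<ge> min \<mu> (\<rho> * \<bar>x - c\<bar>)"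
proof -
  have mono: "\<phi>' x \<le> \<phi>' y" if "a \<le> x" "x \<le> y" "y \<le> b" for x y
  proof (rule DERIV_nonneg_imp_nondecreasing[OF that(2)])
    fix z assume "x \<le> z" "z \<le> y"
    with that have "z \<in> {a..b}" by simp
    from d2[OF this] nn[OF this] show "\<exists>d. (\<phi>' has_real_derivative d) (at z) \<and> 0 \<le> d" by blast
  qed
  have mvt: "\<exists>z. x < z \<and> z < y \<and> \<phi>' y - \<phi>' x = (y - x) * \<phi>'' z" if "a \<le> x" "x < y" "y \<le> b" for x y
    by (rule MVT2[OF that(2)]) (rule d2, use that in simp)
  have cont: "continuous_on {a..b} \<phi>'"
    using d2 by (meson DERIV_isCont continuous_at_imp_continuous_on)
  obtain c where c: "c \<in> {a..b}" "\<phi>' c \<ge> 0 \<or> c = b" "\<phi>' c \<le> 0 \<or> c = a"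
  proof (cases "\<phi>' a \<ge> 0")
    case True thus ?thesis using ab by (intro that[of a]) auto
  next
    case False
    show ?thesis
    proof (cases "\<phi>' b \<le> 0")
      case True thus ?thesis using ab by (intro that[of b]) auto
    next
      case F2: False
      with False obtain c where "a \<le> c" "c \<le> b" "\<phi>' c = 0"
        using IVT'[OF _ _ ab cont, of 0] by auto
      thus ?thesis by (intro that[of c]) auto
    qed
  qed
  show ?thesis
  proof (rule that[OF c(1)])
    fix x assume x: "x \<in> {a..b}"
    show "\<bar>\<phi>' x\<bar> \<ge> min \<mu> (\<rho> * \<bar>x - c\<bar>)"
    proof (cases "\<bar>\<phi>' x\<bar> < \<mu>")
      case True
      consider "x = c" | "c < x" | "x < c" by linarith
      thus ?thesis
      proof cases
        case 2
        with c x have p: "\<phi>' c \<ge> 0" by auto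
        from mvt[of c x] 2 c x obtain z where z: "c < z" "z < x" "\<phi>' x - \<phi>' c = (x - c) * \<phi>'' z" by auto
        have "\<phi>' z \<le> \<phi>' x" "\<phi>' c \<le> \<phi>' z" using mono z c x by auto
        with p True have "\<phi>'' z \<ge> \<rho>" using lb[of z] z c x by auto
        hence "(x - c) * \<phi>'' z \<ge> (x - c) * \<rho>" using 2 by (intro mult_left_mono) auto
        thus ?thesis using z p 2 by (auto simp: min_def algebra_simps)
      next
        case 3
        with c x have p: "\<phi>' c \<le> 0" by auto
        from mvt[of x c] 3 c x obtain z where z: "x < z" "z < c" "\<phi>' c - \<phi>' x = (c - x) * \<phi>'' z" by auto
        have "\<phi>' x \<le> \<phi>' z" "\<phi>' z \<le> \<phi>' c" using mono z c x by auto
        with p True have "\<phi>'' z \<ge> \<rho>" using lb[of z] z c x by auto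
        hence "(c - x) * \<phi>'' z \<ge> (c - x) * \<rho>" using 3 by (intro mult_left_mono) auto
        thus ?thesis using z p 3 by (auto simp: min_def algebra_simps)
      qed auto
    qed auto
  qed
qed

lemma norm_integral_cis_le:
  fixes \<phi> :: "real \<Rightarrow> real"
  assumes "continuous_on {a..b} \<phi>" "a \<le> b"
  shows "cmod (integral {a..b} (\<lambda>x. cis (\<phi> x))) \<le> b - a"
proof -
  have "cmod (integral {a..b} (\<lambda>x. cis (\<phi> x))) \<le> integral {a..b} (\<lambda>x. 1::real)"
    by (rule Henstock_Kurzweil_Integration.integral_norm_bound_integral)
       (use assms in \<open>auto intro!: integrable_continuous_interval continuous_intros\<close>)
  thus ?thesis using assms by simp
qed

text \<open>
First and second derivative test in one: outside the interval of radius \<open>1 / sqrt \<rho>\<close> around the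
turning point the first derivative test applies, and inside it the trivial bound is good enough.
Requiring a large second derivative only where the first one is small spares the kernel estimate
a decomposition of the frequency interval.
\<close>
lemma van_der_Corput:
  fixes \<phi> \<phi>' \<phi>'' :: "real \<Rightarrow> real"
  assumes ab: "a \<le> b" and \<mu>: "\<mu> > 0" and \<rho>: "\<rho> > 0"
    and d1: "\<And>x. x \<in> {a..b} \<Longrightarrow> (\<phi> has_real_derivative \<phi>' x) (at x)"
    and d2: "\<And>x. x \<in> {a..b} \<Longrightarrow> (\<phi>' has_real_derivative \<phi>'' x) (at x)"
    and c2: "continuous_on {a..b} \<phi>''"
    and nn: "\<And>x. x \<in> {a..b} \<Longrightarrow> \<phi>'' x \<ge> 0"
    and lb: "\<And>x. x \<in> {a..b} \<Longrightarrow> \<bar>\<phi>' x\<bar> < \<mu> \<Longrightarrow> \<phi>'' x \<ge> \<rho>"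
  shows "cmod (integral {a..b} (\<lambda>x. cis (\<phi> x))) \<le> 8 / \<mu> + 10 / sqrt \<rho>"
proof -
  obtain c where c: "c \<in> {a..b}" "\<And>x. x \<in> {a..b} \<Longrightarrow> \<bar>\<phi>' x\<bar> \<ge> min \<mu> (\<rho> * \<bar>x - c\<bar>)"
    using convex_phase_turning_point[OF ab \<rho> d2 nn lb] by metis
  \<comment> \<open>With this radius the length of the inner interval and the bound outside are of the same order.\<close>
  define r where "r = 1 / sqrt \<rho>"
  have r: "r > 0" using \<rho> by (simp add: r_def)
  have \<rho>r: "\<rho> * r = sqrt \<rho>" using \<rho> by (simp add: r_def real_div_sqrt)
  define m where "m = min \<mu> (sqrt \<rho>)"
  have m: "m > 0" using \<mu> \<rho> by (simp add: m_def)
  have m4: "4 / m \<le> 4 / \<mu> + 4 / sqrt \<rho>" using \<mu> \<rho> by (auto simp: m_def min_def)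
  define p where "p = max a (c - r)"
  define q where "q = min b (c + r)"
  have pq: "a \<le> p" "p \<le> c" "c \<le> q" "q \<le> b" using c(1) r by (auto simp: p_def q_def)
  have c0: "continuous_on {a..b} \<phi>"
    using d1 by (meson DERIV_isCont continuous_at_imp_continuous_on)
  have int: "(\<lambda>x. cis (\<phi> x)) integrable_on {x..y}" if "a \<le> x" "y \<le> b" for x y
    by (intro integrable_continuous_interval continuous_intros continuous_on_subset[OF c0]) (use that in auto)
  have far: "m \<le> \<bar>\<phi>' x\<bar>" if "x \<in> {a..b}" "\<bar>x - c\<bar> \<ge> r" for x
  proof -
    have "\<rho> * \<bar>x - c\<bar> \<ge> sqrt \<rho>" using that(2) \<rho> unfolding \<rho>r[symmetric] by (intro mult_left_mono) auto
    thus ?thesis using c(2)[OF that(1)] unfolding m_def by linarith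
  qed
  have out: "cmod (integral {x..y} (\<lambda>x. cis (\<phi> x))) \<le> 4 / m"
    if "a \<le> x" "x \<le> y" "y \<le> b" "\<And>z. z \<in> {x..y} \<Longrightarrow> \<bar>z - c\<bar> \<ge> r" for x y
    by (rule van_der_Corput_first[where \<phi>' = \<phi>' and \<phi>'' = \<phi>'', OF that(2) m])
       (use that d1 d2 nn far in \<open>auto intro: continuous_on_subset[OF c2]\<close>)
  have b1: "cmod (integral {a..p} (\<lambda>x. cis (\<phi> x))) \<le> 4 / m"
  proof (cases "p = a")
    case True thus ?thesis using m by simp
  next
    case False thus ?thesis using pq r by (intro out) (auto simp: p_def)
  qed
  have b3: "cmod (integral {q..b} (\<lambda>x. cis (\<phi> x))) \<le> 4 / m"
  proof (cases "q = b")
    case True thus ?thesis using m by simp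
  next
    case False thus ?thesis using pq r by (intro out) (auto simp: q_def)
  qed
  have "cmod (integral {p..q} (\<lambda>x. cis (\<phi> x))) \<le> q - p"
    by (rule norm_integral_cis_le) (use pq in \<open>auto intro: continuous_on_subset[OF c0]\<close>)
  also have "\<dots> \<le> 2 * r" by (auto simp: p_def q_def)
  finally have b2: "cmod (integral {p..q} (\<lambda>x. cis (\<phi> x))) \<le> 2 / sqrt \<rho>" by (simp add: r_def)
  have "integral {a..b} (\<lambda>x. cis (\<phi> x)) = integral {a..p} (\<lambda>x. cis (\<phi> x)) + integral {p..q} (\<lambda>x. cis (\<phi> x))
       + integral {q..b} (\<lambda>x. cis (\<phi> x))"
    using pq Henstock_Kurzweil_Integration.integral_combine[of a p q "\<lambda>x. cis (\<phi> x)"]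
      Henstock_Kurzweil_Integration.integral_combine[of a q b "\<lambda>x. cis (\<phi> x)"] int by auto
  hence "cmod (integral {a..b} (\<lambda>x. cis (\<phi> x))) \<le> 4 / m + 2 / sqrt \<rho> + 4 / m"
    using b1 b2 b3 norm_triangle_ineq[of "integral {a..p} (\<lambda>x. cis (\<phi> x)) + integral {p..q} (\<lambda>x. cis (\<phi> x))"
       "integral {q..b} (\<lambda>x. cis (\<phi> x))"]
      norm_triangle_ineq[of "integral {a..p} (\<lambda>x. cis (\<phi> x))" "integral {p..q} (\<lambda>x. cis (\<phi> x))"] by simp
  thus ?thesis using m4 by (simp add: add_divide_distrib)
qed

lemma van_der_Corput_signed:
  fixes \<phi> \<phi>' \<phi>'' :: "real \<Rightarrow> real"
  assumes ab: "a \<le> b" and \<mu>: "\<mu> > 0" and \<rho>: "\<rho> > 0"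
    and d1: "\<And>x. x \<in> {a..b} \<Longrightarrow> (\<phi> has_real_derivative \<phi>' x) (at x)"
    and d2: "\<And>x. x \<in> {a..b} \<Longrightarrow> (\<phi>' has_real_derivative \<phi>'' x) (at x)"
    and c2: "continuous_on {a..b} \<phi>''"
    and sgn: "(\<forall>x\<in>{a..b}. \<phi>'' x \<ge> 0) \<or> (\<forall>x\<in>{a..b}. \<phi>'' x \<le> 0)"
    and lb: "\<And>x. x \<in> {a..b} \<Longrightarrow> \<bar>\<phi>' x\<bar> < \<mu> \<Longrightarrow> \<bar>\<phi>'' x\<bar> \<ge> \<rho>"
  shows "cmod (integral {a..b} (\<lambda>x. cis (\<phi> x))) \<le> 8 / \<mu> + 10 / sqrt \<rho>"
  using sgn
proof
  assume "\<forall>x\<in>{a..b}. \<phi>'' x \<ge> 0"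
  hence nn: "\<phi>'' x \<ge> 0" if "x \<in> {a..b}" for x using that by blast
  show ?thesis
    by (rule van_der_Corput[OF ab \<mu> \<rho> d1 d2 c2 nn]) (use lb nn in force)+
next
  assume "\<forall>x\<in>{a..b}. \<phi>'' x \<le> 0"
  hence nn: "- \<phi>'' x \<ge> 0" if "x \<in> {a..b}" for x using that by auto
  have "cmod (integral {a..b} (\<lambda>x. cis (- \<phi> x))) \<le> 8 / \<mu> + 10 / sqrt \<rho>"
  proof (rule van_der_Corput[OF ab \<mu> \<rho>, where \<phi>' = "\<lambda>x. - \<phi>' x" and \<phi>'' = "\<lambda>x. - \<phi>'' x"])
    show "continuous_on {a..b} (\<lambda>x. - \<phi>'' x)" by (intro continuous_intros c2)
    show "- \<phi>'' x \<ge> \<rho>" if "x \<in> {a..b}" "\<bar>- \<phi>' x\<bar> < \<mu>" for x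
      using lb[OF that(1)] nn[OF that(1)] that(2) by simp
  qed (use d1 d2 nn DERIV_minus in blast)+
  also have "integral {a..b} (\<lambda>x. cis (- \<phi> x)) = cnj (integral {a..b} (\<lambda>x. cis (\<phi> x)))"
    by (simp add: integral_cnj cis_cnj)
  finally show ?thesis by simp
qed

text \<open>
The hypotheses on \<open>\<Phi>\<close> and the constants, as one predicate that is preserved by reflection.
\<close>
definition dispersive :: "(real \<Rightarrow> real) \<Rightarrow> real \<Rightarrow> real \<Rightarrow> bool" where
  "dispersive \<Phi> C1 C2 \<longleftrightarrow> C2_function \<Phi> \<and> C1 > 0 \<and> C2 > 0 \<and>
     (\<forall>\<xi>. \<bar>\<xi>\<bar> \<ge> 1 \<longrightarrow> \<bar>\<xi>\<bar> * \<bar>deriv (deriv \<Phi>) \<xi>\<bar> \<ge> C1 \<and>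
        \<bar>\<xi>\<bar> * \<bar>deriv (deriv \<Phi>) \<xi>\<bar> \<ge> C2 * \<bar>deriv \<Phi> \<xi>\<bar>)"

lemma dispersive_deriv:
  assumes "dispersive \<Phi> C1 C2"
  shows "(\<Phi> has_real_derivative deriv \<Phi> x) (at x)"
    and "(deriv \<Phi> has_real_derivative deriv (deriv \<Phi>) x) (at x)"
    and "continuous_on A (deriv (deriv \<Phi>))"
    and "continuous_on A \<Phi>"
proof -
  have *: "\<Phi> differentiable at x" "deriv \<Phi> differentiable at x" "continuous_on UNIV (deriv (deriv \<Phi>))" for x
    using assms by (auto simp: dispersive_def C2_function_def)
  show "(\<Phi> has_real_derivative deriv \<Phi> x) (at x)" for x
    using *(1) by (simp add: DERIV_deriv_iff_real_differentiable)
  thus "continuous_on A \<Phi>" by (meson DERIV_isCont continuous_at_imp_continuous_on)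
  show "(deriv \<Phi> has_real_derivative deriv (deriv \<Phi>) x) (at x)"
    using *(2) by (simp add: DERIV_deriv_iff_real_differentiable)
  show "continuous_on A (deriv (deriv \<Phi>))" by (rule continuous_on_subset[OF *(3)]) simp
qed

lemma dispersive_reflect:
  assumes "dispersive \<Phi> C1 C2"
  shows "dispersive (\<lambda>x. \<Phi> (- x)) C1 C2"
proof -
  have m: "(uminus has_real_derivative -1) (at x)" for x :: real
    by (auto intro!: derivative_eq_intros)
  have 1: "((\<lambda>x. \<Phi> (- x)) has_real_derivative - deriv \<Phi> (- x)) (at x)" for x
    using DERIV_chain2[OF dispersive_deriv(1)[OF assms] m] by simp
  have e1: "deriv (\<lambda>x. \<Phi> (- x)) = (\<lambda>x. - deriv \<Phi> (- x))"
    using 1 by (auto intro: DERIV_imp_deriv)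
  have 2: "((\<lambda>x. - deriv \<Phi> (- x)) has_real_derivative deriv (deriv \<Phi>) (- x)) (at x)" for x
    using DERIV_minus[OF DERIV_chain2[OF dispersive_deriv(2)[OF assms] m]] by simp
  have e2: "deriv (\<lambda>x. - deriv \<Phi> (- x)) = (\<lambda>x. deriv (deriv \<Phi>) (- x))"
    using 2 by (auto intro: DERIV_imp_deriv)
  have c: "continuous_on UNIV (\<lambda>x. deriv (deriv \<Phi>) (- x))"
    by (rule continuous_on_compose2[OF dispersive_deriv(3)[OF assms, of UNIV]]) (auto intro: continuous_intros)
  have "C2_function (\<lambda>x. \<Phi> (- x))"
    unfolding C2_function_def e1 e2 using 1 2 c real_differentiable_def by blast
  moreover have "\<bar>x\<bar> * \<bar>deriv (deriv \<Phi>) (- x)\<bar> \<ge> C1 \<and>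
        \<bar>x\<bar> * \<bar>deriv (deriv \<Phi>) (- x)\<bar> \<ge> C2 * \<bar>- deriv \<Phi> (- x)\<bar>" if "\<bar>x\<bar> \<ge> 1" for x
  proof -
    have "\<bar>- x\<bar> \<ge> 1" using that by simp
    thus ?thesis using assms unfolding dispersive_def by (metis abs_minus_cancel)
  qed
  ultimately show ?thesis using assms unfolding dispersive_def e1 e2 by simp
qed

text \<open>
The second derivative cannot vanish for \<open>\<bar>\<xi>\<bar> \<ge> 1\<close>, so by continuity it keeps its sign on \<open>[a, b]\<close>; this
is what makes the derivative of every phase \<open>z \<xi> + \<tau> \<Phi> \<xi>\<close> monotone.
\<close>
lemma dispersive_sign:
  assumes "dispersive \<Phi> C1 C2" "1 \<le> a"
  shows "(\<forall>x\<in>{a..b}. deriv (deriv \<Phi>) x \<ge> 0) \<or> (\<forall>x\<in>{a..b}. deriv (deriv \<Phi>) x \<le> 0)"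
proof (rule ccontr)
  assume "\<not> ?thesis"
  then obtain x y where xy: "x \<in> {a..b}" "y \<in> {a..b}" "deriv (deriv \<Phi>) x < 0" "deriv (deriv \<Phi>) y > 0"
    by (auto simp: not_le)
  have "connected (deriv (deriv \<Phi>) ` {a..b})"
    by (intro connected_continuous_image dispersive_deriv(3)[OF assms(1)] connected_Icc)
  hence "0 \<in> deriv (deriv \<Phi>) ` {a..b}"
    using xy by (meson connectedD_interval imageI less_imp_le)
  then obtain z where "z \<in> {a..b}" "deriv (deriv \<Phi>) z = 0" by auto
  with assms have "\<bar>z\<bar> \<ge> 1" "deriv (deriv \<Phi>) z = 0" by auto
  hence "C1 \<le> \<bar>z\<bar> * \<bar>0\<bar>" using assms(1) unfolding dispersive_def by metis
  thus False using assms(1) by (simp add: dispersive_def)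
qed

text \<open>
The first bound uses \<open>\<bar>\<Phi>''\<bar> \<ge> C1 / \<bar>\<xi>\<bar>\<close> alone and is good for large \<open>\<tau>\<close>. In the second one, the
derivative \<open>z + \<tau> \<Phi>'\<close> of the phase can be smaller than \<open>\<bar>z\<bar> / 2\<close> only where \<open>\<bar>\<tau> \<Phi>'\<bar> \<ge> \<bar>z\<bar> / 2\<close>, and there
the second hypothesis on \<open>\<Phi>\<close> makes \<open>\<bar>\<tau> \<Phi>''\<bar>\<close> at least of order \<open>\<bar>z\<bar> / l\<close>.
\<close>
lemma block_integral_bounds:
  assumes \<Phi>: "dispersive \<Phi> C1 C2" and l: "1 \<le> l"
  shows "\<tau> \<noteq> 0 \<Longrightarrow> cmod (integral {l..2*l} (\<lambda>\<xi>. cis (z * \<xi> + \<tau> * \<Phi> \<xi>))) \<le> 18 / sqrt (\<bar>\<tau>\<bar> * C1 / (2 * l))"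
    and "z \<noteq> 0 \<Longrightarrow> cmod (integral {l..2*l} (\<lambda>\<xi>. cis (z * \<xi> + \<tau> * \<Phi> \<xi>))) \<le>
           16 / \<bar>z\<bar> + 10 / sqrt (\<bar>z\<bar> * C2 / (4 * l))"
proof -
  have C: "C1 > 0" "C2 > 0" using \<Phi> by (auto simp: dispersive_def)
  have d1: "((\<lambda>\<xi>. z * \<xi> + \<tau> * \<Phi> \<xi>) has_real_derivative z + \<tau> * deriv \<Phi> \<xi>) (at \<xi>)" for \<xi>
    using DERIV_add[OF DERIV_cmult_Id[of z] DERIV_cmult[OF dispersive_deriv(1)[OF \<Phi>], of \<tau>]] by simp
  have d2: "((\<lambda>\<xi>. z + \<tau> * deriv \<Phi> \<xi>) has_real_derivative \<tau> * deriv (deriv \<Phi>) \<xi>) (at \<xi>)" for \<xi>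
    using DERIV_add[OF DERIV_const[of z] DERIV_cmult[OF dispersive_deriv(2)[OF \<Phi>], of \<tau>]] by simp
  have c2: "continuous_on {l..2*l} (\<lambda>\<xi>. \<tau> * deriv (deriv \<Phi>) \<xi>)"
    by (intro continuous_intros dispersive_deriv(3)[OF \<Phi>])
  have sgn: "(\<forall>x\<in>{l..2*l}. \<tau> * deriv (deriv \<Phi>) x \<ge> 0) \<or> (\<forall>x\<in>{l..2*l}. \<tau> * deriv (deriv \<Phi>) x \<le> 0)"
    using dispersive_sign[OF \<Phi> l, of "2*l"]
    by (cases "\<tau> \<ge> 0") (auto simp: zero_le_mult_iff mult_le_0_iff)
  have low: "\<bar>deriv (deriv \<Phi>) \<xi>\<bar> \<ge> C1 / (2 * l)" "\<bar>deriv (deriv \<Phi>) \<xi>\<bar> \<ge> C2 * \<bar>deriv \<Phi> \<xi>\<bar> / (2 * l)"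
    if "\<xi> \<in> {l..2*l}" for \<xi>
  proof -
    have *: "\<bar>\<xi>\<bar> * \<bar>deriv (deriv \<Phi>) \<xi>\<bar> \<ge> C1" "\<bar>\<xi>\<bar> * \<bar>deriv (deriv \<Phi>) \<xi>\<bar> \<ge> C2 * \<bar>deriv \<Phi> \<xi>\<bar>"
    proof -
      have "\<bar>\<xi>\<bar> \<ge> 1" using that l by auto
      thus "\<bar>\<xi>\<bar> * \<bar>deriv (deriv \<Phi>) \<xi>\<bar> \<ge> C1" "\<bar>\<xi>\<bar> * \<bar>deriv (deriv \<Phi>) \<xi>\<bar> \<ge> C2 * \<bar>deriv \<Phi> \<xi>\<bar>"
        using \<Phi> unfolding dispersive_def by blast+
    qed
    have "\<bar>\<xi>\<bar> * \<bar>deriv (deriv \<Phi>) \<xi>\<bar> \<le> (2 * l) * \<bar>deriv (deriv \<Phi>) \<xi>\<bar>"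
      by (rule mult_right_mono) (use that l in auto)
    thus "\<bar>deriv (deriv \<Phi>) \<xi>\<bar> \<ge> C1 / (2 * l)" "\<bar>deriv (deriv \<Phi>) \<xi>\<bar> \<ge> C2 * \<bar>deriv \<Phi> \<xi>\<bar> / (2 * l)"
      using * l by (simp_all add: divide_le_eq mult.commute)
  qed
  have ll: "l \<le> 2 * l" using l by simp
  show "cmod (integral {l..2*l} (\<lambda>\<xi>. cis (z * \<xi> + \<tau> * \<Phi> \<xi>))) \<le> 18 / sqrt (\<bar>\<tau>\<bar> * C1 / (2 * l))" if "\<tau> \<noteq> 0"
  proof -
    define \<rho> where "\<rho> = \<bar>\<tau>\<bar> * C1 / (2 * l)"
    have \<rho>: "\<rho> > 0" using that C l by (simp add: \<rho>_def)
    have s: "sqrt \<rho> > 0" using \<rho> by simp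
    have "cmod (integral {l..2*l} (\<lambda>\<xi>. cis (z * \<xi> + \<tau> * \<Phi> \<xi>))) \<le> 8 / sqrt \<rho> + 10 / sqrt \<rho>"
    proof (rule van_der_Corput_signed[OF ll s \<rho> d1 d2 c2 sgn])
      fix x assume "x \<in> {l..2*l}"
      from mult_left_mono[OF low(1)[OF this], of "\<bar>\<tau>\<bar>"]
      show "\<rho> \<le> \<bar>\<tau> * deriv (deriv \<Phi>) x\<bar>" by (simp add: \<rho>_def abs_mult)
    qed
    thus ?thesis by (simp add: \<rho>_def)
  qed
  show "cmod (integral {l..2*l} (\<lambda>\<xi>. cis (z * \<xi> + \<tau> * \<Phi> \<xi>))) \<le>
           16 / \<bar>z\<bar> + 10 / sqrt (\<bar>z\<bar> * C2 / (4 * l))" if "z \<noteq> 0"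
  proof -
    define \<rho> where "\<rho> = \<bar>z\<bar> * C2 / (4 * l)"
    have \<rho>: "\<rho> > 0" using that C l by (simp add: \<rho>_def)
    have s: "\<bar>z\<bar> / 2 > 0" using that by simp
    have "cmod (integral {l..2*l} (\<lambda>\<xi>. cis (z * \<xi> + \<tau> * \<Phi> \<xi>))) \<le> 8 / (\<bar>z\<bar> / 2) + 10 / sqrt \<rho>"
    proof (rule van_der_Corput_signed[OF ll s \<rho> d1 d2 c2 sgn])
      fix x assume x: "x \<in> {l..2*l}" and "\<bar>z + \<tau> * deriv \<Phi> x\<bar> < \<bar>z\<bar> / 2"
      hence "\<bar>z\<bar> / 2 \<le> \<bar>\<tau> * deriv \<Phi> x\<bar>" by linarith
      hence "(C2 / (2*l)) * (\<bar>z\<bar> / 2) \<le> (C2 / (2*l)) * \<bar>\<tau> * deriv \<Phi> x\<bar>"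
        by (rule mult_left_mono) (use C l in auto)
      also have "\<dots> = \<bar>\<tau>\<bar> * (C2 * \<bar>deriv \<Phi> x\<bar> / (2 * l))" by (simp add: abs_mult)
      also have "\<dots> \<le> \<bar>\<tau>\<bar> * \<bar>deriv (deriv \<Phi>) x\<bar>" by (rule mult_left_mono[OF low(2)[OF x]]) simp
      finally show "\<rho> \<le> \<bar>\<tau> * deriv (deriv \<Phi>) x\<bar>" by (simp add: \<rho>_def abs_mult mult.commute)
    qed
    thus ?thesis by (simp add: \<rho>_def)
  qed
qed

text \<open>
The three terms stem from the case of large \<open>\<tau>\<close>, from the first derivative test, and from the second
derivative test for small \<open>\<tau>\<close>.
\<close>
definition kernel_const :: "real \<Rightarrow> real \<Rightarrow> real \<Rightarrow> real" where
  "kernel_const M C1 C2 = 18 * sqrt (8 * M / C1) + 32 + 10 * sqrt (8 / C2)"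

text \<open>
Here \<open>u\<close> stands for the difference of two space points, \<open>\<tau>\<close> for the difference of the two times, and
\<open>z\<close> for the difference of the points after they have moved along the admissible directions. Either
\<open>\<tau>\<close> is comparable to \<open>u\<close>, or the motion is negligible and \<open>z\<close> is comparable to \<open>u\<close>; the two bounds
above match these two cases.
\<close>
lemma block_integral_decay:
  assumes \<Phi>: "dispersive \<Phi> C1 C2" and l: "1 \<le> l" and M: "1 \<le> M"
    and z: "\<bar>z - u\<bar> \<le> M * \<bar>\<tau>\<bar> + 1 / sqrt l" and u: "\<bar>u\<bar> \<ge> 8 / sqrt l"
  shows "cmod (integral {l..2*l} (\<lambda>\<xi>. cis (z * \<xi> + \<tau> * \<Phi> \<xi>))) \<le> kernel_const M C1 C2 * sqrt l / sqrt \<bar>u\<bar>"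
    (is "?I \<le> _")
proof -
  have C: "C1 > 0" "C2 > 0" using \<Phi> by (auto simp: dispersive_def)
  have s1: "sqrt l \<ge> 1" using l by simp
  have "8 / sqrt l > 0" using l by simp
  with u have u0: "\<bar>u\<bar> > 0" by linarith
  define q where "q = sqrt l / sqrt \<bar>u\<bar>"
  have q: "q \<ge> 0" using l u0 by (simp add: q_def)
  have K: "kernel_const M C1 C2 * q = 18 * (sqrt (8 * M / C1) * q) + 32 * q + 10 * (sqrt (8 / C2) * q)"
    by (simp add: kernel_const_def algebra_simps)
  have nn: "sqrt (8 * M / C1) * q \<ge> 0" "sqrt (8 / C2) * q \<ge> 0" using q C M by auto
  have "?I \<le> kernel_const M C1 C2 * q"
  proof (cases "\<bar>\<tau>\<bar> \<ge> \<bar>u\<bar> / (4 * M)")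
    case True
    have "\<bar>u\<bar> / (4 * M) > 0" using u0 M by simp
    with True have t0: "\<tau> \<noteq> 0" by auto
    have "?I \<le> 18 / sqrt (\<bar>\<tau>\<bar> * C1 / (2 * l))" by (rule block_integral_bounds(1)[OF \<Phi> l t0])
    also have "\<dots> \<le> 18 / sqrt ((\<bar>u\<bar> / (4 * M)) * C1 / (2 * l))"
      using True u0 t0 M C l
      by (intro divide_left_mono real_sqrt_le_mono divide_right_mono mult_right_mono mult_pos_pos) auto
    also have "\<dots> = 18 * (sqrt (8 * M / C1) * q)"
      using u0 M C l by (simp add: q_def real_sqrt_divide real_sqrt_mult field_simps)
    finally show ?thesis using K nn q by linarith
  next
    case False
    hence "M * \<bar>\<tau>\<bar> \<le> \<bar>u\<bar> / 4" using M by (simp add: field_simps)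
    hence zu: "\<bar>z\<bar> \<ge> \<bar>u\<bar> / 2" using z u by linarith
    hence z0: "z \<noteq> 0" using u0 by auto
    have "?I \<le> 16 / \<bar>z\<bar> + 10 / sqrt (\<bar>z\<bar> * C2 / (4 * l))" by (rule block_integral_bounds(2)[OF \<Phi> l z0])
    also have "16 / \<bar>z\<bar> \<le> 16 / (\<bar>u\<bar> / 2)" using zu u0 z0 by (intro divide_left_mono) auto
    \<comment> \<open>This is where the distance from the diagonal enters: it gives \<open>1 \<le> l * \<bar>u\<bar>\<close>, so that \<open>1 / \<bar>u\<bar> \<le> q\<close>.\<close>
    also have "\<dots> \<le> 32 * q"
    proof -
      have "sqrt l * 1 \<le> sqrt l * sqrt l" using s1 by (intro mult_left_mono) auto
      hence "sqrt l \<le> l" using l by simp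
      hence "1 / l \<le> 8 / sqrt l" using s1 by (intro frac_le) auto
      with u have "1 / l \<le> \<bar>u\<bar>" by linarith
      hence "1 \<le> l * \<bar>u\<bar>" using l by (simp add: field_simps)
      hence "1 \<le> sqrt l * sqrt \<bar>u\<bar>" by (metis real_sqrt_mult real_sqrt_ge_1_iff)
      hence "1 / \<bar>u\<bar> \<le> (sqrt l * sqrt \<bar>u\<bar>) / \<bar>u\<bar>" using u0 by (intro divide_right_mono) auto
      also have "\<dots> = q" unfolding q_def using u0 by (simp add: field_simps)
      finally show ?thesis by simp
    qed
    also have "10 / sqrt (\<bar>z\<bar> * C2 / (4 * l)) \<le> 10 / sqrt ((\<bar>u\<bar> / 2) * C2 / (4 * l))"
      using zu u0 z0 C l by (intro divide_left_mono real_sqrt_le_mono divide_right_mono mult_right_mono mult_pos_pos) auto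
    also have "\<dots> = 10 * (sqrt (8 / C2) * q)"
      using u0 C l by (simp add: q_def real_sqrt_divide real_sqrt_mult field_simps)
    finally show ?thesis using K nn by linarith
  qed
  thus ?thesis by (simp add: q_def)
qed

definition dyadic_block :: "real \<Rightarrow> real set" where
  "dyadic_block l = {\<xi>. l < \<bar>\<xi>\<bar> \<and> \<bar>\<xi>\<bar> \<le> 2 * l}"

lemma dyadic_block_eq: "l \<ge> 0 \<Longrightarrow> dyadic_block l = {l<..2*l} \<union> {-(2*l)..<-l}"
  by (auto simp: dyadic_block_def)

lemma sets_dyadic_block [measurable]: "dyadic_block l \<in> sets borel"
  unfolding dyadic_block_def by measurable

lemma block_integral_split:
  assumes c: "continuous_on UNIV f" and l: "l \<ge> (0::real)"
  shows "(LINT \<xi>:dyadic_block l|lborel. f \<xi> :: complex) =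
     integral {l..2*l} f + integral {l..2*l} (\<lambda>\<xi>. f (- \<xi>))"
proof -
  have si: "set_integrable lborel {a..b} f" for a b
    by (rule borel_integrable_atLeastAtMost') (rule continuous_on_subset[OF c], simp)
  have s1: "set_integrable lborel {l<..2*l} f" and s2: "set_integrable lborel {-(2*l)..<-l} f"
    by (rule set_integrable_subset[OF si[of l "2*l"]], auto) (rule set_integrable_subset[OF si[of "-(2*l)" "-l"]], auto)
  have "(LINT \<xi>:dyadic_block l|lborel. f \<xi>) = (LINT \<xi>:{l<..2*l}|lborel. f \<xi>) + (LINT \<xi>:{-(2*l)..<-l}|lborel. f \<xi>)"
    unfolding dyadic_block_eq[OF l] by (rule set_integral_Un[OF _ s1 s2]) (use l in auto)
  also have "(LINT \<xi>:{l<..2*l}|lborel. f \<xi>) = integral {l<..2*l} f"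
    by (rule set_borel_integral_eq_integral(2)[OF s1])
  also have "\<dots> = integral {l..2*l} f"
    by (rule integral_subset_negligible) (auto intro: negligible_subset[of "{l}"])
  also have "(LINT \<xi>:{-(2*l)..<-l}|lborel. f \<xi>) = integral {-(2*l)..<-l} f"
    by (rule set_borel_integral_eq_integral(2)[OF s2])
  also have "\<dots> = integral {-(2*l)..-l} f"
    by (rule integral_subset_negligible) (auto intro: negligible_subset[of "{-l}"])
  also have "\<dots> = integral {l..2*l} (\<lambda>\<xi>. f (- \<xi>))"
    using Henstock_Kurzweil_Integration.integral_reflect_real[of "2*l" l "\<lambda>\<xi>. f (- \<xi>)"] by simp
  finally show ?thesis .
qed

text \<open>
Negative frequencies are reflected to positive ones. Within distance \<open>8 / sqrt l\<close> of the diagonal only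
the length of the block is used; the integral over \<open>u\<close> of this part is of order \<open>sqrt l\<close>, like that of
the decaying part.
\<close>
lemma kernel_bound:
  assumes \<Phi>: "dispersive \<Phi> C1 C2" and l: "1 \<le> l" and M: "1 \<le> M"
    and z: "\<bar>z - u\<bar> \<le> M * \<bar>\<tau>\<bar> + 1 / sqrt l"
  shows "cmod (LINT \<xi>:dyadic_block l|lborel. cis (z * \<xi> + \<tau> * \<Phi> \<xi>)) \<le>
     2 * l * indicator {- (8 / sqrt l)..8 / sqrt l} u + 2 * kernel_const M C1 C2 * sqrt l / sqrt \<bar>u\<bar>"
proof -
  define \<Psi> where "\<Psi> = (\<lambda>x. \<Phi> (- x))"
  have \<Psi>: "dispersive \<Psi> C1 C2" unfolding \<Psi>_def by (rule dispersive_reflect[OF \<Phi>])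
  have c: "continuous_on A (\<lambda>\<xi>. cis (z * \<xi> + \<tau> * \<Phi> \<xi>))" for A
    by (intro continuous_intros dispersive_deriv(4)[OF \<Phi>])
  have "(LINT \<xi>:dyadic_block l|lborel. cis (z * \<xi> + \<tau> * \<Phi> \<xi>)) =
      integral {l..2*l} (\<lambda>\<xi>. cis (z * \<xi> + \<tau> * \<Phi> \<xi>)) + integral {l..2*l} (\<lambda>\<xi>. cis ((-z) * \<xi> + \<tau> * \<Psi> \<xi>))"
    using block_integral_split[OF c] l by (simp add: \<Psi>_def)
  hence le: "cmod (LINT \<xi>:dyadic_block l|lborel. cis (z * \<xi> + \<tau> * \<Phi> \<xi>)) \<le>
      cmod (integral {l..2*l} (\<lambda>\<xi>. cis (z * \<xi> + \<tau> * \<Phi> \<xi>))) + cmod (integral {l..2*l} (\<lambda>\<xi>. cis ((-z) * \<xi> + \<tau> * \<Psi> \<xi>)))"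
    by (simp only: norm_triangle_ineq)
  have C: "C1 > 0" "C2 > 0" using \<Phi> by (auto simp: dispersive_def)
  have k: "kernel_const M C1 C2 * sqrt l / sqrt \<bar>u\<bar> \<ge> 0" unfolding kernel_const_def using C M l by simp
  show ?thesis
  proof (cases "\<bar>u\<bar> \<ge> 8 / sqrt l")
    case True
    have z': "\<bar>- z - - u\<bar> \<le> M * \<bar>\<tau>\<bar> + 1 / sqrt l" using z by simp
    have u': "\<bar>- u\<bar> \<ge> 8 / sqrt l" using True by simp
    have i: "0 \<le> 2 * l * indicat_real {- (8 / sqrt l)..8 / sqrt l} u" using l by simp
    show ?thesis
      using le i block_integral_decay[OF \<Phi> l M z True] block_integral_decay[OF \<Psi> l M z' u'] by simp
  next
    case False
    have "cmod (integral {l..2*l} (\<lambda>\<xi>. cis (z * \<xi> + \<tau> * \<Phi> \<xi>))) \<le> 2*l - l"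
      by (rule norm_integral_cis_le) (use l in \<open>auto intro!: continuous_intros dispersive_deriv(4)[OF \<Phi>]\<close>)
    moreover have "cmod (integral {l..2*l} (\<lambda>\<xi>. cis ((-z) * \<xi> + \<tau> * \<Psi> \<xi>))) \<le> 2*l - l"
      by (rule norm_integral_cis_le) (use l in \<open>auto intro!: continuous_intros dispersive_deriv(4)[OF \<Psi>]\<close>)
    moreover have "indicat_real {- (8 / sqrt l)..8 / sqrt l} u = 1" using False by (subst indicator_simps(1)) (simp_all, linarith)
    ultimately show ?thesis using le k by simp
  qed
qed

section \<open>Schur's test and the method of T T*\<close>

lemma borel_measurable_cnj [measurable (raw)]:
  "f \<in> borel_measurable M \<Longrightarrow> (\<lambda>x. cnj (f x)) \<in> borel_measurable M"
  by (rule borel_measurable_continuous_on[of cnj]) (auto intro: continuous_intros)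

lemma borel_measurable_cis [measurable (raw)]:
  "f \<in> borel_measurable M \<Longrightarrow> (\<lambda>x. cis (f x)) \<in> borel_measurable M"
  by (rule borel_measurable_continuous_on[of cis]) (auto intro: continuous_intros)

text \<open>
The quadratic Schur test: bound \<open>f x * f y\<close> by the mean of the squares and use the symmetry of the
kernel.
\<close>
lemma Schur_test:
  fixes M :: "'a measure" and k :: "'a \<Rightarrow> 'a \<Rightarrow> real" and f :: "'a \<Rightarrow> real"
  assumes "sigma_finite_measure M"
    and k[measurable]: "(\<lambda>(x, y). k x y) \<in> borel_measurable (M \<Otimes>\<^sub>M M)"
    and k0: "\<And>x y. k x y \<ge> 0" and sym: "\<And>x y. k x y = k y x"
    and f[measurable]: "f \<in> borel_measurable M" and f0: "\<And>x. f x \<ge> 0"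
    and A: "\<And>x. x \<in> space M \<Longrightarrow> (\<integral>\<^sup>+y. ennreal (k x y) \<partial>M) \<le> A"
  shows "(\<integral>\<^sup>+x. \<integral>\<^sup>+y. ennreal (f x * f y * k x y) \<partial>M \<partial>M) \<le> A * (\<integral>\<^sup>+x. ennreal ((f x)\<^sup>2) \<partial>M)"
proof -
  interpret sigma_finite_measure M by fact
  interpret P: pair_sigma_finite M M by unfold_locales
  let ?J = "\<integral>\<^sup>+x. \<integral>\<^sup>+y. ennreal ((f x)\<^sup>2) * ennreal (k x y) \<partial>M \<partial>M"
  let ?h = "ennreal (1/2)"
  have J: "?J \<le> A * (\<integral>\<^sup>+x. ennreal ((f x)\<^sup>2) \<partial>M)"
  proof -
    have "?J = (\<integral>\<^sup>+x. ennreal ((f x)\<^sup>2) * (\<integral>\<^sup>+y. ennreal (k x y) \<partial>M) \<partial>M)"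
      by (intro nn_integral_cong nn_integral_cmult) simp
    also have "\<dots> \<le> (\<integral>\<^sup>+x. ennreal ((f x)\<^sup>2) * A \<partial>M)"
      by (intro nn_integral_mono mult_left_mono A) auto
    also have "\<dots> = A * (\<integral>\<^sup>+x. ennreal ((f x)\<^sup>2) \<partial>M)"
      by (subst nn_integral_multc) (simp_all add: mult.commute)
    finally show ?thesis .
  qed
  have J': "(\<integral>\<^sup>+x. \<integral>\<^sup>+y. ennreal ((f y)\<^sup>2) * ennreal (k x y) \<partial>M \<partial>M) = ?J"
    by (subst P.Fubini') (simp_all add: sym)
  have "(\<integral>\<^sup>+x. \<integral>\<^sup>+y. ennreal (f x * f y * k x y) \<partial>M \<partial>M)
      \<le> (\<integral>\<^sup>+x. \<integral>\<^sup>+y. ?h * (ennreal ((f x)\<^sup>2) * ennreal (k x y)) + ?h * (ennreal ((f y)\<^sup>2) * ennreal (k x y)) \<partial>M \<partial>M)"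
  proof (intro nn_integral_mono)
    fix x y
    have "f x * f y \<le> 1/2 * (f x)\<^sup>2 + 1/2 * (f y)\<^sup>2"
      using sum_squares_bound[of "f x" "f y"] by simp
    hence "f x * f y * k x y \<le> (1/2 * (f x)\<^sup>2 + 1/2 * (f y)\<^sup>2) * k x y"
      by (rule mult_right_mono[OF _ k0])
    hence "ennreal (f x * f y * k x y) \<le> ennreal (1/2 * ((f x)\<^sup>2 * k x y) + 1/2 * ((f y)\<^sup>2 * k x y))"
      by (intro ennreal_leI) (simp add: algebra_simps)
    also have "\<dots> = ?h * (ennreal ((f x)\<^sup>2) * ennreal (k x y)) + ?h * (ennreal ((f y)\<^sup>2) * ennreal (k x y))"
      using k0 by (simp only: ennreal_plus ennreal_mult mult_nonneg_nonneg zero_le_power2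
          zero_le_divide_1_iff zero_le_numeral)
    finally show "ennreal (f x * f y * k x y) \<le> \<dots>" .
  qed
  also have "\<dots> = ?h * ?J + ?h * ?J"
  proof -
    have [measurable]: "(\<lambda>y. k x y) \<in> borel_measurable M" if "x \<in> space M" for x
      using measurable_Pair2[OF k that] by simp
    have "(\<integral>\<^sup>+x. \<integral>\<^sup>+y. ?h * (ennreal ((f x)\<^sup>2) * ennreal (k x y)) + ?h * (ennreal ((f y)\<^sup>2) * ennreal (k x y)) \<partial>M \<partial>M)
      = (\<integral>\<^sup>+x. ?h * (\<integral>\<^sup>+y. ennreal ((f x)\<^sup>2) * ennreal (k x y) \<partial>M) + ?h * (\<integral>\<^sup>+y. ennreal ((f y)\<^sup>2) * ennreal (k x y) \<partial>M) \<partial>M)"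
    proof (rule nn_integral_cong)
      fix x assume x[measurable]: "x \<in> space M"
      show "(\<integral>\<^sup>+y. ?h * (ennreal ((f x)\<^sup>2) * ennreal (k x y)) + ?h * (ennreal ((f y)\<^sup>2) * ennreal (k x y)) \<partial>M)
        = ?h * (\<integral>\<^sup>+y. ennreal ((f x)\<^sup>2) * ennreal (k x y) \<partial>M) + ?h * (\<integral>\<^sup>+y. ennreal ((f y)\<^sup>2) * ennreal (k x y) \<partial>M)"
        by (subst nn_integral_add, measurable)+ (subst nn_integral_cmult, measurable)+
    qed
    also have "\<dots> = ?h * ?J + ?h * ?J"
      by (subst nn_integral_add, measurable)+ (subst nn_integral_cmult, measurable, simp add: J')+
    finally show ?thesis .
  qed
  also have "\<dots> = (?h + ?h) * ?J" by (rule distrib_right[symmetric])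
  also have "?h + ?h = 1" by (subst ennreal_plus[symmetric]) auto
  also have "1 * ?J = ?J" by simp
  also note J
  finally show ?thesis .
qed

lemma integrable_of_square_integrable:
  fixes w :: "'a \<Rightarrow> complex"
  assumes "finite_measure M" "w \<in> borel_measurable M" "integrable M (\<lambda>x. (cmod (w x))\<^sup>2)"
  shows "integrable M w"
proof -
  interpret finite_measure M by fact
  show ?thesis
  proof (rule Bochner_Integration.integrable_bound)
    show "integrable M (\<lambda>x. 1 + (cmod (w x))\<^sup>2)" using assms(3) by simp
    have "r \<le> 1 + r\<^sup>2" for r :: real
      using sum_squares_bound[of 1 r] zero_le_power2[of r] unfolding mult_1_right one_power2
      by linarith
    thus "AE x in M. norm (w x) \<le> norm (1 + (cmod (w x))\<^sup>2)" by simp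
  qed fact
qed

lemma borel_measurable_adjoint:
  fixes e :: "'a \<Rightarrow> 'b \<Rightarrow> complex" and w :: "'a \<Rightarrow> complex"
  assumes "sigma_finite_measure M"
    and e: "(\<lambda>(x, \<xi>). e x \<xi>) \<in> borel_measurable (M \<Otimes>\<^sub>M N)" and [measurable]: "w \<in> borel_measurable M"
  shows "(\<lambda>\<xi>. LINT x|M. w x * e x \<xi>) \<in> borel_measurable N"
proof -
  interpret M: sigma_finite_measure M by fact
  have "(\<lambda>(x,\<xi>). e x \<xi>) \<circ> (\<lambda>(\<xi>,x). (x,\<xi>)) \<in> borel_measurable (N \<Otimes>\<^sub>M M)"
    by (rule measurable_comp[OF _ e]) measurable
  hence [measurable]: "(\<lambda>(\<xi>,x). e x \<xi>) \<in> borel_measurable (N \<Otimes>\<^sub>M M)" by (simp add: o_def case_prod_beta')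
  have "(\<lambda>(\<xi>,x). w x * e x \<xi>) \<in> borel_measurable (N \<Otimes>\<^sub>M M)" by measurable
  thus ?thesis by (rule M.borel_measurable_lebesgue_integral)
qed

text \<open>
Up to complex conjugation the inner integral is \<open>T\<^sup>* w\<close>, where \<open>T\<close> has the kernel \<open>e\<close>. The square of
its norm is the quadratic form of the kernel of \<open>T T\<^sup>*\<close>, to which Schur's test applies. Finiteness
of both measures makes every interchange of integrals absolutely convergent.
\<close>
lemma TTstar_dual:
  fixes M :: "'a measure" and N :: "'b measure" and e :: "'a \<Rightarrow> 'b \<Rightarrow> complex" and w :: "'a \<Rightarrow> complex"
  assumes "finite_measure M" "finite_measure N"
    and e[measurable]: "(\<lambda>(x, \<xi>). e x \<xi>) \<in> borel_measurable (M \<Otimes>\<^sub>M N)"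
    and e1: "\<And>x \<xi>. cmod (e x \<xi>) \<le> 1"
    and w[measurable]: "w \<in> borel_measurable M" and w2: "integrable M (\<lambda>x. (cmod (w x))\<^sup>2)"
    and A: "\<And>x. x \<in> space M \<Longrightarrow> (\<integral>\<^sup>+y. ennreal (cmod (LINT \<xi>|N. e x \<xi> * cnj (e y \<xi>))) \<partial>M) \<le> ennreal A"
    and A0: "A \<ge> 0"
  shows "integrable N (\<lambda>\<xi>. (cmod (LINT x|M. w x * e x \<xi>))\<^sup>2)"
    and "(LINT \<xi>|N. (cmod (LINT x|M. w x * e x \<xi>))\<^sup>2) \<le> A * (LINT x|M. (cmod (w x))\<^sup>2)"
proof -
  interpret M: finite_measure M by fact
  interpret N: finite_measure N by fact
  interpret P: pair_sigma_finite M N by unfold_locales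
  have wi: "integrable M w" by (rule integrable_of_square_integrable) fact+
  define W where "W = (LINT x|M. cmod (w x))"
  define c where "c = (\<lambda>\<xi>. LINT x|M. w x * e x \<xi>)"
  define K where "K = (\<lambda>x y. LINT \<xi>|N. e x \<xi> * cnj (e y \<xi>))"
  have cm[measurable]: "c \<in> borel_measurable N"
    unfolding c_def by (rule borel_measurable_adjoint[OF M.sigma_finite_measure_axioms e w])
  have em: "(\<lambda>x. e x \<xi>) \<in> borel_measurable M" if "\<xi> \<in> space N" for \<xi>
    using measurable_Pair1[OF e that] by simp
  have em': "(\<lambda>\<xi>. e x \<xi>) \<in> borel_measurable N" if "x \<in> space M" for x
    using measurable_Pair2[OF e that] by simp
  have cb: "cmod (c \<xi>) \<le> W" for \<xi>
    unfolding c_def W_def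
  proof (rule order.trans[OF integral_norm_bound], rule integral_mono')
    show "integrable M (\<lambda>x. cmod (w x))" using wi by simp
    show "cmod (w x * e x \<xi>) \<le> cmod (w x)" for x
      using mult_left_mono[OF e1[of x \<xi>], of "cmod (w x)"] by (simp add: norm_mult)
  qed simp
  have Km[measurable]: "(\<lambda>(x, y). K x y) \<in> borel_measurable (M \<Otimes>\<^sub>M M)"
  proof -
    have 1: "(\<lambda>p. e (fst (fst p)) (snd p)) \<in> borel_measurable ((M \<Otimes>\<^sub>M M) \<Otimes>\<^sub>M N)"
      using measurable_compose[of "\<lambda>p. (fst (fst p), snd p)" _ "M \<Otimes>\<^sub>M N" "\<lambda>(x,\<xi>). e x \<xi>" borel, OF _ e] by simp
    have 2: "(\<lambda>p. e (snd (fst p)) (snd p)) \<in> borel_measurable ((M \<Otimes>\<^sub>M M) \<Otimes>\<^sub>M N)"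
      using measurable_compose[of "\<lambda>p. (snd (fst p), snd p)" _ "M \<Otimes>\<^sub>M N" "\<lambda>(x,\<xi>). e x \<xi>" borel, OF _ e] by simp
    have "(\<lambda>(q, \<xi>). e (fst q) \<xi> * cnj (e (snd q) \<xi>)) \<in> borel_measurable ((M \<Otimes>\<^sub>M M) \<Otimes>\<^sub>M N)"
      unfolding case_prod_beta by (intro borel_measurable_times borel_measurable_cnj 1 2)
    from N.borel_measurable_lebesgue_integral[OF this] show ?thesis
      by (simp add: K_def case_prod_beta)
  qed
  have W0: "W \<ge> 0" unfolding W_def by simp
  show int: "integrable N (\<lambda>\<xi>. (cmod (LINT x|M. w x * e x \<xi>))\<^sup>2)"
    unfolding c_def[symmetric]
    by (rule N.integrable_const_bound[where B = "W\<^sup>2"]) (use cb in \<open>auto intro!: power_mono simp: c_def\<close>)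
  have fub: "integrable (M \<Otimes>\<^sub>M N) (\<lambda>(x,\<xi>). w' x * b x \<xi>)"
    if w'[measurable]: "w' \<in> borel_measurable M" and w'w: "\<And>x. cmod (w' x) = cmod (w x)"
      and b[measurable]: "(\<lambda>(x, \<xi>). b x \<xi>) \<in> borel_measurable (M \<Otimes>\<^sub>M N)" and bB: "\<And>x \<xi>. cmod (b x \<xi>) \<le> B"
    for w' b B
  proof (rule Bochner_Integration.integrable_bound)
    have "integrable M (\<lambda>x. LINT \<xi>|N. norm (case (x, \<xi>) of (x, \<xi>) \<Rightarrow> cmod (w x) * B))"
      using wi by (simp add: abs_mult)
    thus "integrable (M \<Otimes>\<^sub>M N) (\<lambda>(x, \<xi>). cmod (w x) * B)"
      by (intro P.Fubini_integrable) auto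
    show "(\<lambda>(x,\<xi>). w' x * b x \<xi>) \<in> borel_measurable (M \<Otimes>\<^sub>M N)" by measurable
    have "cmod (w x) * cmod (b x \<xi>) \<le> \<bar>cmod (w x) * B\<bar>" for x \<xi>
      by (rule order.trans[OF mult_left_mono[OF bB]]) auto
    thus "AE p in M \<Otimes>\<^sub>M N. norm (case p of (x, \<xi>) \<Rightarrow> w' x * b x \<xi>) \<le> norm (case p of (x, \<xi>) \<Rightarrow> cmod (w x) * B)"
      by (auto simp: norm_mult w'w intro!: AE_I2)
  qed
  define D where "D = (\<lambda>x. LINT \<xi>|N. e x \<xi> * cnj (c \<xi>))"
  have f1: "integrable (M \<Otimes>\<^sub>M N) (\<lambda>(x,\<xi>). w x * (e x \<xi> * cnj (c \<xi>)))"
  proof (rule fub)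
    show "cmod (e x \<xi> * cnj (c \<xi>)) \<le> 1 * W" for x \<xi>
      unfolding norm_mult by (intro mult_mono e1) (use cb in auto)
  qed auto
  have wD: "integrable M (\<lambda>x. w x * D x)"
    using P.integrable_fst'[OF f1] by (simp add: D_def)
  have D: "D x = (LINT y|M. cnj (w y) * K x y)" and Ki: "integrable M (\<lambda>y. cnj (w y) * K x y)"
    if x: "x \<in> space M" for x
  proof -
    have [measurable]: "(\<lambda>\<xi>. e x \<xi>) \<in> borel_measurable N" by (rule em'[OF x])
    have f2: "integrable (M \<Otimes>\<^sub>M N) (\<lambda>(y,\<xi>). cnj (w y) * (e x \<xi> * cnj (e y \<xi>)))"
    proof (rule fub)
      show "cmod (e x \<xi> * cnj (e y \<xi>)) \<le> 1 * 1" for y \<xi>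
        unfolding norm_mult by (intro mult_mono) (use e1 in auto)
    qed auto
    show "integrable M (\<lambda>y. cnj (w y) * K x y)"
      using P.integrable_fst'[OF f2] by (simp add: K_def)
    have "D x = (LINT \<xi>|N. LINT y|M. cnj (w y) * (e x \<xi> * cnj (e y \<xi>)))"
      unfolding D_def
    proof (rule Bochner_Integration.integral_cong[OF refl])
      fix \<xi>
      have "cnj (c \<xi>) = (LINT y|M. cnj (w y) * cnj (e y \<xi>))"
        unfolding c_def by (simp flip: Bochner_Integration.integral_cnj)
      moreover have "(LINT y|M. cnj (w y) * (e x \<xi> * cnj (e y \<xi>))) = (LINT y|M. e x \<xi> * (cnj (w y) * cnj (e y \<xi>)))"
        by (rule Bochner_Integration.integral_cong) (simp_all add: mult_ac)
      ultimately show "e x \<xi> * cnj (c \<xi>) = (LINT y|M. cnj (w y) * (e x \<xi> * cnj (e y \<xi>)))"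
        by simp
    qed
    also have "\<dots> = (LINT y|M. LINT \<xi>|N. cnj (w y) * (e x \<xi> * cnj (e y \<xi>)))"
      by (rule P.Fubini_integral[OF f2])
    finally show "D x = (LINT y|M. cnj (w y) * K x y)" by (simp add: K_def)
  qed
  have "complex_of_real (LINT \<xi>|N. (cmod (c \<xi>))\<^sup>2) = (LINT \<xi>|N. c \<xi> * cnj (c \<xi>))"
    by (simp add: complex_norm_square[symmetric] flip: integral_complex_of_real of_real_power)
  also have "\<dots> = (LINT \<xi>|N. LINT x|M. w x * (e x \<xi> * cnj (c \<xi>)))"
    unfolding c_def[THEN fun_cong, of _, abs_def] by (simp add: algebra_simps flip: integral_mult_left_zero)
  also have "\<dots> = (LINT x|M. w x * D x)"
    unfolding D_def by (subst P.Fubini_integral[OF f1]) simp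
  finally have eq: "complex_of_real (LINT \<xi>|N. (cmod (c \<xi>))\<^sup>2) = (LINT x|M. w x * D x)" .
  have "ennreal (LINT \<xi>|N. (cmod (c \<xi>))\<^sup>2) = ennreal (cmod (complex_of_real (LINT \<xi>|N. (cmod (c \<xi>))\<^sup>2)))"
    by simp
  also have "\<dots> \<le> (\<integral>\<^sup>+x. ennreal (cmod (w x * D x)) \<partial>M)"
    unfolding eq by (rule integral_norm_bound_ennreal[OF wD])
  also have "\<dots> \<le> (\<integral>\<^sup>+x. \<integral>\<^sup>+y. ennreal (cmod (w x) * cmod (w y) * cmod (K x y)) \<partial>M \<partial>M)"
  proof (rule nn_integral_mono)
    fix x assume x: "x \<in> space M"
    have [measurable]: "(\<lambda>y. K x y) \<in> borel_measurable M" using measurable_Pair2[OF Km x] by simp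
    have "ennreal (cmod (w x * D x)) = ennreal (cmod (w x)) * ennreal (cmod (D x))"
      by (simp add: norm_mult ennreal_mult)
    also have "\<dots> \<le> ennreal (cmod (w x)) * (\<integral>\<^sup>+y. ennreal (cmod (cnj (w y) * K x y)) \<partial>M)"
      unfolding D[OF x] by (intro mult_left_mono integral_norm_bound_ennreal Ki[OF x]) simp
    also have "\<dots> = (\<integral>\<^sup>+y. ennreal (cmod (w x) * cmod (w y) * cmod (K x y)) \<partial>M)"
      by (subst nn_integral_cmult[symmetric]) (simp_all add: norm_mult mult.assoc flip: ennreal_mult)
    finally show "ennreal (cmod (w x * D x)) \<le> \<dots>" .
  qed
  also have "\<dots> \<le> ennreal A * (\<integral>\<^sup>+x. ennreal ((cmod (w x))\<^sup>2) \<partial>M)"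
  proof (rule Schur_test)
    show "sigma_finite_measure M" by unfold_locales
    show "cmod (K x y) = cmod (K y x)" for x y
    proof -
      have "K y x = cnj (K x y)" unfolding K_def by (simp add: mult.commute flip: Bochner_Integration.integral_cnj)
      thus ?thesis by simp
    qed
    show "(\<integral>\<^sup>+y. ennreal (cmod (K x y)) \<partial>M) \<le> ennreal A" if "x \<in> space M" for x
      unfolding K_def by (rule A[OF that])
  qed auto
  also have "\<dots> = ennreal A * ennreal (LINT x|M. (cmod (w x))\<^sup>2)"
    by (subst nn_integral_eq_integral[OF w2]) auto
  also have "\<dots> = ennreal (A * (LINT x|M. (cmod (w x))\<^sup>2))"
    using A0 by (simp add: ennreal_mult)
  finally have "(LINT \<xi>|N. (cmod (c \<xi>))\<^sup>2) \<le> A * (LINT x|M. (cmod (w x))\<^sup>2)"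
    using A0 by (subst (asm) ennreal_le_iff) auto
  thus "(LINT \<xi>|N. (cmod (LINT x|M. w x * e x \<xi>))\<^sup>2) \<le> A * (LINT x|M. (cmod (w x))\<^sup>2)"
    by (simp add: c_def)
qed

lemma Cauchy_Schwarz_LINT:
  fixes f g :: "'a \<Rightarrow> complex"
  assumes f[measurable]: "f \<in> borel_measurable M" and g[measurable]: "g \<in> borel_measurable M"
    and f2: "integrable M (\<lambda>x. (cmod (f x))\<^sup>2)" and g2: "integrable M (\<lambda>x. (cmod (g x))\<^sup>2)"
  shows "integrable M (\<lambda>x. f x * g x)"
    and "(cmod (LINT x|M. f x * g x))\<^sup>2 \<le> (LINT x|M. (cmod (f x))\<^sup>2) * (LINT x|M. (cmod (g x))\<^sup>2)"
proof -
  show i: "integrable M (\<lambda>x. f x * g x)"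
  proof (rule Bochner_Integration.integrable_bound)
    show "integrable M (\<lambda>x. (cmod (f x))\<^sup>2 + (cmod (g x))\<^sup>2)" using f2 g2 by simp
    have "r * s \<le> r\<^sup>2 + s\<^sup>2" if "r \<ge> 0" "s \<ge> 0" for r s :: real
      using sum_squares_bound[of r s] mult_nonneg_nonneg[OF that] by linarith
    thus "AE x in M. norm (f x * g x) \<le> norm ((cmod (f x))\<^sup>2 + (cmod (g x))\<^sup>2)"
      by (auto simp: norm_mult)
  qed auto
  have "cmod (LINT x|M. f x * g x) \<le> (LINT x|M. cmod (f x) * cmod (g x))"
    using integral_norm_bound[of M "\<lambda>x. f x * g x"] by (simp add: norm_mult)
  hence "(cmod (LINT x|M. f x * g x))\<^sup>2 \<le> (LINT x|M. cmod (f x) * cmod (g x))\<^sup>2"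
    by (intro power_mono) auto
  also have "\<dots> \<le> (LINT x|M. (cmod (f x))\<^sup>2) * (LINT x|M. (cmod (g x))\<^sup>2)"
  proof -
    have fg: "integrable M (\<lambda>x. cmod (f x) * cmod (g x))" using integrable_norm[OF i] by (simp add: norm_mult)
    define a where "a = (LINT x|M. (cmod (f x))\<^sup>2)"
    define b where "b = (LINT x|M. cmod (f x) * cmod (g x))"
    define d where "d = (LINT x|M. (cmod (g x))\<^sup>2)"
    have q: "0 \<le> a * t\<^sup>2 - 2 * b * t * s + d * s\<^sup>2" for t s :: real
    proof -
      have "0 \<le> (LINT x|M. (t * cmod (f x) - s * cmod (g x))\<^sup>2)" by simp
      also have "\<dots> = (LINT x|M. t\<^sup>2 * (cmod (f x))\<^sup>2 - (2 * t * s) * (cmod (f x) * cmod (g x)) + s\<^sup>2 * (cmod (g x))\<^sup>2)"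
        by (intro Bochner_Integration.integral_cong refl) (simp add: power2_eq_square algebra_simps)
      also have "\<dots> = t\<^sup>2 * a - (2 * t * s) * b + s\<^sup>2 * d"
        unfolding a_def b_def d_def using f2 g2 fg by simp
      finally show ?thesis by (simp add: algebra_simps)
    qed
    have ad: "a \<ge> 0" "d \<ge> 0" "b \<ge> 0" unfolding a_def d_def b_def by auto
    have "b\<^sup>2 \<le> a * d"
    proof (cases "a = 0")
      case True
      have "b = 0"
      proof (rule ccontr)
        assume "b \<noteq> 0"
        with ad have "b > 0" by simp
        from q[of "(d + 1) / b" 1] True this ad show False by simp
      qed
      thus ?thesis using True by simp
    next
      case False
      with ad have a: "a > 0" by simp
      from q[of b a] have "0 \<le> a * (a * d - b\<^sup>2)" by (simp add: power2_eq_square algebra_simps)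
      with a show ?thesis by (simp add: zero_le_mult_iff)
    qed
    thus ?thesis by (simp add: a_def b_def d_def)
  qed
  finally show "(cmod (LINT x|M. f x * g x))\<^sup>2 \<le> (LINT x|M. (cmod (f x))\<^sup>2) * (LINT x|M. (cmod (g x))\<^sup>2)" .
qed

text \<open>
Duality: testing \<open>T G\<close> against itself gives \<open>\<parallel>T G\<parallel>\<^sup>2 \<le> \<parallel>T\<^sup>* (T G)\<parallel> \<parallel>G\<parallel>\<close>, and the previous lemma bounds
the first factor by \<open>sqrt A \<parallel>T G\<parallel>\<close>.
\<close>
lemma TTstar:
  fixes M :: "'a measure" and N :: "'b measure" and e :: "'a \<Rightarrow> 'b \<Rightarrow> complex" and G :: "'b \<Rightarrow> complex"
  assumes fin: "finite_measure M" "finite_measure N"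
    and e[measurable]: "(\<lambda>(x, \<xi>). e x \<xi>) \<in> borel_measurable (M \<Otimes>\<^sub>M N)"
    and e1: "\<And>x \<xi>. cmod (e x \<xi>) \<le> 1"
    and G[measurable]: "G \<in> borel_measurable N" and G2: "integrable N (\<lambda>\<xi>. (cmod (G \<xi>))\<^sup>2)"
    and A: "\<And>x. x \<in> space M \<Longrightarrow> (\<integral>\<^sup>+y. ennreal (cmod (LINT \<xi>|N. e x \<xi> * cnj (e y \<xi>))) \<partial>M) \<le> ennreal A"
    and A0: "A \<ge> 0"
  shows "integrable M (\<lambda>x. (cmod (LINT \<xi>|N. e x \<xi> * G \<xi>))\<^sup>2)"
    and "(LINT x|M. (cmod (LINT \<xi>|N. e x \<xi> * G \<xi>))\<^sup>2) \<le> A * (LINT \<xi>|N. (cmod (G \<xi>))\<^sup>2)"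
proof -
  interpret M: finite_measure M by fact
  interpret N: finite_measure N by fact
  interpret P: pair_sigma_finite M N by unfold_locales
  have Gi: "integrable N G" by (rule integrable_of_square_integrable) fact+
  define W where "W = (LINT \<xi>|N. cmod (G \<xi>))"
  define T where "T = (\<lambda>x. LINT \<xi>|N. e x \<xi> * G \<xi>)"
  have T[measurable]: "T \<in> borel_measurable M"
    unfolding T_def by (rule N.borel_measurable_lebesgue_integral) measurable
  have Tb: "cmod (T x) \<le> W" for x
    unfolding T_def W_def
  proof (rule order.trans[OF integral_norm_bound], rule integral_mono')
    show "integrable N (\<lambda>x. cmod (G x))" using Gi by simp
    show "cmod (e x \<xi> * G \<xi>) \<le> cmod (G \<xi>)" for \<xi>
      using mult_right_mono[OF e1[of x \<xi>], of "cmod (G \<xi>)"] by (simp add: norm_mult)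
  qed simp
  have T2: "integrable M (\<lambda>x. (cmod (T x))\<^sup>2)"
    by (rule M.integrable_const_bound[where B = "W\<^sup>2"]) (use Tb in \<open>auto intro!: power_mono\<close>)
  thus "integrable M (\<lambda>x. (cmod (LINT \<xi>|N. e x \<xi> * G \<xi>))\<^sup>2)" by (simp add: T_def)
  define w where "w = (\<lambda>x. cnj (T x))"
  have w[measurable]: "w \<in> borel_measurable M" by (simp add: w_def)
  have w2: "integrable M (\<lambda>x. (cmod (w x))\<^sup>2)" using T2 by (simp add: w_def)
  define c where "c = (\<lambda>\<xi>. LINT x|M. w x * e x \<xi>)"
  have dual: "integrable N (\<lambda>\<xi>. (cmod (c \<xi>))\<^sup>2)"
    "(LINT \<xi>|N. (cmod (c \<xi>))\<^sup>2) \<le> A * (LINT x|M. (cmod (w x))\<^sup>2)"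
    unfolding c_def by (rule TTstar_dual[OF fin e e1 w w2 A A0], assumption)+
  have cm[measurable]: "c \<in> borel_measurable N"
    unfolding c_def by (rule borel_measurable_adjoint[OF M.sigma_finite_measure_axioms e w])
  have f: "integrable (M \<Otimes>\<^sub>M N) (\<lambda>(x,\<xi>). w x * (e x \<xi> * G \<xi>))"
  proof (rule Bochner_Integration.integrable_bound)
    have "integrable (M \<Otimes>\<^sub>M N) (\<lambda>(x, \<xi>). W * cmod (G \<xi>))"
      using Gi by (intro P.Fubini_integrable) (auto simp: abs_mult)
    thus "integrable (M \<Otimes>\<^sub>M N) (\<lambda>(x, \<xi>). W * cmod (G \<xi>))" .
    show "(\<lambda>(x,\<xi>). w x * (e x \<xi> * G \<xi>)) \<in> borel_measurable (M \<Otimes>\<^sub>M N)" by measurable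
    have "cmod (w x) * (cmod (e x \<xi>) * cmod (G \<xi>)) \<le> \<bar>W * cmod (G \<xi>)\<bar>" for x \<xi>
    proof -
      have "cmod (w x) * (cmod (e x \<xi>) * cmod (G \<xi>)) \<le> W * (1 * cmod (G \<xi>))"
        by (intro mult_mono e1) (use Tb[of x] order.trans[OF norm_ge_zero Tb[of x]] in \<open>auto simp: w_def\<close>)
      thus ?thesis by simp
    qed
    thus "AE p in M \<Otimes>\<^sub>M N. norm (case p of (x, \<xi>) \<Rightarrow> w x * (e x \<xi> * G \<xi>)) \<le> norm (case p of (x, \<xi>) \<Rightarrow> W * cmod (G \<xi>))"
      by (auto simp: norm_mult intro!: AE_I2)
  qed
  define X where "X = (LINT x|M. (cmod (T x))\<^sup>2)"
  define Y where "Y = (LINT \<xi>|N. (cmod (G \<xi>))\<^sup>2)"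
  have X0: "X \<ge> 0" and Y0: "Y \<ge> 0" by (auto simp: X_def Y_def)
  have "complex_of_real X = (LINT x|M. w x * T x)"
    unfolding X_def w_def by (simp add: complex_norm_square[symmetric] mult.commute[of "cnj _"] flip: integral_complex_of_real of_real_power)
  also have "\<dots> = (LINT x|M. LINT \<xi>|N. w x * (e x \<xi> * G \<xi>))"
    unfolding T_def[THEN fun_cong, of _, abs_def] by simp
  also have "\<dots> = (LINT \<xi>|N. LINT x|M. w x * (e x \<xi> * G \<xi>))"
    by (rule P.Fubini_integral[OF f, symmetric])
  also have "\<dots> = (LINT \<xi>|N. c \<xi> * G \<xi>)"
    unfolding c_def by (simp add: mult.assoc[symmetric])
  finally have "X = cmod (LINT \<xi>|N. c \<xi> * G \<xi>)" using X0 by (metis abs_of_nonneg norm_of_real)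
  hence "X\<^sup>2 \<le> (LINT \<xi>|N. (cmod (c \<xi>))\<^sup>2) * Y"
    unfolding Y_def using Cauchy_Schwarz_LINT(2)[OF cm G dual(1) G2] by simp
  also have "\<dots> \<le> (A * X) * Y"
    using dual(2) Y0 unfolding X_def w_def by (intro mult_right_mono) auto
  finally have "X * X \<le> X * (A * Y)" by (simp add: power2_eq_square algebra_simps)
  hence "X \<le> A * Y" using X0 A0 Y0 by (cases "X = 0") auto
  thus "(LINT x|M. (cmod (LINT \<xi>|N. e x \<xi> * G \<xi>))\<^sup>2) \<le> A * (LINT \<xi>|N. (cmod (G \<xi>))\<^sup>2)"
    by (simp add: X_def Y_def T_def)
qed

section \<open>Maximal estimates for a dyadic block\<close>

lemma nn_integral_inverse_sqrt:
  assumes a: "a \<ge> 0"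
  shows "(\<integral>\<^sup>+u. ennreal (indicator {-a..a} u / sqrt \<bar>u\<bar>) \<partial>lborel) \<le> ennreal (4 * sqrt a)"
proof -
  define f where "f = (\<lambda>u::real. ennreal (u powr (-1/2)) * indicator {0..a} u)"
  have fm[measurable]: "f \<in> borel_measurable borel" unfolding f_def by measurable
  have "((\<lambda>u. u powr (-1/2)) has_integral (a powr (-1/2 + 1) / (-1/2 + 1))) {0..a}"
    by (rule has_integral_powr_from_0[OF _ a]) simp
  hence "((\<lambda>u. u powr (-1/2)) has_integral (2 * sqrt a)) {0..a}"
    using a by (simp add: powr_half_sqrt mult.commute)
  hence I: "(\<integral>\<^sup>+u. f u \<partial>lborel) = ennreal (2 * sqrt a)"
    unfolding f_def by (intro nn_integral_has_integral_lebesgue') auto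
  have I': "(\<integral>\<^sup>+u. f (- u) \<partial>lborel) = ennreal (2 * sqrt a)"
    using nn_integral_real_affine[OF fm, of "-1" 0] I by simp
  have "(\<integral>\<^sup>+u. ennreal (indicator {-a..a} u / sqrt \<bar>u\<bar>) \<partial>lborel) \<le> (\<integral>\<^sup>+u. f u + f (- u) \<partial>lborel)"
  proof (rule nn_integral_mono)
    fix u :: real
    have s: "1 / sqrt v = v powr (-1/2)" if "v \<ge> 0" for v
      using powr_minus[of v "1/2"] powr_half_sqrt[OF that] by (simp add: inverse_eq_divide)
    show "ennreal (indicator {-a..a} u / sqrt \<bar>u\<bar>) \<le> f u + f (- u)"
      using s[of u] s[of "-u"] by (cases "u \<ge> 0") (auto simp: f_def indicator_def split: if_splits)
  qed
  also have "\<dots> = ennreal (2 * sqrt a) + ennreal (2 * sqrt a)"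
    by (subst nn_integral_add) (simp_all add: I I')
  also have "\<dots> = ennreal (4 * sqrt a)" using a by (subst ennreal_plus[symmetric]) auto
  finally show ?thesis .
qed

text \<open>
Without the factor \<open>1 / (2 pi)\<close>, and for an arbitrary set of frequencies, so that dyadic blocks and
the partial integrals of the evolution are both instances.
\<close>
definition wave :: "(real \<Rightarrow> real) \<Rightarrow> (real \<Rightarrow> complex) \<Rightarrow> real set \<Rightarrow> real \<Rightarrow> real \<Rightarrow> complex" where
  "wave \<Phi> g E y t = (LINT \<xi>:E|lborel. cis (y * \<xi> + t * \<Phi> \<xi>) * g \<xi>)"

lemma wave_measurable [measurable (raw)]:
  assumes [measurable]: "\<Phi> \<in> borel_measurable borel" "g \<in> borel_measurable borel" "E \<in> sets borel"
    and [measurable]: "a \<in> borel_measurable M" "b \<in> borel_measurable M"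
  shows "(\<lambda>x. wave \<Phi> g E (a x) (b x)) \<in> borel_measurable M"
  unfolding wave_def set_lebesgue_integral_def
  by (rule lborel.borel_measurable_lebesgue_integral) measurable

lemma dispersive_measurable: "dispersive \<Phi> C1 C2 \<Longrightarrow> \<Phi> \<in> borel_measurable borel"
  by (rule borel_measurable_continuous_onI) (rule dispersive_deriv(4))

definition maximal_const :: "real \<Rightarrow> real \<Rightarrow> real \<Rightarrow> real \<Rightarrow> real" where
  "maximal_const R B C1 C2 = 32 + 8 * kernel_const B C1 C2 * sqrt (2 * R)"

lemma kernel_const_nonneg: "dispersive \<Phi> C1 C2 \<Longrightarrow> 1 \<le> B \<Longrightarrow> kernel_const B C1 C2 \<ge> 0"
  unfolding kernel_const_def dispersive_def by simp

text \<open>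
The strip around the diagonal contributes \<open>2 l * 16 / sqrt l\<close>, and the integrable singularity
\<open>1 / sqrt \<bar>u\<bar>\<close> on \<open>[-2R, 2R]\<close> contributes the rest; both are of order \<open>sqrt l\<close>.
\<close>
lemma nn_integral_kernel_majorant:
  assumes \<Phi>: "dispersive \<Phi> C1 C2" and l: "1 \<le> l" and B: "1 \<le> B" and R: "R \<ge> 0" and x: "x \<in> {-R..R}"
  shows "(\<integral>\<^sup>+y. ennreal (2 * l * indicator {- (8 / sqrt l)..8 / sqrt l} (x - y)
       + 2 * kernel_const B C1 C2 * sqrt l / sqrt \<bar>x - y\<bar>) * indicator {-R..R} y \<partial>lborel)
     \<le> ennreal (maximal_const R B C1 C2 * sqrt l)"
proof -
  define k where "k = kernel_const B C1 C2"
  have k: "k \<ge> 0" unfolding k_def by (rule kernel_const_nonneg[OF \<Phi> B])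
  define d where "d = 8 / sqrt l"
  have d: "d \<ge> 0" using l by (simp add: d_def)
  define h where "h = (\<lambda>u. ennreal (2 * l) * indicator {-d..d} u
      + ennreal (2 * k * sqrt l) * ennreal (indicator {-(2*R)..2*R} u / sqrt \<bar>u\<bar>))"
  have hm[measurable]: "h \<in> borel_measurable borel" unfolding h_def by measurable
  have h: "h u = ennreal (2 * l * indicator {-d..d} u + 2 * k * sqrt l * (indicator {-(2*R)..2*R} u / sqrt \<bar>u\<bar>))" for u
  proof -
    have nn: "0 \<le> 2 * l" "0 \<le> 2 * k * sqrt l" "0 \<le> indicat_real {-d..d} u"
      "0 \<le> indicat_real {-(2*R)..2*R} u / sqrt \<bar>u\<bar>" using l k by auto
    show ?thesis unfolding h_def
      by (simp only: ennreal_plus[OF mult_nonneg_nonneg[OF nn(1,3)] mult_nonneg_nonneg[OF nn(2,4)]]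
          ennreal_mult[OF nn(1,3)] ennreal_mult[OF nn(2,4)] ennreal_indicator)
  qed
  have "(\<integral>\<^sup>+y. ennreal (2 * l * indicator {- d..d} (x - y) + 2 * k * sqrt l / sqrt \<bar>x - y\<bar>) * indicator {-R..R} y \<partial>lborel)
      \<le> (\<integral>\<^sup>+y. h (x + (-1) * y) \<partial>lborel)"
  proof (rule nn_integral_mono)
    fix y :: real
    show "ennreal (2 * l * indicator {- d..d} (x - y) + 2 * k * sqrt l / sqrt \<bar>x - y\<bar>) * indicator {-R..R} y
       \<le> h (x + (-1) * y)"
    proof (cases "y \<in> {-R..R}")
      case True
      with x have "x - y \<in> {-(2*R)..2*R}" by auto
      thus ?thesis using True by (simp add: h)
    qed simp
  qed
  also have "\<dots> = (\<integral>\<^sup>+u. h u \<partial>lborel)"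
    using nn_integral_real_affine[OF hm, of "-1" x] by simp
  also have "\<dots> = ennreal (2 * l) * emeasure lborel {-d..d}
      + ennreal (2 * k * sqrt l) * (\<integral>\<^sup>+u. ennreal (indicator {-(2*R)..2*R} u / sqrt \<bar>u\<bar>) \<partial>lborel)"
    unfolding h_def by (subst nn_integral_add) (simp_all add: nn_integral_cmult)
  also have "\<dots> \<le> ennreal (2 * l) * ennreal (2 * d) + ennreal (2 * k * sqrt l) * ennreal (4 * sqrt (2 * R))"
    by (intro add_mono mult_left_mono nn_integral_inverse_sqrt) (use d R in auto)
  also have "\<dots> = ennreal (2 * l * (2 * d) + 2 * k * sqrt l * (4 * sqrt (2 * R)))"
  proof -
    have nn: "0 \<le> 2 * l" "0 \<le> 2 * d" "0 \<le> 2 * k * sqrt l" "0 \<le> 4 * sqrt (2 * R)" using l d k R by auto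
    show ?thesis
      by (simp only: ennreal_plus[OF mult_nonneg_nonneg[OF nn(1,2)] mult_nonneg_nonneg[OF nn(3,4)]]
          ennreal_mult[OF nn(1,2)] ennreal_mult[OF nn(3,4)])
  qed
  also have "2 * l * (2 * d) = 32 * sqrt l"
  proof -
    have "2 * l * (2 * d) = 32 * (l / sqrt l)" by (simp add: d_def)
    thus ?thesis using real_div_sqrt[of l] l by simp
  qed
  finally show ?thesis by (simp add: k_def d_def maximal_const_def algebra_simps)
qed

text \<open>
Instead of taking a supremum, the time \<open>t\<close> and the direction \<open>\<theta>\<close> are chosen as measurable functions of
the point \<open>x\<close>. The constant does not depend on the choice, so the bound is one for the maximal
function. Directions within \<open>1 / sqrt l\<close> of each other are what the kernel bound tolerates.
\<close>
lemma linearized_maximal_estimate: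
  fixes t \<theta> :: "real \<Rightarrow> real"
  assumes \<Phi>: "dispersive \<Phi> C1 C2" and l: "1 \<le> l" and B: "1 \<le> B" and R: "R \<ge> 0"
    and [measurable]: "t \<in> borel_measurable borel" "\<theta> \<in> borel_measurable borel" "g \<in> borel_measurable borel"
    and t1: "\<And>x. \<bar>t x\<bar> \<le> 1" and \<theta>B: "\<And>x. \<bar>\<theta> x\<bar> \<le> B" and near: "\<And>x y. \<bar>\<theta> x - \<theta> y\<bar> \<le> 1 / sqrt l"
    and g2: "set_integrable lborel (dyadic_block l) (\<lambda>\<xi>. (cmod (g \<xi>))\<^sup>2)"
  shows "(\<integral>\<^sup>+x\<in>{-R..R}. ennreal ((cmod (wave \<Phi> g (dyadic_block l) (x + t x * \<theta> x) (t x)))\<^sup>2) \<partial>lborel)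
    \<le> ennreal (maximal_const R B C1 C2 * sqrt l * (LINT \<xi>:dyadic_block l|lborel. (cmod (g \<xi>))\<^sup>2))"
proof -
  note [measurable] = dispersive_measurable[OF \<Phi>]
  define M where "M = restrict_space lborel {-R..R}"
  define N where "N = restrict_space lborel (dyadic_block l)"
  define e where "e = (\<lambda>x \<xi>. cis ((x + t x * \<theta> x) * \<xi> + t x * \<Phi> \<xi>))"
  define A where "A = maximal_const R B C1 C2 * sqrt l"
  have A0: "A \<ge> 0" using kernel_const_nonneg[OF \<Phi> B] l R by (simp add: A_def maximal_const_def)
  have finM: "finite_measure M"
    unfolding M_def
    by (rule finite_measureI) (simp add: emeasure_restrict_space space_restrict_space emeasure_lborel_Icc_eq)
  have finN: "finite_measure N"
  proof -
    have "emeasure lborel (dyadic_block l) \<le> emeasure lborel {-(2*l)..2*l}"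
      by (rule emeasure_mono) (auto simp: dyadic_block_def)
    also have "\<dots> < \<infinity>" by (simp add: emeasure_lborel_Icc_eq)
    finally show ?thesis
      unfolding N_def by (intro finite_measureI) (simp add: emeasure_restrict_space space_restrict_space)
  qed
  have idM: "(\<lambda>x. x) \<in> measurable M borel" and idN: "(\<lambda>x. x) \<in> measurable N borel"
    unfolding M_def N_def by (auto intro!: measurable_restrict_space1)
  have em[measurable]: "(\<lambda>(x, \<xi>). e x \<xi>) \<in> borel_measurable (M \<Otimes>\<^sub>M N)"
  proof -
    have 1: "(\<lambda>p. (fst p, snd p)) \<in> measurable (M \<Otimes>\<^sub>M N) (borel \<Otimes>\<^sub>M borel)"
      by (intro measurable_Pair measurable_compose[OF measurable_fst idM] measurable_compose[OF measurable_snd idN])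
    have 2: "(\<lambda>(x, \<xi>). e x \<xi>) \<in> borel_measurable (borel \<Otimes>\<^sub>M borel)"
      unfolding e_def by measurable
    show ?thesis using measurable_compose[OF 1 2] by (simp add: case_prod_beta)
  qed
  have gN: "g \<in> borel_measurable N" unfolding N_def by (auto intro!: measurable_restrict_space1)
  have g2N: "integrable N (\<lambda>\<xi>. (cmod (g \<xi>))\<^sup>2)"
    unfolding N_def using g2 by (subst integrable_restrict_space) (auto simp: set_integrable_def)
  have K: "(\<integral>\<^sup>+y. ennreal (cmod (LINT \<xi>|N. e x \<xi> * cnj (e y \<xi>))) \<partial>M) \<le> ennreal A"
    if "x \<in> space M" for x
  proof -
    have x: "x \<in> {-R..R}" using that by (simp add: M_def space_restrict_space)
    have le: "cmod (LINT \<xi>|N. e x \<xi> * cnj (e y \<xi>)) \<le> 2 * l * indicator {- (8 / sqrt l)..8 / sqrt l} (x - y)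
       + 2 * kernel_const B C1 C2 * sqrt l / sqrt \<bar>x - y\<bar>" for y
    proof -
      define z where "z = (x + t x * \<theta> x) - (y + t y * \<theta> y)"
      have "(LINT \<xi>|N. e x \<xi> * cnj (e y \<xi>)) = (LINT \<xi>:dyadic_block l|lborel. cis (z * \<xi> + (t x - t y) * \<Phi> \<xi>))"
        unfolding N_def set_lebesgue_integral_def
        by (subst integral_restrict_space) (simp_all add: e_def z_def cis_cnj cis_mult algebra_simps)
      moreover have "\<bar>z - (x - y)\<bar> \<le> B * \<bar>t x - t y\<bar> + 1 / sqrt l"
      proof -
        have "z - (x - y) = (t x - t y) * \<theta> x + t y * (\<theta> x - \<theta> y)" by (simp add: z_def algebra_simps)
        hence "\<bar>z - (x - y)\<bar> \<le> \<bar>t x - t y\<bar> * \<bar>\<theta> x\<bar> + \<bar>t y\<bar> * \<bar>\<theta> x - \<theta> y\<bar>"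
          by (metis abs_mult abs_triangle_ineq)
        also have "\<dots> \<le> \<bar>t x - t y\<bar> * B + 1 * (1 / sqrt l)"
          by (intro add_mono mult_mono t1 \<theta>B near) auto
        finally show ?thesis by (simp add: mult.commute)
      qed
      ultimately show ?thesis using kernel_bound[OF \<Phi> l B] by simp
    qed
    have "(\<integral>\<^sup>+y. ennreal (cmod (LINT \<xi>|N. e x \<xi> * cnj (e y \<xi>))) \<partial>M)
       \<le> (\<integral>\<^sup>+y. ennreal (2 * l * indicator {- (8 / sqrt l)..8 / sqrt l} (x - y)
       + 2 * kernel_const B C1 C2 * sqrt l / sqrt \<bar>x - y\<bar>) \<partial>M)"
      by (intro nn_integral_mono ennreal_leI le)
    also have "\<dots> \<le> ennreal A"
      unfolding M_def A_def
      by (subst nn_integral_restrict_space) (use nn_integral_kernel_majorant[OF \<Phi> l B R x] in auto)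
    finally show ?thesis .
  qed
  have w: "wave \<Phi> g (dyadic_block l) (x + t x * \<theta> x) (t x) = (LINT \<xi>|N. e x \<xi> * g \<xi>)" for x
    unfolding wave_def N_def e_def set_lebesgue_integral_def by (subst integral_restrict_space) simp_all
  have e1: "cmod (e x \<xi>) \<le> 1" for x \<xi> by (simp add: e_def)
  note T = TTstar[OF finM finN em e1 gN g2N K A0]
  have "(\<integral>\<^sup>+x\<in>{-R..R}. ennreal ((cmod (wave \<Phi> g (dyadic_block l) (x + t x * \<theta> x) (t x)))\<^sup>2) \<partial>lborel)
     = (\<integral>\<^sup>+x. ennreal ((cmod (LINT \<xi>|N. e x \<xi> * g \<xi>))\<^sup>2) \<partial>M)"
    unfolding M_def w by (subst nn_integral_restrict_space) simp_all
  also have "\<dots> = ennreal (LINT x|M. (cmod (LINT \<xi>|N. e x \<xi> * g \<xi>))\<^sup>2)"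
    by (rule nn_integral_eq_integral[OF T(1)]) auto
  also have "\<dots> \<le> ennreal (A * (LINT \<xi>|N. (cmod (g \<xi>))\<^sup>2))"
    by (rule ennreal_leI[OF T(2)])
  also have "(LINT \<xi>|N. (cmod (g \<xi>))\<^sup>2) = (LINT \<xi>:dyadic_block l|lborel. (cmod (g \<xi>))\<^sup>2)"
    unfolding N_def set_lebesgue_integral_def by (subst integral_restrict_space) simp_all
  finally show ?thesis by (simp add: A_def)
qed

text \<open>
In every pair the first component is a time and the second one a direction.
\<close>
definition near_pairs :: "real \<Rightarrow> real \<Rightarrow> (real \<times> real) set \<Rightarrow> bool" where
  "near_pairs \<delta> B S \<longleftrightarrow> S \<subseteq> {-1..1} \<times> {-B..B} \<and> (\<forall>p\<in>S. \<forall>q\<in>S. \<bar>snd p - snd q\<bar> \<le> \<delta>)"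

abbreviation wave_sq :: "(real \<Rightarrow> real) \<Rightarrow> (real \<Rightarrow> complex) \<Rightarrow> real set \<Rightarrow> real \<times> real \<Rightarrow> real \<Rightarrow> ennreal" where
  "wave_sq \<Phi> g E p x \<equiv> ennreal ((cmod (wave \<Phi> g E (x + fst p * snd p) (fst p)))\<^sup>2)"

text \<open>
For finitely many pairs the maximum is attained at a measurable index, namely the least maximising
one, and the linearised estimate applies to it. Monotone convergence exhausts the countable set.
\<close>
lemma maximal_estimate_countable:
  assumes \<Phi>: "dispersive \<Phi> C1 C2" and l: "1 \<le> l" and B: "1 \<le> B" and R: "R \<ge> 0"
    and [measurable]: "g \<in> borel_measurable borel"
    and g2: "set_integrable lborel (dyadic_block l) (\<lambda>\<xi>. (cmod (g \<xi>))\<^sup>2)"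
    and S: "countable S" "near_pairs (1 / sqrt l) B S"
  shows "(\<integral>\<^sup>+x\<in>{-R..R}. (SUP p\<in>S. wave_sq \<Phi> g (dyadic_block l) p x) \<partial>lborel)
    \<le> ennreal (maximal_const R B C1 C2 * sqrt l * (LINT \<xi>:dyadic_block l|lborel. (cmod (g \<xi>))\<^sup>2))"
    (is "_ \<le> ?C")
proof (cases "S = {}")
  case False
  note [measurable] = dispersive_measurable[OF \<Phi>]
  define p where "p = from_nat_into S"
  have pS: "range p = S" unfolding p_def by (rule range_from_nat_into[OF False S(1)])
  define F where "F = (\<lambda>k x. (cmod (wave \<Phi> g (dyadic_block l) (x + fst (p k) * snd (p k)) (fst (p k))))\<^sup>2)"
  have Fm[measurable]: "F k \<in> borel_measurable borel" for k unfolding F_def by measurable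
  have fin: "(\<integral>\<^sup>+x\<in>{-R..R}. (SUP k\<in>{..m}. ennreal (F k x)) \<partial>lborel) \<le> ?C" for m
  proof -
    \<comment> \<open>Ties are broken by the least index to keep the selection measurable.\<close>
    define \<kappa> where "\<kappa> = (\<lambda>x. LEAST k. k \<le> m \<and> (\<forall>j\<in>{..m}. F j x \<le> F k x))"
    have \<kappa>m[measurable]: "\<kappa> \<in> measurable borel (count_space UNIV)" unfolding \<kappa>_def by measurable
    have \<kappa>: "F j x \<le> F (\<kappa> x) x" if "j \<le> m" for j x
    proof -
      have "\<exists>k. k \<le> m \<and> (\<forall>j\<in>{..m}. F j x \<le> F k x)"
      proof -
        have "Max ((\<lambda>j. F j x) ` {..m}) \<in> (\<lambda>j. F j x) ` {..m}" by (rule Max_in) auto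
        then obtain k where k: "k \<in> {..m}" "Max ((\<lambda>j. F j x) ` {..m}) = F k x" by (rule imageE)
        have "F j x \<le> F k x" if "j \<in> {..m}" for j unfolding k(2)[symmetric] by (rule Max_ge) (use that in auto)
        with k(1) show ?thesis by auto
      qed
      from LeastI_ex[OF this] that show ?thesis unfolding \<kappa>_def by auto
    qed
    have pin: "p k \<in> S" for k using pS by auto
    have pk: "\<bar>fst (p k)\<bar> \<le> 1" "\<bar>snd (p k)\<bar> \<le> B" "\<bar>snd (p k) - snd (p j)\<bar> \<le> 1 / sqrt l" for k j
      using pin[of k] pin[of j] S(2) unfolding near_pairs_def by (auto simp: abs_le_iff)
    have m1: "(\<lambda>x. fst (p (\<kappa> x))) \<in> borel_measurable borel" "(\<lambda>x. snd (p (\<kappa> x))) \<in> borel_measurable borel"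
      by (rule measurable_compose[OF \<kappa>m], simp)+
    have "(SUP k\<in>{..m}. ennreal (F k x)) \<le> ennreal (F (\<kappa> x) x)" for x
      by (rule SUP_least) (use \<kappa> in \<open>auto intro: ennreal_leI\<close>)
    hence "(\<integral>\<^sup>+x\<in>{-R..R}. (SUP k\<in>{..m}. ennreal (F k x)) \<partial>lborel) \<le> (\<integral>\<^sup>+x\<in>{-R..R}. ennreal (F (\<kappa> x) x) \<partial>lborel)"
      by (intro nn_integral_mono mult_right_mono) auto
    also have "\<dots> \<le> ?C" unfolding F_def
      by (rule linearized_maximal_estimate[OF \<Phi> l B R m1 _ pk g2]) measurable
    finally show ?thesis .
  qed
  have "(\<integral>\<^sup>+x\<in>{-R..R}. (SUP p\<in>S. wave_sq \<Phi> g (dyadic_block l) p x) \<partial>lborel)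
    = (\<integral>\<^sup>+x. (SUP m. (SUP k\<in>{..m}. ennreal (F k x)) * indicator {-R..R} x) \<partial>lborel)"
  proof (rule nn_integral_cong)
    fix x :: real
    have "(SUP p\<in>S. wave_sq \<Phi> g (dyadic_block l) p x) = (SUP k. ennreal (F k x))"
      unfolding pS[symmetric] by (simp add: F_def image_image)
    also have "\<dots> = (SUP m. SUP k\<in>{..m}. ennreal (F k x))"
    proof (rule antisym)
      show "(SUP k. ennreal (F k x)) \<le> (SUP m. SUP k\<in>{..m}. ennreal (F k x))"
      proof (rule SUP_least)
        fix k
        have "ennreal (F k x) \<le> (SUP j\<in>{..k}. ennreal (F j x))" by (rule SUP_upper) simp
        also have "\<dots> \<le> (SUP m. SUP k\<in>{..m}. ennreal (F k x))" by (rule SUP_upper) simp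
        finally show "ennreal (F k x) \<le> (SUP m. SUP k\<in>{..m}. ennreal (F k x))" .
      qed
      show "(SUP m. SUP k\<in>{..m}. ennreal (F k x)) \<le> (SUP k. ennreal (F k x))"
        by (intro SUP_least) (rule SUP_upper, simp)
    qed
    finally show "(SUP p\<in>S. wave_sq \<Phi> g (dyadic_block l) p x) * indicator {-R..R} x
        = (SUP m. (SUP k\<in>{..m}. ennreal (F k x)) * indicator {-R..R} x)"
      by (simp add: SUP_mult_right_ennreal)
  qed
  also have "\<dots> = (SUP m. \<integral>\<^sup>+x\<in>{-R..R}. (SUP k\<in>{..m}. ennreal (F k x)) \<partial>lborel)"
  proof (rule nn_integral_monotone_convergence_SUP)
    show "incseq (\<lambda>m x. (SUP k\<in>{..m}. ennreal (F k x)) * indicator {-R..R} x)"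
      by (intro incseq_SucI le_funI mult_right_mono SUP_subset_mono) auto
  qed measurable
  also have "\<dots> \<le> ?C" by (intro SUP_least fin)
  finally show ?thesis .
qed (simp add: bot_ennreal)

text \<open>
The supremum over all directions is at most the sum of the suprema over the pieces of a covering.
\<close>
lemma maximal_estimate_covering:
  assumes \<Phi>: "dispersive \<Phi> C1 C2" and l: "1 \<le> l" and B: "1 \<le> B" and R: "R \<ge> 0"
    and [measurable]: "g \<in> borel_measurable borel"
    and g2: "set_integrable lborel (dyadic_block l) (\<lambda>\<xi>. (cmod (g \<xi>))\<^sup>2)"
    and S: "countable S" "S \<subseteq> {-1..1} \<times> \<Theta>" and \<Theta>: "\<Theta> \<subseteq> {-B..B}"
    and A: "finite A" "\<Theta> \<subseteq> (\<Union>a\<in>A. {a..a + 1 / sqrt l})"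
  shows "(\<integral>\<^sup>+x\<in>{-R..R}. (SUP p\<in>S. wave_sq \<Phi> g (dyadic_block l) p x) \<partial>lborel)
    \<le> ennreal (card A * (maximal_const R B C1 C2 * sqrt l * (LINT \<xi>:dyadic_block l|lborel. (cmod (g \<xi>))\<^sup>2)))"
proof -
  note [measurable] = dispersive_measurable[OF \<Phi>]
  define C where "C = maximal_const R B C1 C2 * sqrt l * (LINT \<xi>:dyadic_block l|lborel. (cmod (g \<xi>))\<^sup>2)"
  have C0: "C \<ge> 0" unfolding C_def set_lebesgue_integral_def
    using kernel_const_nonneg[OF \<Phi> B] l R by (simp add: maximal_const_def)
  define Sa where "Sa = (\<lambda>a. {p\<in>S. snd p \<in> {a..a + 1 / sqrt l}})"
  have Sac: "countable (Sa a)" for a unfolding Sa_def by (rule countable_subset[OF _ S(1)]) auto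
  define G where "G = (\<lambda>a x. (SUP p\<in>Sa a. wave_sq \<Phi> g (dyadic_block l) p x))"
  have Gm[measurable]: "G a \<in> borel_measurable borel" for a
    unfolding G_def by (rule borel_measurable_SUP[OF Sac]) measurable
  have "(\<integral>\<^sup>+x\<in>{-R..R}. (SUP p\<in>S. wave_sq \<Phi> g (dyadic_block l) p x) \<partial>lborel)
     \<le> (\<integral>\<^sup>+x\<in>{-R..R}. (\<Sum>a\<in>A. G a x) \<partial>lborel)"
  proof (intro nn_integral_mono mult_right_mono SUP_least)
    fix x p assume p: "p \<in> S"
    then obtain a where a: "a \<in> A" "p \<in> Sa a" using S(2) A(2) unfolding Sa_def by force
    have "wave_sq \<Phi> g (dyadic_block l) p x \<le> G a x" unfolding G_def by (rule SUP_upper[OF a(2)])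
    also have "\<dots> \<le> (\<Sum>a\<in>A. G a x)" by (rule member_le_sum[OF a(1)]) (use A in auto)
    finally show "wave_sq \<Phi> g (dyadic_block l) p x \<le> (\<Sum>a\<in>A. G a x)" .
  qed auto
  also have "\<dots> = (\<Sum>a\<in>A. \<integral>\<^sup>+x\<in>{-R..R}. G a x \<partial>lborel)"
    by (subst nn_integral_sum[symmetric]) (auto simp: sum_distrib_right)
  also have "\<dots> \<le> (\<Sum>a\<in>A. ennreal C)"
  proof (rule sum_mono)
    fix a
    have "near_pairs (1 / sqrt l) B (Sa a)"
      using S(2) \<Theta> unfolding near_pairs_def Sa_def by (auto simp: abs_le_iff)
    thus "(\<integral>\<^sup>+x\<in>{-R..R}. G a x \<partial>lborel) \<le> ennreal C"
      unfolding G_def C_def by (intro maximal_estimate_countable[OF \<Phi> l B R _ g2 Sac]) measurable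
  qed
  also have "\<dots> = ennreal (card A * C)"
    using C0 by (simp add: ennreal_mult ennreal_of_nat_eq_real_of_nat)
  finally show ?thesis by (simp add: C_def)
qed

section \<open>The Fourier transform of square integrable functions\<close>

definition trunc_fourier :: "(real \<Rightarrow> complex) \<Rightarrow> real \<Rightarrow> real \<Rightarrow> complex" where
  "trunc_fourier w R \<xi> = (LINT x:{-R..R}|lborel. cis (- (x * \<xi>)) * w x)"

lemma trunc_fourier_measurable [measurable (raw)]:
  assumes [measurable]: "w \<in> borel_measurable borel" "a \<in> borel_measurable M"
  shows "(\<lambda>x. trunc_fourier w R (a x)) \<in> borel_measurable M"
  unfolding trunc_fourier_def set_lebesgue_integral_def
  by (rule lborel.borel_measurable_lebesgue_integral) measurable

lemma nn_integral_gaussian: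
  fixes k :: real assumes k: "k > 0"
  shows "(\<integral>\<^sup>+y. ennreal (exp (- ((k * (x - y))\<^sup>2) / 2)) \<partial>lborel) = ennreal (sqrt (2 * pi) / k)"
proof -
  have 1: "(\<integral>\<^sup>+u. ennreal (std_normal_density u) \<partial>lborel) = 1"
    using integral_normal_density[of 1 0] integrable_normal_density[of 1 0]
    by (subst nn_integral_eq_integral) (auto simp: normal_density_nonneg)
  have "(\<integral>\<^sup>+u. ennreal (exp (- u\<^sup>2 / 2)) \<partial>lborel) = (\<integral>\<^sup>+u. ennreal (sqrt (2 * pi)) * ennreal (std_normal_density u) \<partial>lborel)"
    by (intro nn_integral_cong) (simp add: std_normal_density_def flip: ennreal_mult)
  also have "\<dots> = ennreal (sqrt (2 * pi))"
    by (subst nn_integral_cmult) (simp_all add: 1)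
  finally have 2: "(\<integral>\<^sup>+u. ennreal (exp (- u\<^sup>2 / 2)) \<partial>lborel) = ennreal (sqrt (2 * pi))" .
  have "(\<integral>\<^sup>+u. ennreal (exp (- u\<^sup>2 / 2)) \<partial>lborel)
    = ennreal k * (\<integral>\<^sup>+y. ennreal (exp (- ((k * (x - y))\<^sup>2) / 2)) \<partial>lborel)"
    using nn_integral_real_affine[of "\<lambda>u. ennreal (exp (- u\<^sup>2 / 2))" "-k" "k * x"] k
    by (simp add: algebra_simps)
  with 2 have "ennreal (1 / k) * (ennreal k * (\<integral>\<^sup>+y. ennreal (exp (- ((k * (x - y))\<^sup>2) / 2)) \<partial>lborel)) = ennreal (1 / k) * ennreal (sqrt (2 * pi))"
    by simp
  moreover have "ennreal (1 / k) * ennreal k = 1" using k by (simp flip: ennreal_mult)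
  ultimately show ?thesis using k by (simp add: mult.assoc[symmetric] flip: ennreal_mult)
qed

text \<open>
This is the \<open>T\<^sup>*\<close> half of the argument above, with the standard normal distribution as the measure on
the frequency side: there the kernel is its characteristic function, a Gaussian in \<open>k (x - y)\<close> whose
integral \<open>sqrt (2 pi) / k\<close> compensates the dilation by \<open>k\<close>.
\<close>
lemma Plancherel_gaussian:
  assumes w[measurable]: "w \<in> borel_measurable borel"
    and w2: "set_integrable lborel {-R..R} (\<lambda>x. (cmod (w x))\<^sup>2)" and k: "k > (0::real)"
  shows "(\<integral>\<^sup>+\<xi>. ennreal (exp (- (\<xi> / k)\<^sup>2 / 2)) * ennreal ((cmod (trunc_fourier w R \<xi>))\<^sup>2) \<partial>lborel)
     \<le> ennreal (2 * pi * (LINT x:{-R..R}|lborel. (cmod (w x))\<^sup>2))"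
proof -
  define M where "M = restrict_space lborel {-R..R}"
  define N where "N = std_normal_distribution"
  interpret N: real_distribution N unfolding N_def by (rule real_dist_normal_dist)
  define e where "e = (\<lambda>x \<eta>. cis (- (k * x * \<eta>)))"
  define A where "A = sqrt (2 * pi) / k"
  define W where "W = (LINT x:{-R..R}|lborel. (cmod (w x))\<^sup>2)"
  have A0: "A \<ge> 0" using k by (simp add: A_def)
  have W0: "W \<ge> 0" unfolding W_def set_lebesgue_integral_def by simp
  have finM: "finite_measure M"
    unfolding M_def
    by (rule finite_measureI) (simp add: emeasure_restrict_space space_restrict_space emeasure_lborel_Icc_eq)
  have finN: "finite_measure N" by unfold_locales
  have idM: "(\<lambda>x. x) \<in> measurable M borel" unfolding M_def by (auto intro!: measurable_restrict_space1)
  have em: "(\<lambda>(x, \<xi>). e x \<xi>) \<in> borel_measurable (M \<Otimes>\<^sub>M N)"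
  proof -
    have 1: "(\<lambda>p. (fst p, snd p)) \<in> measurable (M \<Otimes>\<^sub>M N) (borel \<Otimes>\<^sub>M borel)"
      by (intro measurable_Pair measurable_compose[OF measurable_fst idM] measurable_compose[OF measurable_snd])
         (simp add: N_def)
    have 2: "(\<lambda>(x, \<xi>). e x \<xi>) \<in> borel_measurable (borel \<Otimes>\<^sub>M borel)"
      unfolding e_def by measurable
    show ?thesis using measurable_compose[OF 1 2] by (simp add: case_prod_beta)
  qed
  have wM: "w \<in> borel_measurable M" unfolding M_def by (auto intro!: measurable_restrict_space1)
  have w2M: "integrable M (\<lambda>\<xi>. (cmod (w \<xi>))\<^sup>2)"
    unfolding M_def using w2 by (subst integrable_restrict_space) (auto simp: set_integrable_def)
  have e1: "cmod (e x \<xi>) \<le> 1" for x \<xi> by (simp add: e_def)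
  have K: "(\<integral>\<^sup>+y. ennreal (cmod (LINT \<xi>|N. e x \<xi> * cnj (e y \<xi>))) \<partial>M) \<le> ennreal A" if "x \<in> space M" for x
  proof -
    have "(LINT \<xi>|N. e x \<xi> * cnj (e y \<xi>)) = complex_of_real (exp (- ((k * (x - y))\<^sup>2) / 2))" for y
    proof -
      have "(LINT \<xi>|N. e x \<xi> * cnj (e y \<xi>)) = char N (- (k * (x - y)))"
        unfolding char_def e_def cis_conv_exp[symmetric]
        by (intro Bochner_Integration.integral_cong refl) (simp add: cis_cnj cis_mult algebra_simps)
      thus ?thesis by (simp add: N_def char_std_normal_distribution)
    qed
    hence "(\<integral>\<^sup>+y. ennreal (cmod (LINT \<xi>|N. e x \<xi> * cnj (e y \<xi>))) \<partial>M)
       = (\<integral>\<^sup>+y. ennreal (exp (- ((k * (x - y))\<^sup>2) / 2)) \<partial>M)"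
      by (simp del: of_real_exp add: norm_of_real)
    also have "\<dots> \<le> (\<integral>\<^sup>+y. ennreal (exp (- ((k * (x - y))\<^sup>2) / 2)) \<partial>lborel)"
      unfolding M_def by (subst nn_integral_restrict_space) (auto intro!: nn_integral_mono split: split_indicator)
    also have "\<dots> = ennreal A" unfolding A_def by (rule nn_integral_gaussian[OF k])
    finally show ?thesis .
  qed
  note D = TTstar_dual[OF finM finN em e1 wM w2M K A0]
  have T: "(LINT x|M. w x * e x \<eta>) = trunc_fourier w R (k * \<eta>)" for \<eta>
    unfolding trunc_fourier_def M_def e_def set_lebesgue_integral_def
    by (subst integral_restrict_space) (simp_all add: mult_ac)
  have WM: "(LINT x|M. (cmod (w x))\<^sup>2) = W"
    unfolding W_def M_def set_lebesgue_integral_def by (subst integral_restrict_space) simp_all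
  let ?f = "\<lambda>\<xi>. ennreal (exp (- (\<xi> / k)\<^sup>2 / 2)) * ennreal ((cmod (trunc_fourier w R \<xi>))\<^sup>2)"
  have "(\<integral>\<^sup>+\<xi>. ?f \<xi> \<partial>lborel) = ennreal k * (\<integral>\<^sup>+\<eta>. ?f (0 + k * \<eta>) \<partial>lborel)"
    using k by (subst nn_integral_real_affine[of _ k 0]) auto
  also have "(\<integral>\<^sup>+\<eta>. ?f (0 + k * \<eta>) \<partial>lborel)
     = (\<integral>\<^sup>+\<eta>. ennreal (sqrt (2 * pi)) * (ennreal (std_normal_density \<eta>) * ennreal ((cmod (trunc_fourier w R (k * \<eta>)))\<^sup>2)) \<partial>lborel)"
    using k by (intro nn_integral_cong) (simp add: std_normal_density_def mult.assoc[symmetric] flip: ennreal_mult)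
  also have "\<dots> = ennreal (sqrt (2 * pi)) * (\<integral>\<^sup>+\<eta>. ennreal ((cmod (trunc_fourier w R (k * \<eta>)))\<^sup>2) \<partial>N)"
    unfolding N_def by (subst nn_integral_cmult, measurable, subst nn_integral_density) auto
  also have "(\<integral>\<^sup>+\<eta>. ennreal ((cmod (trunc_fourier w R (k * \<eta>)))\<^sup>2) \<partial>N) = ennreal (LINT \<eta>|N. (cmod (trunc_fourier w R (k * \<eta>)))\<^sup>2)"
    using D(1) unfolding T by (intro nn_integral_eq_integral) auto
  also have "ennreal k * (ennreal (sqrt (2 * pi)) * \<dots>) \<le> ennreal k * (ennreal (sqrt (2 * pi)) * ennreal (A * W))"
    using D(2) unfolding T WM by (intro mult_left_mono ennreal_leI) auto
  also have "\<dots> = ennreal (k * (sqrt (2 * pi) * (A * W)))"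
    using k A0 W0 by (simp add: ennreal_mult)
  also have "k * (sqrt (2 * pi) * (A * W)) = 2 * pi * W"
    using k by (simp add: A_def)
  finally show ?thesis by (simp add: W_def)
qed

text \<open>
The Gaussian weight increases to one as \<open>k\<close> tends to infinity.
\<close>
lemma Plancherel_upper:
  assumes w[measurable]: "w \<in> borel_measurable borel"
    and w2: "set_integrable lborel {-R..R} (\<lambda>x. (cmod (w x))\<^sup>2)"
  shows "(\<integral>\<^sup>+\<xi>. ennreal ((cmod (trunc_fourier w R \<xi>))\<^sup>2) \<partial>lborel) \<le> ennreal (2 * pi * (LINT x:{-R..R}|lborel. (cmod (w x))\<^sup>2))"
    (is "_ \<le> ?C")
proof -
  define f where "f = (\<lambda>n \<xi>. ennreal (exp (- (\<xi> / real (Suc n))\<^sup>2 / 2)) * ennreal ((cmod (trunc_fourier w R \<xi>))\<^sup>2))"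
  have [measurable]: "f n \<in> borel_measurable borel" for n unfolding f_def by measurable
  have lim: "(\<lambda>n. f n \<xi>) \<longlonglongrightarrow> ennreal ((cmod (trunc_fourier w R \<xi>))\<^sup>2)" for \<xi>
  proof -
    have "(\<lambda>n. \<xi> * (1 / real (Suc n))) \<longlonglongrightarrow> \<xi> * 0"
      by (intro tendsto_mult tendsto_const) (use LIMSEQ_inverse_real_of_nat in \<open>simp add: inverse_eq_divide\<close>)
    hence "(\<lambda>n. \<xi> / real (Suc n)) \<longlonglongrightarrow> 0" by simp
    hence "(\<lambda>n. exp (- (\<xi> / real (Suc n))\<^sup>2 / 2) * (cmod (trunc_fourier w R \<xi>))\<^sup>2) \<longlonglongrightarrow> exp (- 0\<^sup>2 / 2) * (cmod (trunc_fourier w R \<xi>))\<^sup>2"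
      by (intro tendsto_intros) auto
    hence "(\<lambda>n. ennreal (exp (- (\<xi> / real (Suc n))\<^sup>2 / 2) * (cmod (trunc_fourier w R \<xi>))\<^sup>2)) \<longlonglongrightarrow> ennreal ((cmod (trunc_fourier w R \<xi>))\<^sup>2)"
      by (intro tendsto_ennrealI) simp
    thus ?thesis by (simp add: f_def ennreal_mult)
  qed
  have "(\<integral>\<^sup>+\<xi>. ennreal ((cmod (trunc_fourier w R \<xi>))\<^sup>2) \<partial>lborel) = (\<integral>\<^sup>+\<xi>. liminf (\<lambda>n. f n \<xi>) \<partial>lborel)"
    using lim_imp_Liminf[OF sequentially_bot lim] by simp
  also have "\<dots> \<le> liminf (\<lambda>n. \<integral>\<^sup>+\<xi>. f n \<xi> \<partial>lborel)"
    by (rule nn_integral_liminf) measurable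
  also have "\<dots> \<le> liminf (\<lambda>n. ?C)"
    by (intro Liminf_mono always_eventually allI) (use Plancherel_gaussian[OF w w2] in \<open>auto simp: f_def\<close>)
  also have "\<dots> = ?C" by (simp add: Liminf_const)
  finally show ?thesis .
qed

definition tail_sq :: "(real \<Rightarrow> complex) \<Rightarrow> real \<Rightarrow> real" where
  "tail_sq f R = (LINT x:- {-R..R}|lborel. (cmod (f x))\<^sup>2)"

lemma set_integrable_lborel:
  fixes f :: "real \<Rightarrow> 'a::{banach, second_countable_topology}"
  shows "integrable lborel f \<Longrightarrow> A \<in> sets borel \<Longrightarrow> set_integrable lborel A f"
  unfolding set_integrable_def by (rule integrable_mult_indicator) simp_all

lemma square_integrable_local:
  fixes f :: "real \<Rightarrow> complex"
  assumes f: "f \<in> borel_measurable borel" and f2: "integrable lborel (\<lambda>x. (cmod (f x))\<^sup>2)"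
  shows "set_integrable lborel {a..b} f"
proof -
  have "integrable (restrict_space lborel {a..b}) f"
  proof (rule integrable_of_square_integrable)
    show "finite_measure (restrict_space lborel {a..b})"
      by (rule finite_measureI) (simp add: emeasure_restrict_space space_restrict_space emeasure_lborel_Icc_eq)
    show "f \<in> borel_measurable (restrict_space lborel {a..b})" using f by (auto intro!: measurable_restrict_space1)
    show "integrable (restrict_space lborel {a..b}) (\<lambda>x. (cmod (f x))\<^sup>2)"
      using set_integrable_lborel[OF f2] by (subst integrable_restrict_space) (auto simp: set_integrable_def)
  qed
  thus ?thesis unfolding set_integrable_def by (subst (asm) integrable_restrict_space) auto
qed

lemma set_integrable_cis_mult:
  fixes f :: "real \<Rightarrow> complex"
  assumes "set_integrable lborel A f" and [measurable]: "\<phi> \<in> borel_measurable borel" "A \<in> sets borel"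
  shows "set_integrable lborel A (\<lambda>x. cis (\<phi> x) * f x)"
proof -
  have 1: "integrable lborel (\<lambda>x. indicator A x *\<^sub>R f x)" using assms(1) by (simp add: set_integrable_def)
  hence [measurable]: "(\<lambda>x. indicator A x *\<^sub>R f x) \<in> borel_measurable borel" by auto
  have "integrable lborel (\<lambda>x. cis (\<phi> x) * (indicator A x *\<^sub>R f x))"
    by (rule Bochner_Integration.integrable_bound[OF 1], measurable) (auto simp: norm_mult)
  thus ?thesis unfolding set_integrable_def by simp
qed

lemma trunc_fourier_diff_le_tail:
  assumes f[measurable]: "f \<in> borel_measurable borel" and f2: "integrable lborel (\<lambda>x. (cmod (f x))\<^sup>2)"
    and R: "R \<le> R'"
  shows "(\<integral>\<^sup>+\<xi>. ennreal ((cmod (trunc_fourier f R' \<xi> - trunc_fourier f R \<xi>))\<^sup>2) \<partial>lborel) \<le> ennreal (2 * pi * tail_sq f R)"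
proof -
  define w where "w = (\<lambda>x. indicator (- {-R..R}) x *\<^sub>R f x)"
  have w[measurable]: "w \<in> borel_measurable borel" unfolding w_def by measurable
  have w2: "integrable lborel (\<lambda>x. (cmod (w x))\<^sup>2)"
    by (rule Bochner_Integration.integrable_bound[OF f2]) (auto simp: w_def power_mult_distrib split: split_indicator)
  have tl: "(\<lambda>x. indicat_real (- {-R..R}) x *\<^sub>R (cmod (f x))\<^sup>2) = (\<lambda>x. (cmod (w x))\<^sup>2)"
    by (auto simp: w_def split: split_indicator)
  have eq: "trunc_fourier f R' \<xi> - trunc_fourier f R \<xi> = trunc_fourier w R' \<xi>" for \<xi>
  proof -
    have "trunc_fourier f R' \<xi> - trunc_fourier f R \<xi> =
       (LINT x|lborel. indicator {-R'..R'} x *\<^sub>R (cis (- (x * \<xi>)) * f x) - indicator {-R..R} x *\<^sub>R (cis (- (x * \<xi>)) * f x))"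
      unfolding trunc_fourier_def set_lebesgue_integral_def
      by (rule Bochner_Integration.integral_diff[symmetric])
         (use set_integrable_cis_mult[OF square_integrable_local[OF f f2]] in \<open>auto simp: set_integrable_def\<close>)
    also have "\<dots> = trunc_fourier w R' \<xi>"
      unfolding trunc_fourier_def set_lebesgue_integral_def w_def
      by (intro Bochner_Integration.integral_cong refl) (use R in \<open>auto split: split_indicator\<close>)
    finally show ?thesis .
  qed
  have "(\<integral>\<^sup>+\<xi>. ennreal ((cmod (trunc_fourier w R' \<xi>))\<^sup>2) \<partial>lborel) \<le> ennreal (2 * pi * (LINT x:{-R'..R'}|lborel. (cmod (w x))\<^sup>2))"
    by (rule Plancherel_upper[OF w set_integrable_lborel[OF w2]]) simp
  also have "\<dots> \<le> ennreal (2 * pi * tail_sq f R)"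
  proof -
    have "(LINT x:{-R'..R'}|lborel. (cmod (w x))\<^sup>2) \<le> (LINT x|lborel. (cmod (w x))\<^sup>2)"
      unfolding set_lebesgue_integral_def
      by (rule integral_mono') (use w2 in \<open>auto split: split_indicator\<close>)
    thus ?thesis unfolding tail_sq_def set_lebesgue_integral_def tl by (intro ennreal_leI mult_left_mono) auto
  qed
  finally show ?thesis by (simp add: eq)
qed

lemma tail_sq_tendsto_0:
  assumes f[measurable]: "f \<in> borel_measurable borel" and f2: "integrable lborel (\<lambda>x. (cmod (f x))\<^sup>2)"
  shows "(tail_sq f \<longlongrightarrow> 0) at_top"
proof -
  have "((\<lambda>R. LINT x|lborel. indicat_real (- {-R..R}) x *\<^sub>R (cmod (f x))\<^sup>2) \<longlongrightarrow> (LINT x::real|lborel. (0::real))) at_top"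
  proof (rule integral_dominated_convergence_at_top[where w = "\<lambda>x. (cmod (f x))\<^sup>2" and M = lborel and f = "\<lambda>_. 0"
        and s = "\<lambda>R x. indicat_real (- {-R..R}) x *\<^sub>R (cmod (f x))\<^sup>2"])
    show "integrable lborel (\<lambda>x. (cmod (f x))\<^sup>2)" by fact
    show "\<forall>\<^sub>F R in at_top. AE x in lborel. norm (indicat_real (- {-R..R}) x *\<^sub>R (cmod (f x))\<^sup>2) \<le> (cmod (f x))\<^sup>2"
      by (auto split: split_indicator)
    show "AE x in lborel. ((\<lambda>R. indicat_real (- {-R..R}) x *\<^sub>R (cmod (f x))\<^sup>2) \<longlongrightarrow> 0) at_top"
    proof (rule AE_I2)
      fix x :: real
      have "\<forall>\<^sub>F R in at_top. indicat_real (- {-R..R}) x *\<^sub>R (cmod (f x))\<^sup>2 = 0"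
        using eventually_ge_at_top[of "\<bar>x\<bar>"] by eventually_elim (auto split: split_indicator)
      thus "((\<lambda>R. indicat_real (- {-R..R}) x *\<^sub>R (cmod (f x))\<^sup>2) \<longlongrightarrow> 0) at_top"
        by (rule tendsto_eventually)
    qed
  qed measurable
  thus ?thesis by (simp add: tail_sq_def[abs_def] set_lebesgue_integral_def)
qed

lemma summable_of_weighted_squares:
  fixes a :: "nat \<Rightarrow> real"
  assumes a0: "\<And>k. a k \<ge> 0" and C: "\<And>k. 2 ^ k * (a k)\<^sup>2 \<le> C"
  shows "summable a"
proof (rule summable_comparison_test)
  define q where "q = sqrt (1/2)"
  have C0: "C \<ge> 0" using C[of 0] order.trans[OF zero_le_power2] by fastforce
  have q: "0 \<le> q" "q < 1" "q\<^sup>2 = 1/2" by (auto simp: q_def real_sqrt_less_iff[of "1/2" 1, simplified])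
  show "summable (\<lambda>k. sqrt C * q ^ k)" using q by (intro summable_mult summable_geometric) auto
  have "a k \<le> sqrt C * q ^ k" for k
  proof (rule power2_le_imp_le)
    have "(a k)\<^sup>2 = (1/2) ^ k * (2 ^ k * (a k)\<^sup>2)" by (simp add: power_one_over)
    also have "\<dots> \<le> (1/2) ^ k * C" by (rule mult_left_mono[OF C]) simp
    also have "\<dots> = (sqrt C * q ^ k)\<^sup>2"
    proof -
      have "(q ^ k)\<^sup>2 = (q\<^sup>2) ^ k" by (metis power_mult mult.commute)
      thus ?thesis using C0 q(3) by (simp add: power_mult_distrib)
    qed
    finally show "(a k)\<^sup>2 \<le> (sqrt C * q ^ k)\<^sup>2" .
  qed (use q C0 in auto)
  thus "\<exists>N. \<forall>k\<ge>N. norm (a k) \<le> sqrt C * q ^ k" using a0 by auto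
qed

text \<open>
The Riesz-Fischer argument: the weights \<open>2 ^ k\<close> are small enough for the weighted squares of the
increments to be integrable and large enough to make the increments summable.
\<close>
lemma rapidly_Cauchy_AE_convergent:
  fixes F :: "nat \<Rightarrow> 'a \<Rightarrow> complex"
  assumes [measurable]: "\<And>k. F k \<in> borel_measurable M"
    and d: "\<And>k. (\<integral>\<^sup>+\<xi>. ennreal ((cmod (F (Suc k) \<xi> - F k \<xi>))\<^sup>2) \<partial>M) \<le> ennreal (C / 4 ^ k)" and C: "C \<ge> 0"
  shows "AE \<xi> in M. convergent (\<lambda>k. F k \<xi>)"
proof -
  define S where "S = (\<lambda>\<xi>. \<Sum>k. ennreal (2 ^ k * (cmod (F (Suc k) \<xi> - F k \<xi>))\<^sup>2))"
  have "(\<integral>\<^sup>+\<xi>. S \<xi> \<partial>M) = (\<Sum>k. \<integral>\<^sup>+\<xi>. ennreal (2 ^ k * (cmod (F (Suc k) \<xi> - F k \<xi>))\<^sup>2) \<partial>M)"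
    unfolding S_def by (rule nn_integral_suminf) measurable
  also have "\<dots> = (\<Sum>k. ennreal (2 ^ k) * (\<integral>\<^sup>+\<xi>. ennreal ((cmod (F (Suc k) \<xi> - F k \<xi>))\<^sup>2) \<partial>M))"
    by (intro suminf_cong, subst nn_integral_cmult[symmetric]) (simp_all add: ennreal_mult)
  also have "\<dots> \<le> (\<Sum>k. ennreal (C * (1/2) ^ k))"
  proof (rule suminf_le)
    fix k :: nat
    have "ennreal (2 ^ k) * (\<integral>\<^sup>+\<xi>. ennreal ((cmod (F (Suc k) \<xi> - F k \<xi>))\<^sup>2) \<partial>M) \<le> ennreal (2 ^ k) * ennreal (C / 4 ^ k)"
      by (rule mult_left_mono[OF d]) simp
    also have "\<dots> = ennreal (2 ^ k * (C / 4 ^ k))" using C by (intro ennreal_mult[symmetric]) auto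
    also have "2 ^ k * (C / 4 ^ k) = C * (1/2) ^ k"
    proof -
      have "(4::real) ^ k = 2 ^ k * 2 ^ k" by (simp flip: power_mult_distrib)
      thus ?thesis by (simp add: power_one_over)
    qed
    finally show "ennreal (2 ^ k) * (\<integral>\<^sup>+\<xi>. ennreal ((cmod (F (Suc k) \<xi> - F k \<xi>))\<^sup>2) \<partial>M) \<le> ennreal (C * (1/2) ^ k)" .
  qed auto
  also have "\<dots> = ennreal (\<Sum>k. C * (1/2) ^ k)"
    using C by (intro suminf_ennreal2 summable_mult summable_geometric) auto
  also have "\<dots> < \<infinity>" by simp
  finally have "AE \<xi> in M. S \<xi> \<noteq> \<infinity>"
    by (intro nn_integral_PInf_AE) (auto simp: S_def)
  thus ?thesis
  proof eventually_elim
    case (elim \<xi>)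
    then obtain D where D: "S \<xi> = ennreal D" "D \<ge> 0" by (cases "S \<xi>") auto
    have "2 ^ k * (cmod (F (Suc k) \<xi> - F k \<xi>))\<^sup>2 \<le> D" for k
    proof -
      have "ennreal (2 ^ k * (cmod (F (Suc k) \<xi> - F k \<xi>))\<^sup>2) \<le> S \<xi>"
        unfolding S_def using ennreal_suminf_lessD[of "\<lambda>k. ennreal (2 ^ k * (cmod (F (Suc k) \<xi> - F k \<xi>))\<^sup>2)"]
        by (meson linorder_not_le order_less_irrefl)
      thus ?thesis unfolding D(1) using D(2) by (simp add: ennreal_le_iff)
    qed
    hence "summable (\<lambda>k. cmod (F (Suc k) \<xi> - F k \<xi>))"
      by (intro summable_of_weighted_squares) auto
    hence "summable (\<lambda>k. F (Suc k) \<xi> - F k \<xi>)" by (rule summable_norm_cancel)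
    hence "convergent (\<lambda>n. \<Sum>k<n. F (Suc k) \<xi> - F k \<xi>)" by (simp add: summable_iff_convergent)
    then obtain L where "(\<lambda>n. \<Sum>k<n. F (Suc k) \<xi> - F k \<xi>) \<longlonglongrightarrow> L" by (auto simp: convergent_def)
    hence "(\<lambda>n. F n \<xi> - F 0 \<xi>) \<longlonglongrightarrow> L" by (simp add: sum_lessThan_telescope[of "\<lambda>k. F k \<xi>"])
    from tendsto_add[OF this tendsto_const[of "F 0 \<xi>"]] show ?case by (auto simp: convergent_def)
  qed
qed

text \<open>
The truncated transforms along radii \<open>\<rho> k\<close> with rapidly decreasing tails converge almost everywhere,
and Fatou's lemma carries the bound for the differences over to the limit.
\<close>
lemma Plancherel_extension_exists:
  assumes f[measurable]: "f \<in> borel_measurable borel" and f2: "integrable lborel (\<lambda>x. (cmod (f x))\<^sup>2)"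
  obtains g where "g \<in> borel_measurable borel"
    "\<And>R. (\<integral>\<^sup>+\<xi>. ennreal ((cmod (g \<xi> - trunc_fourier f R \<xi>))\<^sup>2) \<partial>lborel) \<le> ennreal (2 * pi * tail_sq f R)"
proof -
  have "\<exists>r. \<forall>R\<ge>r. tail_sq f R \<le> 1 / 4 ^ k" for k :: nat
  proof -
    have "\<forall>\<^sub>F R in at_top. tail_sq f R < 1 / 4 ^ k"
      by (rule order_tendstoD(2)[OF tail_sq_tendsto_0[OF f f2]]) simp
    then obtain r where "\<forall>R\<ge>r. tail_sq f R < 1 / 4 ^ k" by (auto simp: eventually_at_top_linorder)
    hence "\<forall>R\<ge>r. tail_sq f R \<le> 1 / 4 ^ k" using less_imp_le by blast
    thus ?thesis by blast
  qed
  hence "\<exists>r. \<forall>k. \<forall>R\<ge>r k. tail_sq f R \<le> 1 / 4 ^ k" by (intro choice allI)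
  then obtain r where r: "\<And>k R. R \<ge> r k \<Longrightarrow> tail_sq f R \<le> 1 / 4 ^ k" by blast
  \<comment> \<open>The sum makes the radii increasing, the first summand makes them unbounded.\<close>
  define \<rho> where "\<rho> = (\<lambda>k. real k + (\<Sum>j\<le>k. \<bar>r j\<bar>))"
  have \<rho>r: "\<rho> k \<ge> r k" for k
  proof -
    have "\<bar>r k\<bar> \<le> (\<Sum>j\<le>k. \<bar>r j\<bar>)" by (rule member_le_sum) auto
    thus ?thesis unfolding \<rho>_def by linarith
  qed
  have \<rho>mono: "\<rho> k \<le> \<rho> (Suc k)" for k by (simp add: \<rho>_def)
  have \<rho>top: "\<rho> k \<ge> real k" for k by (simp add: \<rho>_def sum_nonneg)
  define F where "F = (\<lambda>k. trunc_fourier f (\<rho> k))"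
  have [measurable]: "F k \<in> borel_measurable borel" for k unfolding F_def by measurable
  define g where "g = (\<lambda>\<xi>. lim (\<lambda>k. F k \<xi>))"
  have g[measurable]: "g \<in> borel_measurable borel" unfolding g_def by measurable
  have "AE \<xi> in lborel. convergent (\<lambda>k. F k \<xi>)"
  proof (rule rapidly_Cauchy_AE_convergent[where C = "2 * pi"])
    fix k
    have "(\<integral>\<^sup>+\<xi>. ennreal ((cmod (F (Suc k) \<xi> - F k \<xi>))\<^sup>2) \<partial>lborel) \<le> ennreal (2 * pi * tail_sq f (\<rho> k))"
      unfolding F_def by (rule trunc_fourier_diff_le_tail[OF f f2 \<rho>mono])
    also have "\<dots> \<le> ennreal (2 * pi * (1 / 4 ^ k))"
      by (intro ennreal_leI mult_left_mono r[OF \<rho>r]) auto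
    finally show "(\<integral>\<^sup>+\<xi>. ennreal ((cmod (F (Suc k) \<xi> - F k \<xi>))\<^sup>2) \<partial>lborel) \<le> ennreal (2 * pi / 4 ^ k)" by simp
  qed auto
  hence conv: "AE \<xi> in lborel. (\<lambda>k. F k \<xi>) \<longlonglongrightarrow> g \<xi>"
    by eventually_elim (simp add: g_def convergent_LIMSEQ_iff)
  have "(\<integral>\<^sup>+\<xi>. ennreal ((cmod (g \<xi> - trunc_fourier f R \<xi>))\<^sup>2) \<partial>lborel) \<le> ennreal (2 * pi * tail_sq f R)" for R
  proof -
    have "(\<integral>\<^sup>+\<xi>. ennreal ((cmod (g \<xi> - trunc_fourier f R \<xi>))\<^sup>2) \<partial>lborel)
       \<le> (\<integral>\<^sup>+\<xi>. liminf (\<lambda>k. ennreal ((cmod (F k \<xi> - trunc_fourier f R \<xi>))\<^sup>2)) \<partial>lborel)"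
    proof (rule nn_integral_mono_AE)
      from conv show "AE \<xi> in lborel. ennreal ((cmod (g \<xi> - trunc_fourier f R \<xi>))\<^sup>2)
          \<le> liminf (\<lambda>k. ennreal ((cmod (F k \<xi> - trunc_fourier f R \<xi>))\<^sup>2))"
      proof eventually_elim
        case (elim \<xi>)
        hence "(\<lambda>k. ennreal ((cmod (F k \<xi> - trunc_fourier f R \<xi>))\<^sup>2)) \<longlonglongrightarrow> ennreal ((cmod (g \<xi> - trunc_fourier f R \<xi>))\<^sup>2)"
          by (intro tendsto_ennrealI tendsto_intros)
        from lim_imp_Liminf[OF sequentially_bot this] show ?case by simp
      qed
    qed
    also have "\<dots> \<le> liminf (\<lambda>k. \<integral>\<^sup>+\<xi>. ennreal ((cmod (F k \<xi> - trunc_fourier f R \<xi>))\<^sup>2) \<partial>lborel)"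
      by (rule nn_integral_liminf) measurable
    also have "\<dots> \<le> liminf (\<lambda>k::nat. ennreal (2 * pi * tail_sq f R))"
    proof (rule Liminf_mono)
      have "\<forall>\<^sub>F k in sequentially. real k \<ge> R"
        by (meson eventually_sequentiallyI nat_ceiling_le_eq)
      thus "\<forall>\<^sub>F k in sequentially. (\<integral>\<^sup>+\<xi>. ennreal ((cmod (F k \<xi> - trunc_fourier f R \<xi>))\<^sup>2) \<partial>lborel) \<le> ennreal (2 * pi * tail_sq f R)"
      proof eventually_elim
        case (elim k)
        show ?case unfolding F_def
          by (rule trunc_fourier_diff_le_tail[OF f f2]) (use elim \<rho>top[of k] in linarith)
      qed
    qed
    also have "\<dots> = ennreal (2 * pi * tail_sq f R)" by (simp add: Liminf_const)
    finally show ?thesis .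
  qed
  thus ?thesis using that g by blast
qed

section \<open>Fourier inversion in the mean\<close>

lemma Fubini_set_bounded:
  fixes u v :: "real \<Rightarrow> complex" and e :: "real \<Rightarrow> real \<Rightarrow> complex"
  assumes u: "set_integrable lborel X u" and v: "set_integrable lborel Y v"
    and e[measurable]: "(\<lambda>(x, \<xi>). e x \<xi>) \<in> borel_measurable (borel \<Otimes>\<^sub>M borel)" and e1: "\<And>x \<xi>. cmod (e x \<xi>) \<le> 1"
  shows "(LINT x:X|lborel. u x * (LINT \<xi>:Y|lborel. v \<xi> * e x \<xi>)) = (LINT \<xi>:Y|lborel. v \<xi> * (LINT x:X|lborel. u x * e x \<xi>))"
proof -
  define u' where "u' = (\<lambda>x. indicator X x *\<^sub>R u x)"
  define v' where "v' = (\<lambda>x. indicator Y x *\<^sub>R v x)"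
  have ui: "integrable lborel u'" and vi: "integrable lborel v'"
    using u v by (simp_all add: u'_def v'_def set_integrable_def)
  have [measurable]: "u' \<in> borel_measurable borel" "v' \<in> borel_measurable borel"
    using borel_measurable_integrable[OF ui] borel_measurable_integrable[OF vi] by auto
  have i1: "integrable (lborel \<Otimes>\<^sub>M lborel) (\<lambda>(x, \<xi>). u' x * v' \<xi>)"
    using ui vi by (intro lborel_pair.Fubini_integrable) (auto simp: norm_mult)
  have i2: "integrable (lborel \<Otimes>\<^sub>M lborel) (\<lambda>(x, \<xi>). u' x * v' \<xi> * e x \<xi>)"
  proof (rule Bochner_Integration.integrable_bound[OF i1])
    have "(\<lambda>(x, \<xi>). u' x * v' \<xi> * e x \<xi>) \<in> borel_measurable (borel \<Otimes>\<^sub>M borel)" by measurable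
    thus "(\<lambda>(x, \<xi>). u' x * v' \<xi> * e x \<xi>) \<in> borel_measurable (lborel \<Otimes>\<^sub>M lborel)" by simp
    show "AE p in lborel \<Otimes>\<^sub>M lborel. norm (case p of (x, \<xi>) \<Rightarrow> u' x * v' \<xi> * e x \<xi>) \<le> norm (case p of (x, \<xi>) \<Rightarrow> u' x * v' \<xi>)"
      using mult_left_mono[OF e1] by (force simp: norm_mult intro!: AE_I2)
  qed
  have A: "indicator X x *\<^sub>R (u x * (LINT \<xi>:Y|lborel. v \<xi> * e x \<xi>)) = (LINT \<xi>|lborel. u' x * v' \<xi> * e x \<xi>)" for x
  proof -
    have "(LINT \<xi>|lborel. u' x * v' \<xi> * e x \<xi>) = (LINT \<xi>|lborel. u' x * (v' \<xi> * e x \<xi>))"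
      by (simp add: mult.assoc)
    also have "\<dots> = u' x * (LINT \<xi>|lborel. v' \<xi> * e x \<xi>)" by (rule integral_mult_right_zero)
    finally show ?thesis by (simp add: u'_def v'_def set_lebesgue_integral_def)
  qed
  have B: "indicator Y \<xi> *\<^sub>R (v \<xi> * (LINT x:X|lborel. u x * e x \<xi>)) = (LINT x|lborel. u' x * v' \<xi> * e x \<xi>)" for \<xi>
  proof -
    have "(LINT x|lborel. u' x * v' \<xi> * e x \<xi>) = (LINT x|lborel. v' \<xi> * (u' x * e x \<xi>))"
      by (intro Bochner_Integration.integral_cong refl) (simp only: mult_ac)
    also have "\<dots> = v' \<xi> * (LINT x|lborel. u' x * e x \<xi>)" by (rule integral_mult_right_zero)
    finally show ?thesis by (simp add: u'_def v'_def set_lebesgue_integral_def)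
  qed
  show ?thesis
    using lborel_pair.Fubini_integral[OF i2, symmetric]
    by (subst (1 3) set_lebesgue_integral_def) (simp only: A B)
qed

lemma integral_cis_symmetric:
  assumes T: "T \<ge> (0::real)"
  shows "(LINT \<xi>:{-T..T}|lborel. cis (c * \<xi>)) = complex_of_real (2 * T * sinc (T * c))"
proof -
  have "(LINT \<xi>:{-T..T}|lborel. cis (c * \<xi>)) = integral {-T..T} (\<lambda>\<xi>. cis (c * \<xi>))"
    by (intro set_borel_integral_eq_integral(2) borel_integrable_atLeastAtMost') (intro continuous_intros)
  also have "\<dots> = complex_of_real (2 * T * sinc (T * c))"
  proof (cases "c = 0")
    case True thus ?thesis using T by (simp add: scaleR_conv_of_real)
  next
    case False
    have "((\<lambda>\<xi>. cis (c * \<xi>) / (\<i> * c)) has_vector_derivative cis (c * \<xi>)) (at \<xi> within {-T..T})" for \<xi>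
    proof -
      have "((\<lambda>\<xi>. c * \<xi>) has_real_derivative c) (at \<xi> within {-T..T})"
        by (auto intro!: derivative_eq_intros)
      from has_vector_derivative_divide[OF has_vector_derivative_cis_compose[OF this], of "\<i> * c"]
      show ?thesis using False by simp
    qed
    hence "((\<lambda>\<xi>. cis (c * \<xi>)) has_integral (cis (c * T) / (\<i> * c) - cis (c * - T) / (\<i> * c))) {-T..T}"
      using T by (intro fundamental_theorem_of_calculus) auto
    hence "integral {-T..T} (\<lambda>\<xi>. cis (c * \<xi>)) = (cis (c * T) - cis (- (c * T))) / (\<i> * c)"
      by (simp add: integral_unique diff_divide_distrib)
    also have "cis (c * T) - cis (- (c * T)) = \<i> * complex_of_real (2 * sin (c * T))"
      by (simp add: complex_eq_iff)
    also have "\<i> * complex_of_real (2 * sin (c * T)) / (\<i> * c) = complex_of_real (2 * T * sinc (T * c))"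
      using False by (simp add: mult.commute)
    finally show ?thesis .
  qed
  finally show ?thesis .
qed

text \<open>
The Fourier transform at \<open>- \<xi>\<close> of the indicator of \<open>[a, b]\<close>.
\<close>
definition interval_transform :: "real \<Rightarrow> real \<Rightarrow> real \<Rightarrow> complex" where
  "interval_transform a b \<xi> = (LINT x:{a..b}|lborel. cis (x * \<xi>))"

lemma interval_transform_measurable [measurable]: "interval_transform a b \<in> borel_measurable borel"
  unfolding interval_transform_def[abs_def] set_lebesgue_integral_def
  by (rule lborel.borel_measurable_lebesgue_integral) measurable

lemma integrable_interval_transform_sq:
  "integrable lborel (\<lambda>\<xi>. (cmod (interval_transform a b \<xi>))\<^sup>2)"
proof -
  define R where "R = max \<bar>a\<bar> \<bar>b\<bar>"
  define w :: "real \<Rightarrow> complex" where "w = indicator {a..b}"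
  have [measurable]: "w \<in> borel_measurable borel" unfolding w_def by measurable
  have w2: "set_integrable lborel {-R..R} (\<lambda>x. (cmod (w x))\<^sup>2)"
  proof -
    have "set_integrable lborel {-R..R} (\<lambda>x. indicat_real {a..b} x)"
      by (rule set_integrable_lborel) (auto simp: emeasure_lborel_Icc_eq)
    also have "(\<lambda>x. indicat_real {a..b} x) = (\<lambda>x. (cmod (w x))\<^sup>2)"
      by (auto simp: w_def split: split_indicator)
    finally show ?thesis .
  qed
  have "interval_transform a b \<xi> = cnj (trunc_fourier w R \<xi>)" for \<xi>
    unfolding interval_transform_def trunc_fourier_def set_lebesgue_integral_def Bochner_Integration.integral_cnj[symmetric]
    by (intro Bochner_Integration.integral_cong refl)
       (auto simp: w_def R_def cis_cnj split: split_indicator)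
  hence eq: "(cmod (interval_transform a b \<xi>))\<^sup>2 = (cmod (trunc_fourier w R \<xi>))\<^sup>2" for \<xi> by simp
  have "(\<integral>\<^sup>+\<xi>. ennreal ((cmod (trunc_fourier w R \<xi>))\<^sup>2) \<partial>lborel) < \<infinity>"
    using Plancherel_upper[OF _ w2] by (rule order.strict_trans1) auto
  thus ?thesis unfolding eq by (intro integrableI_nonneg) auto
qed

lemma interval_transform_set_integrable: "set_integrable lborel {c..d} (interval_transform a b)"
  by (rule square_integrable_local) (auto intro: integrable_interval_transform_sq)

text \<open>
Integrating the Dirichlet kernel over an interval gives values of the sine integral, which are
bounded uniformly in \<open>T\<close> and converge as \<open>T\<close> tends to infinity.
\<close>
lemma Dirichlet_kernel:
  assumes T: "T \<ge> 0" and ab: "a \<le> b"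
  shows "(LINT \<xi>:{-T..T}|lborel. interval_transform a b \<xi> * cis (- (y * \<xi>))) =
    complex_of_real (2 * (Si (T * (b - y)) - Si (T * (a - y))))"
proof -
  have si: "set_integrable lborel {c..d} (\<lambda>x. (1::complex))" for c d :: real
    by (intro borel_integrable_atLeastAtMost' continuous_intros)
  have sc: "set_integrable lborel {c..d} (\<lambda>\<xi>. cis (- (y * \<xi>)))" for c d :: real
    by (intro borel_integrable_atLeastAtMost' continuous_intros)
  have em: "(\<lambda>(\<xi>, x). cis (x * \<xi>)) \<in> borel_measurable (borel \<Otimes>\<^sub>M borel)" by measurable
  have "(LINT \<xi>:{-T..T}|lborel. interval_transform a b \<xi> * cis (- (y * \<xi>)))
     = (LINT \<xi>:{-T..T}|lborel. cis (- (y * \<xi>)) * (LINT x:{a..b}|lborel. 1 * cis (x * \<xi>)))"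
    by (simp add: interval_transform_def mult.commute)
  also have "\<dots> = (LINT x:{a..b}|lborel. 1 * (LINT \<xi>:{-T..T}|lborel. cis (- (y * \<xi>)) * cis (x * \<xi>)))"
    by (rule Fubini_set_bounded[OF sc si em]) simp
  also have "\<dots> = (LINT x:{a..b}|lborel. complex_of_real (2 * T * sinc (T * (x - y))))"
  proof -
    have "(LINT \<xi>:{-T..T}|lborel. cis (- (y * \<xi>)) * cis (x * \<xi>)) = complex_of_real (2 * T * sinc (T * (x - y)))" for x
      using integral_cis_symmetric[OF T, of "x - y"] by (simp add: cis_mult algebra_simps)
    thus ?thesis by simp
  qed
  also have "\<dots> = integral {a..b} (\<lambda>x. complex_of_real (2 * T * sinc (T * (x - y))))"
    by (intro set_borel_integral_eq_integral(2) borel_integrable_atLeastAtMost' continuous_intros)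
  also have "\<dots> = complex_of_real (2 * Si (T * (b - y)) - 2 * Si (T * (a - y)))"
  proof (rule integral_unique)
    have "((\<lambda>x. 2 * T * sinc (T * (x - y))) has_integral (2 * Si (T * (b - y)) - 2 * Si (T * (a - y)))) {a..b}"
    proof (rule fundamental_theorem_of_calculus[OF ab])
      fix x
      have "((\<lambda>x. T * (x - y)) has_real_derivative T) (at x within {a..b})"
        by (auto intro!: derivative_eq_intros)
      from DERIV_cmult[OF DERIV_chain2[OF DERIV_Si this], of 2]
      show "((\<lambda>x. 2 * Si (T * (x - y))) has_vector_derivative 2 * T * sinc (T * (x - y))) (at x within {a..b})"
        by (simp only: has_real_derivative_iff_has_vector_derivative mult_ac)
    qed
    from has_integral_linear[OF this bounded_linear_of_real]
    show "((\<lambda>x. complex_of_real (2 * T * sinc (T * (x - y)))) has_integral complex_of_real (2 * Si (T * (b - y)) - 2 * Si (T * (a - y)))) {a..b}"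
      by (simp only: o_def)
  qed
  finally show ?thesis by (simp only: right_diff_distrib)
qed

lemma Si_scaled_limit:
  assumes "c \<noteq> 0"
  shows "((\<lambda>T. Si (T * c)) \<longlongrightarrow> (if c > 0 then pi / 2 else - (pi / 2))) at_top"
proof (cases "c > 0")
  case True
  have "filterlim (\<lambda>T. T * c) at_top at_top"
    by (rule filterlim_at_top_mult_tendsto_pos[OF tendsto_const True filterlim_ident])
  from filterlim_compose[OF Si_at_top this] True show ?thesis by simp
next
  case False
  with assms have c: "- c > 0" by simp
  have "filterlim (\<lambda>T. T * (- c)) at_top at_top"
    by (rule filterlim_at_top_mult_tendsto_pos[OF tendsto_const c filterlim_ident])
  from tendsto_minus[OF filterlim_compose[OF Si_at_top this]]
  have "((\<lambda>T. - Si (T * (- c))) \<longlongrightarrow> - (pi / 2)) at_top" .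
  moreover have "\<forall>\<^sub>F T in at_top. - Si (T * (- c)) = Si (T * c)"
    using eventually_ge_at_top[of 0]
  proof eventually_elim
    case (elim T)
    hence "T * (- c) \<ge> 0" using c by (intro mult_nonneg_nonneg) auto
    from Si_neg[OF this] show ?case by simp
  qed
  ultimately show ?thesis using False by (simp add: tendsto_cong)
qed

lemma Dirichlet_kernel_limit:
  assumes "y \<noteq> a" "y \<noteq> b" "a \<le> b"
  shows "((\<lambda>T. 2 * (Si (T * (b - y)) - Si (T * (a - y)))) \<longlongrightarrow> 2 * pi * indicator {a..b} y) at_top"
proof -
  have "((\<lambda>T. 2 * (Si (T * (b - y)) - Si (T * (a - y)))) \<longlongrightarrow>
     2 * ((if b - y > 0 then pi / 2 else - (pi / 2)) - (if a - y > 0 then pi / 2 else - (pi / 2)))) at_top"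
    by (intro tendsto_intros Si_scaled_limit) (use assms in auto)
  thus ?thesis using assms by (auto simp: indicator_def split: if_splits)
qed

text \<open>
The transform is moved from \<open>f\<close> to the interval by Fubini's theorem; the Dirichlet integral of the
interval then converges boundedly to \<open>2 pi\<close> times its indicator.
\<close>
lemma truncated_inversion:
  assumes f[measurable]: "f \<in> borel_measurable borel" and f2: "integrable lborel (\<lambda>x. (cmod (f x))\<^sup>2)"
    and ab: "a \<le> b" and R: "{a..b} \<subseteq> {-R..R}"
  shows "((\<lambda>T. LINT \<xi>:{-T..T}|lborel. trunc_fourier f R \<xi> * interval_transform a b \<xi>)
     \<longlongrightarrow> 2 * complex_of_real pi * (LINT x:{a..b}|lborel. f x)) at_top"
proof -
  obtain B where B: "\<And>T. \<bar>Si T\<bar> \<le> B" using bounded_Si by blast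
  have fi: "set_integrable lborel {-R..R} f" by (rule square_integrable_local[OF f f2])
  define D where "D = (\<lambda>T y. 2 * (Si (T * (b - y)) - Si (T * (a - y))))"
  have [measurable]: "D T \<in> borel_measurable borel" for T unfolding D_def by measurable
  have DB: "\<bar>D T y\<bar> \<le> 4 * B" for T y
  proof -
    have "\<bar>2 * (p - q)\<bar> \<le> 4 * B" if "\<bar>p\<bar> \<le> B" "\<bar>q\<bar> \<le> B" for p q :: real
      using that by (auto simp: abs_le_iff)
    thus ?thesis unfolding D_def using B by blast
  qed
  have em: "(\<lambda>(\<xi>, x). cis (- (x * \<xi>))) \<in> borel_measurable (borel \<Otimes>\<^sub>M borel)" by measurable
  have eq: "(LINT \<xi>:{-T..T}|lborel. trunc_fourier f R \<xi> * interval_transform a b \<xi>)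
      = (LINT y|lborel. indicator {-R..R} y *\<^sub>R (f y * D T y))" if T: "T \<ge> 0" for T
  proof -
    have "(LINT \<xi>:{-T..T}|lborel. trunc_fourier f R \<xi> * interval_transform a b \<xi>)
       = (LINT \<xi>:{-T..T}|lborel. interval_transform a b \<xi> * (LINT y:{-R..R}|lborel. f y * cis (- (y * \<xi>))))"
      by (simp add: trunc_fourier_def mult.commute)
    also have "\<dots> = (LINT y:{-R..R}|lborel. f y * (LINT \<xi>:{-T..T}|lborel. interval_transform a b \<xi> * cis (- (y * \<xi>))))"
      by (rule Fubini_set_bounded[OF interval_transform_set_integrable fi em]) simp
    also have "\<dots> = (LINT y|lborel. indicator {-R..R} y *\<^sub>R (f y * D T y))"
    proof -
      have "(LINT \<xi>:{-T..T}|lborel. interval_transform a b \<xi> * cis (- (y * \<xi>))) = complex_of_real (D T y)" for y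
        unfolding D_def by (rule Dirichlet_kernel[OF T ab])
      thus ?thesis by (simp only: set_lebesgue_integral_def)
    qed
    finally show ?thesis .
  qed
  have "((\<lambda>T. LINT y|lborel. indicator {-R..R} y *\<^sub>R (f y * D T y))
     \<longlongrightarrow> (LINT y|lborel. indicator {-R..R} y *\<^sub>R (f y * complex_of_real (2 * pi * indicator {a..b} y)))) at_top"
  proof (rule integral_dominated_convergence_at_top[where w = "\<lambda>y. 4 * B * norm (indicator {-R..R} y *\<^sub>R f y)"])
    show "integrable lborel (\<lambda>y. 4 * B * norm (indicator {-R..R} y *\<^sub>R f y))"
      using fi unfolding set_integrable_def by (intro integrable_mult_right integrable_norm) 
    show "\<forall>\<^sub>F T in at_top. AE y in lborel. norm (indicator {-R..R} y *\<^sub>R (f y * complex_of_real (D T y)))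
        \<le> 4 * B * norm (indicator {-R..R} y *\<^sub>R f y)"
    proof (intro always_eventually allI AE_I2)
      fix T y :: real
      have "norm (indicator {-R..R} y *\<^sub>R f y) * \<bar>D T y\<bar> \<le> norm (indicator {-R..R} y *\<^sub>R f y) * (4 * B)"
        by (rule mult_left_mono[OF DB]) simp
      thus "norm (indicator {-R..R} y *\<^sub>R (f y * complex_of_real (D T y))) \<le> 4 * B * norm (indicator {-R..R} y *\<^sub>R f y)"
        by (simp add: norm_mult mult_ac)
    qed
    have "AE y in lborel. y \<noteq> a \<and> y \<noteq> b"
      using AE_lborel_singleton[of a] AE_lborel_singleton[of b] by eventually_elim simp
    thus "AE y in lborel. ((\<lambda>T. indicator {-R..R} y *\<^sub>R (f y * complex_of_real (D T y)))
       \<longlongrightarrow> indicator {-R..R} y *\<^sub>R (f y * complex_of_real (2 * pi * indicator {a..b} y))) at_top"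
    proof eventually_elim
      case (elim y)
      thus ?case unfolding D_def
        by (intro tendsto_intros tendsto_of_real Dirichlet_kernel_limit ab) auto
    qed
  qed measurable
  also have "(LINT y|lborel. indicator {-R..R} y *\<^sub>R (f y * complex_of_real (2 * pi * indicator {a..b} y)))
     = (LINT y|lborel. 2 * complex_of_real pi * (indicator {a..b} y *\<^sub>R f y))"
    by (intro Bochner_Integration.integral_cong refl) (use R in \<open>auto split: split_indicator\<close>)
  also have "\<dots> = 2 * complex_of_real pi * (LINT x:{a..b}|lborel. f x)"
    unfolding set_lebesgue_integral_def by (rule integral_mult_right_zero)
  finally show ?thesis
  proof (rule Lim_transform_eventually)
    show "\<forall>\<^sub>F T in at_top. (LINT y|lborel. indicator {-R..R} y *\<^sub>R (f y * D T y))
        = (LINT \<xi>:{-T..T}|lborel. trunc_fourier f R \<xi> * interval_transform a b \<xi>)"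
      using eventually_ge_at_top[of 0] by eventually_elim (simp only: eq)
  qed
qed


lemma cmod_sq_le_2: "(cmod u)\<^sup>2 \<le> 2 * (cmod (u - v))\<^sup>2 + 2 * (cmod v)\<^sup>2"
proof -
  have "cmod u \<le> cmod (u - v) + cmod v" using norm_triangle_ineq[of "u - v" v] by simp
  hence "(cmod u)\<^sup>2 \<le> (cmod (u - v) + cmod v)\<^sup>2" by (rule power_mono) simp
  also have "\<dots> \<le> 2 * (cmod (u - v))\<^sup>2 + 2 * (cmod v)\<^sup>2"
    using sum_squares_bound[of "cmod (u - v)" "cmod v"] by (simp add: power2_sum)
  finally show ?thesis .
qed

text \<open>
The inversion formula is tested against the indicator of an interval. Replacing the transform of a truncation
by the full one costs, by the Cauchy-Schwarz inequality, an error that is uniform in \<open>T\<close>.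
\<close>
lemma weak_inversion:
  assumes f[measurable]: "f \<in> borel_measurable borel" and f2: "integrable lborel (\<lambda>x. (cmod (f x))\<^sup>2)"
    and g[measurable]: "g \<in> borel_measurable borel" and g2: "integrable lborel (\<lambda>x. (cmod (g x))\<^sup>2)"
    and gf: "((\<lambda>R. \<integral>\<^sup>+\<xi>. ennreal ((cmod (g \<xi> - trunc_fourier f R \<xi>))\<^sup>2) \<partial>lborel) \<longlongrightarrow> 0) at_top"
    and ab: "a \<le> b"
  shows "((\<lambda>T. LINT \<xi>:{-T..T}|lborel. g \<xi> * interval_transform a b \<xi>)
     \<longlongrightarrow> 2 * complex_of_real pi * (LINT x:{a..b}|lborel. f x)) at_top"
proof (rule tendstoI)
  fix \<epsilon> :: real assume \<epsilon>: "\<epsilon> > 0"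
  define X where "X = (LINT \<xi>|lborel. (cmod (interval_transform a b \<xi>))\<^sup>2)"
  have X0: "X \<ge> 0" by (simp add: X_def)
  \<comment> \<open>Adding \<open>1\<close> avoids a case distinction on \<open>X = 0\<close>.\<close>
  define \<eta> where "\<eta> = (\<epsilon> / 2)\<^sup>2 / (X + 1)"
  have \<eta>: "\<eta> > 0" using \<epsilon> X0 by (simp add: \<eta>_def)
  have \<eta>X: "\<eta> * X < (\<epsilon> / 2)\<^sup>2" using \<epsilon> X0 by (simp add: \<eta>_def field_simps)
  have "\<forall>\<^sub>F R in at_top. (\<integral>\<^sup>+\<xi>. ennreal ((cmod (g \<xi> - trunc_fourier f R \<xi>))\<^sup>2) \<partial>lborel) < ennreal \<eta>"
    by (rule order_tendstoD(2)[OF gf]) (use \<eta> in simp)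
  hence "\<forall>\<^sub>F R in at_top. (\<integral>\<^sup>+\<xi>. ennreal ((cmod (g \<xi> - trunc_fourier f R \<xi>))\<^sup>2) \<partial>lborel) < ennreal \<eta> \<and> R \<ge> max \<bar>a\<bar> \<bar>b\<bar>"
    by (intro eventually_conj eventually_ge_at_top)
  from eventually_happens'[OF trivial_limit_at_top_linorder this]
  obtain R where R: "(\<integral>\<^sup>+\<xi>. ennreal ((cmod (g \<xi> - trunc_fourier f R \<xi>))\<^sup>2) \<partial>lborel) < ennreal \<eta>" "R \<ge> max \<bar>a\<bar> \<bar>b\<bar>"
    by blast
  define h where "h = (\<lambda>\<xi>. g \<xi> - trunc_fourier f R \<xi>)"
  have [measurable]: "h \<in> borel_measurable borel" unfolding h_def by measurable
  have h2: "integrable lborel (\<lambda>\<xi>. (cmod (h \<xi>))\<^sup>2)"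
    by (rule integrableI_nonneg) (use R(1) in \<open>auto simp: h_def intro: order.strict_trans\<close>)
  have hE: "(LINT \<xi>|lborel. (cmod (h \<xi>))\<^sup>2) \<le> \<eta>"
  proof -
    have "ennreal (LINT \<xi>|lborel. (cmod (h \<xi>))\<^sup>2) = (\<integral>\<^sup>+\<xi>. ennreal ((cmod (h \<xi>))\<^sup>2) \<partial>lborel)"
      by (rule nn_integral_eq_integral[symmetric, OF h2]) simp
    also have "\<dots> \<le> ennreal \<eta>" using R(1) by (simp add: h_def less_imp_le)
    finally show ?thesis using \<eta> by (simp add: ennreal_le_iff)
  qed
  have t2: "integrable lborel (\<lambda>\<xi>. (cmod (trunc_fourier f R \<xi>))\<^sup>2)"
  proof (rule Bochner_Integration.integrable_bound)
    show "integrable lborel (\<lambda>\<xi>. 2 * (cmod (h \<xi>))\<^sup>2 + 2 * (cmod (g \<xi>))\<^sup>2)" using h2 g2 by simp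
    show "AE \<xi> in lborel. norm ((cmod (trunc_fourier f R \<xi>))\<^sup>2) \<le> norm (2 * (cmod (h \<xi>))\<^sup>2 + 2 * (cmod (g \<xi>))\<^sup>2)"
      using cmod_sq_le_2[of "trunc_fourier f R _" "g _"] by (auto simp: h_def norm_minus_commute)
  qed measurable
  have near: "cmod ((LINT \<xi>:{-T..T}|lborel. g \<xi> * interval_transform a b \<xi>)
     - (LINT \<xi>:{-T..T}|lborel. trunc_fourier f R \<xi> * interval_transform a b \<xi>)) < \<epsilon> / 2" for T
  proof -
    have i: "set_integrable lborel {-T..T} (\<lambda>\<xi>. u \<xi> * interval_transform a b \<xi>)"
      if [measurable]: "u \<in> borel_measurable borel" and "integrable lborel (\<lambda>\<xi>. (cmod (u \<xi>))\<^sup>2)" for u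
      by (intro set_integrable_lborel Cauchy_Schwarz_LINT(1) that integrable_interval_transform_sq) (auto intro: that)
    define H where "H = (\<lambda>\<xi>. indicator {-T..T} \<xi> *\<^sub>R h \<xi>)"
    have [measurable]: "H \<in> borel_measurable borel" unfolding H_def by measurable
    have H2: "integrable lborel (\<lambda>\<xi>. (cmod (H \<xi>))\<^sup>2)"
      by (rule Bochner_Integration.integrable_bound[OF h2]) (auto simp: H_def split: split_indicator)
    have "(LINT \<xi>:{-T..T}|lborel. g \<xi> * interval_transform a b \<xi>)
       - (LINT \<xi>:{-T..T}|lborel. trunc_fourier f R \<xi> * interval_transform a b \<xi>)
       = (LINT \<xi>:{-T..T}|lborel. g \<xi> * interval_transform a b \<xi> - trunc_fourier f R \<xi> * interval_transform a b \<xi>)"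
      by (rule set_integral_diff(2)[symmetric]) (intro i g2 t2; measurable)+
    also have "\<dots> = (LINT \<xi>|lborel. H \<xi> * interval_transform a b \<xi>)"
      unfolding set_lebesgue_integral_def H_def h_def by (simp add: algebra_simps)
    finally have "(cmod ((LINT \<xi>:{-T..T}|lborel. g \<xi> * interval_transform a b \<xi>)
       - (LINT \<xi>:{-T..T}|lborel. trunc_fourier f R \<xi> * interval_transform a b \<xi>)))\<^sup>2
       = (cmod (LINT \<xi>|lborel. H \<xi> * interval_transform a b \<xi>))\<^sup>2" by simp
    also have "\<dots> \<le> (LINT \<xi>|lborel. (cmod (H \<xi>))\<^sup>2) * X"
      unfolding X_def by (rule Cauchy_Schwarz_LINT(2)) (use H2 integrable_interval_transform_sq in auto)
    also have "\<dots> \<le> \<eta> * X"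
    proof (rule mult_right_mono[OF _ X0])
      have "(LINT \<xi>|lborel. (cmod (H \<xi>))\<^sup>2) \<le> (LINT \<xi>|lborel. (cmod (h \<xi>))\<^sup>2)"
        by (rule integral_mono'[OF h2]) (auto simp: H_def split: split_indicator)
      thus "(LINT \<xi>|lborel. (cmod (H \<xi>))\<^sup>2) \<le> \<eta>" using hE by simp
    qed
    also have "\<dots> < (\<epsilon> / 2)\<^sup>2" by (rule \<eta>X)
    finally show ?thesis by (rule power2_less_imp_less) (use \<epsilon> in simp)
  qed
  have "\<forall>\<^sub>F T in at_top. dist (LINT \<xi>:{-T..T}|lborel. trunc_fourier f R \<xi> * interval_transform a b \<xi>)
      (2 * complex_of_real pi * (LINT x:{a..b}|lborel. f x)) < \<epsilon> / 2"
    by (rule tendstoD[OF truncated_inversion[OF f f2 ab]]) (use R(2) \<epsilon> in auto)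
  thus "\<forall>\<^sub>F T in at_top. dist (LINT \<xi>:{-T..T}|lborel. g \<xi> * interval_transform a b \<xi>)
      (2 * complex_of_real pi * (LINT x:{a..b}|lborel. f x)) < \<epsilon>"
  proof eventually_elim
    case (elim T)
    from near[of T] have "dist (LINT \<xi>:{-T..T}|lborel. trunc_fourier f R \<xi> * interval_transform a b \<xi>)
        (LINT \<xi>:{-T..T}|lborel. g \<xi> * interval_transform a b \<xi>) < \<epsilon> / 2"
      by (simp add: dist_norm norm_minus_commute)
    from dist_triangle_half_r[OF this elim] show ?case .
  qed
qed

lemma integral_of_wave_over_interval:
  assumes "g \<in> borel_measurable borel" and g2: "integrable lborel (\<lambda>x. (cmod (g x))\<^sup>2)"
  shows "(LINT x:{a..b}|lborel. LINT \<xi>:{-T..T}|lborel. cis (x * \<xi>) * g \<xi>)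
     = (LINT \<xi>:{-T..T}|lborel. g \<xi> * interval_transform a b \<xi>)"
proof -
  have si: "set_integrable lborel {a..b} (\<lambda>x. (1::complex))"
    by (intro borel_integrable_atLeastAtMost' continuous_intros)
  have em: "(\<lambda>(x, \<xi>). cis (x * \<xi>)) \<in> borel_measurable (borel \<Otimes>\<^sub>M borel)" by measurable
  from Fubini_set_bounded[OF si square_integrable_local[OF assms, of "-T" T] em]
  show ?thesis by (simp add: interval_transform_def mult.commute)
qed

lemma AE_zero_of_interval_integrals:
  fixes h :: "real \<Rightarrow> complex"
  assumes h: "set_integrable lborel {A..B} h"
    and z: "\<And>a b. A \<le> a \<Longrightarrow> a \<le> b \<Longrightarrow> b \<le> B \<Longrightarrow> (LINT x:{a..b}|lborel. h x) = 0"
  shows "AE x in lborel. x \<in> {A..B} \<longrightarrow> h x = 0"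
proof -
  define h' where "h' = (\<lambda>x. indicator {A..B} x *\<^sub>R h x)"
  have hi: "integrable lborel h'" using h by (simp add: h'_def set_integrable_def)
  have int: "(LINT x:{a..b}|lborel. h' x) = 0" for a b
  proof (cases "max a A \<le> min b B")
    case True
    have "(LINT x:{a..b}|lborel. h' x) = (LINT x:{max a A..min b B}|lborel. h x)"
      unfolding set_lebesgue_integral_def h'_def
      by (intro Bochner_Integration.integral_cong refl) (auto split: split_indicator)
    also have "\<dots> = 0" by (rule z) (use True in auto)
    finally show ?thesis .
  next
    case False
    have "(LINT x:{a..b}|lborel. h' x) = (LINT x::real|lborel. 0)"
      unfolding set_lebesgue_integral_def h'_def
      by (intro Bochner_Integration.integral_cong refl) (use False in \<open>auto split: split_indicator\<close>)
    thus ?thesis by simp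
  qed
  have total: "(LINT x|lborel. h' x) = 0"
  proof -
    have "(LINT x|lborel. h' x) = (LINT x:{A..B}|lborel. h' x)"
      unfolding set_lebesgue_integral_def h'_def
      by (intro Bochner_Integration.integral_cong refl) (auto split: split_indicator)
    thus ?thesis using int by simp
  qed
  have "AE x in lborel. h' x = 0"
  proof (rule sigma_finite_measure.density_zero[OF lborel.sigma_finite_measure_axioms hi])
    fix S :: "real set" assume "S \<in> sets lborel"
    hence "S \<in> sets borel" by simp
    thus "(LINT x:S|lborel. h' x) = 0"
    proof (induction rule: borel_set_induct)
      case empty show ?case by (simp add: set_lebesgue_integral_def)
    next
      case (interval a b) show ?case by (rule int)
    next
      case (compl S)
      have "(LINT x:UNIV|lborel. h' x) = (LINT x:S|lborel. h' x) + (LINT x:-S|lborel. h' x)"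
        using set_integral_Un[of S "-S" lborel h'] set_integrable_lborel[OF hi] compl(1) by simp
      thus ?case using total compl by (simp add: set_lebesgue_integral_def)
    next
      case (union S)
      have "(LINT x:(\<Union>i. S i)|lborel. h' x) = (\<Sum>i. (LINT x:S i|lborel. h' x))"
        by (rule lebesgue_integral_countable_add)
           (use union in \<open>auto simp: disjoint_family_on_def intro!: set_integrable_lborel[OF hi]\<close>)
      thus ?case using union by simp
    qed
  qed
  thus ?thesis by eventually_elim (auto simp: h'_def)
qed

section \<open>Covering numbers\<close>

lemma interval_cover:
  fixes \<Theta> :: "real set"
  assumes \<Theta>: "\<Theta> \<subseteq> {-M..M}" and \<delta>: "\<delta> > 0" and M: "M \<ge> 0"
  obtains A where "finite A" "real (card A) \<le> 2 * M / \<delta> + 1" "\<Theta> \<subseteq> (\<Union>a\<in>A. {a..a + \<delta>})"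
proof -
  define m where "m = nat \<lfloor>2 * M / \<delta>\<rfloor>"
  define A where "A = (\<lambda>k::nat. - M + real k * \<delta>) ` {..m}"
  have "card A \<le> card {..m}" unfolding A_def by (rule card_image_le) simp
  hence "real (card A) \<le> real m + 1" by simp
  also have "\<dots> \<le> 2 * M / \<delta> + 1"
    using M \<delta> by (simp add: m_def)
  finally have cA: "real (card A) \<le> 2 * M / \<delta> + 1" .
  have "x \<in> (\<Union>a\<in>A. {a..a + \<delta>})" if "x \<in> \<Theta>" for x
  proof -
    have x: "- M \<le> x" "x \<le> M" using that \<Theta> by auto
    define k where "k = nat \<lfloor>(x + M) / \<delta>\<rfloor>"
    have pos: "(x + M) / \<delta> \<ge> 0" using x \<delta> by simp
    have "(x + M) / \<delta> \<le> 2 * M / \<delta>" using x \<delta> by (intro divide_right_mono) auto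
    hence "k \<le> m" unfolding k_def m_def by (intro nat_mono floor_mono)
    moreover have "real k \<le> (x + M) / \<delta>" "(x + M) / \<delta> < real k + 1"
    proof -
      have "\<lfloor>(x + M) / \<delta>\<rfloor> \<ge> 0" using pos by (simp only: zero_le_floor)
      hence "real k = real_of_int \<lfloor>(x + M) / \<delta>\<rfloor>" unfolding k_def by (rule of_nat_nat)
      thus "real k \<le> (x + M) / \<delta>" "(x + M) / \<delta> < real k + 1"
        using floor_correct[of "(x + M) / \<delta>"] by simp_all
    qed
    hence "real k * \<delta> \<le> x + M" "x + M < (real k + 1) * \<delta>"
      using \<delta> by (simp_all only: pos_le_divide_eq pos_divide_less_eq)
    hence "x \<in> {(- M + real k * \<delta>)..(- M + real k * \<delta>) + \<delta>}"
      by (auto simp: algebra_simps)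
    ultimately show ?thesis unfolding A_def by blast
  qed
  thus ?thesis using that[of A] cA unfolding A_def by blast
qed

lemma covering_number_properties:
  assumes \<Theta>: "\<Theta> \<subseteq> {-M..M}" and \<delta>: "\<delta> > 0" and M: "M \<ge> 0"
  shows "real (covering_number \<Theta> \<delta>) \<le> 2 * M / \<delta> + 1"
    and "\<exists>A. finite A \<and> card A = covering_number \<Theta> \<delta> \<and> \<Theta> \<subseteq> (\<Union>a\<in>A. {a..a + \<delta>})"
proof -
  obtain A where A: "finite A" "real (card A) \<le> 2 * M / \<delta> + 1" "\<Theta> \<subseteq> (\<Union>a\<in>A. {a..a + \<delta>})"
    using interval_cover[OF assms] by blast
  let ?P = "\<lambda>n. \<exists>A. finite A \<and> card A = n \<and> \<Theta> \<subseteq> (\<Union>a\<in>A. {a..a + \<delta>})"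
  have P: "?P (card A)" using A by blast
  have "covering_number \<Theta> \<delta> \<le> card A" unfolding covering_number_def by (rule Least_le[of ?P, OF P])
  thus "real (covering_number \<Theta> \<delta>) \<le> 2 * M / \<delta> + 1" using A(2) by linarith
  show "?P (covering_number \<Theta> \<delta>)" unfolding covering_number_def by (rule LeastI[of ?P, OF P])
qed

text \<open>
The infimum defining the dimension is taken over a nonempty set, because \<open>2\<close> belongs to it for every
bounded set. Hence some admissible exponent lies below \<open>d\<close>.
\<close>
lemma covering_number_below_power:
  assumes \<Theta>: "\<Theta> \<subseteq> {-M..M}" and M: "M \<ge> 0" and d: "upper_Minkowski_dim \<Theta> < d"
  obtains r where "0 < r" "r < d" "\<forall>\<^sub>F \<delta> in at_right 0. real (covering_number \<Theta> \<delta>) * \<delta> powr r < 1"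
proof -
  let ?S = "{r. r > 0 \<and> Limsup (at_right 0) (\<lambda>\<delta>. ereal (real (covering_number \<Theta> \<delta>) * \<delta> powr r)) = 0}"
  have "2 \<in> ?S"
  proof -
    have "((\<lambda>\<delta>. real (covering_number \<Theta> \<delta>) * \<delta> powr 2) \<longlongrightarrow> 0) (at_right 0)"
    proof (rule tendsto_sandwich)
      show "\<forall>\<^sub>F \<delta> in at_right 0. 0 \<le> real (covering_number \<Theta> \<delta>) * \<delta> powr 2" by simp
      show "\<forall>\<^sub>F \<delta> in at_right 0. real (covering_number \<Theta> \<delta>) * \<delta> powr 2 \<le> 2 * M * \<delta> + \<delta>\<^sup>2"
        using eventually_at_right_less[of "0::real"]
      proof eventually_elim
        case (elim \<delta>)
        have "real (covering_number \<Theta> \<delta>) * \<delta>\<^sup>2 \<le> (2 * M / \<delta> + 1) * \<delta>\<^sup>2"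
          by (rule mult_right_mono[OF covering_number_properties(1)[OF \<Theta> elim M]]) simp
        also have "\<dots> = 2 * M * \<delta> + \<delta>\<^sup>2" using elim by (simp add: field_simps power2_eq_square)
        finally show ?case using elim by simp
      qed
      have "((\<lambda>\<delta>. 2 * M * \<delta> + \<delta>\<^sup>2) \<longlongrightarrow> 2 * M * 0 + 0\<^sup>2) (at_right 0)"
        by (intro tendsto_intros)
      thus "((\<lambda>\<delta>. 2 * M * \<delta> + \<delta>\<^sup>2) \<longlongrightarrow> 0) (at_right 0)" by simp
    qed simp
    hence "((\<lambda>\<delta>. ereal (real (covering_number \<Theta> \<delta>) * \<delta> powr 2)) \<longlongrightarrow> ereal 0) (at_right 0)"
      by (rule tendsto_ereal)
    from lim_imp_Limsup[OF _ this] show ?thesis by simp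
  qed
  hence "\<exists>r\<in>?S. r < d"
    by (intro cInf_lessD) (use d in \<open>auto simp only: upper_Minkowski_dim_def\<close>)
  then obtain r where r: "r \<in> ?S" "r < d" by blast
  have "\<forall>\<^sub>F \<delta> in at_right 0. ereal (real (covering_number \<Theta> \<delta>) * \<delta> powr r) < 1"
    by (rule Limsup_lessD) (use r in simp)
  hence "\<forall>\<^sub>F \<delta> in at_right 0. real (covering_number \<Theta> \<delta>) * \<delta> powr r < 1"
    by eventually_elim simp
  thus ?thesis using that[of r] r by auto
qed

text \<open>
At frequency \<open>2 ^ n\<close> the relevant length of a piece of \<open>\<Theta>\<close> is \<open>2 ^ (- n / 2)\<close>, which turns the exponent
\<open>r\<close> into \<open>r / 2\<close>.
\<close>
lemma covering_at_dyadic_scales: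
  assumes \<Theta>: "\<Theta> \<subseteq> {-M..M}" and M: "M \<ge> 0" and d: "upper_Minkowski_dim \<Theta> < d"
  obtains r n0 where "0 < r" "r < d"
    "\<And>n::nat. n \<ge> n0 \<Longrightarrow> \<exists>A. finite A \<and> real (card A) \<le> (2 ^ n) powr (r / 2) \<and> \<Theta> \<subseteq> (\<Union>a\<in>A. {a..a + 1 / sqrt (2 ^ n)})"
proof -
  obtain r where r: "0 < r" "r < d" and ev: "\<forall>\<^sub>F \<delta> in at_right 0. real (covering_number \<Theta> \<delta>) * \<delta> powr r < 1"
    using covering_number_below_power[OF assms] by blast
  have "filterlim (\<lambda>n. 1 / sqrt (2 ^ n)) (at_right 0) sequentially"
    unfolding filterlim_at
  proof
    have "(\<lambda>n. sqrt ((1/2) ^ n)) \<longlonglongrightarrow> sqrt 0"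
      by (intro tendsto_real_sqrt LIMSEQ_realpow_zero) auto
    thus "(\<lambda>n. 1 / sqrt (2 ^ n)) \<longlonglongrightarrow> 0" by (simp add: power_one_over real_sqrt_divide)
  qed auto
  from eventually_compose_filterlim[OF ev this]
  obtain n0 where n0: "\<And>n. n \<ge> n0 \<Longrightarrow> real (covering_number \<Theta> (1 / sqrt (2 ^ n))) * (1 / sqrt (2 ^ n)) powr r < 1"
    by (auto simp: eventually_sequentially)
  show ?thesis
  proof (rule that[OF r])
    fix n :: nat assume n: "n \<ge> n0"
    define \<delta> :: real where "\<delta> = 1 / sqrt (2 ^ n)"
    have \<delta>: "\<delta> > 0" by (simp add: \<delta>_def)
    obtain A where A: "finite A" "card A = covering_number \<Theta> \<delta>" "\<Theta> \<subseteq> (\<Union>a\<in>A. {a..a + \<delta>})"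
      using covering_number_properties(2)[OF \<Theta> \<delta> M] by blast
    have "\<delta> = (2 ^ n) powr (- (1 / 2))"
      by (simp add: \<delta>_def powr_minus powr_half_sqrt inverse_eq_divide)
    hence "\<delta> powr r = (2 ^ n) powr (- (r / 2))" by (simp add: powr_powr)
    hence "real (card A) * (2 ^ n) powr (- (r / 2)) < 1" using n0[OF n] A(2) by (simp add: \<delta>_def)
    hence "real (card A) < (2 ^ n) powr (r / 2)" by (simp add: powr_minus field_simps)
    thus "\<exists>A. finite A \<and> real (card A) \<le> (2 ^ n) powr (r / 2) \<and> \<Theta> \<subseteq> (\<Union>a\<in>A. {a..a + 1 / sqrt (2 ^ n)})"
      using A by (auto simp: \<delta>_def)
  qed
qed

section \<open>Geometric decay of the dyadic blocks\<close>

lemma wave_continuous: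
  assumes g: "set_integrable lborel E g" and [measurable]: "\<Phi> \<in> borel_measurable borel" "E \<in> sets borel"
  shows "continuous_on UNIV (\<lambda>p. wave \<Phi> g E (fst p) (snd p))"
  unfolding continuous_on_sequentially
proof (intro ballI allI impI, elim conjE)
  fix u :: "nat \<Rightarrow> real \<times> real" and p assume u: "u \<longlonglongrightarrow> p"
  have 1: "integrable lborel (\<lambda>\<xi>. indicator E \<xi> *\<^sub>R g \<xi>)" using g by (simp add: set_integrable_def)
  hence [measurable]: "(\<lambda>\<xi>. indicator E \<xi> *\<^sub>R g \<xi>) \<in> borel_measurable borel" by auto
  have eq: "wave \<Phi> g E y t = (LINT \<xi>|lborel. cis (y * \<xi> + t * \<Phi> \<xi>) * (indicator E \<xi> *\<^sub>R g \<xi>))" for y t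
    unfolding wave_def set_lebesgue_integral_def by simp
  have "(\<lambda>n. LINT \<xi>|lborel. cis (fst (u n) * \<xi> + snd (u n) * \<Phi> \<xi>) * (indicator E \<xi> *\<^sub>R g \<xi>))
    \<longlonglongrightarrow> (LINT \<xi>|lborel. cis (fst p * \<xi> + snd p * \<Phi> \<xi>) * (indicator E \<xi> *\<^sub>R g \<xi>))"
  proof (rule integral_dominated_convergence[where w = "\<lambda>\<xi>. norm (indicator E \<xi> *\<^sub>R g \<xi>)"])
    show "integrable lborel (\<lambda>\<xi>. norm (indicator E \<xi> *\<^sub>R g \<xi>))" by (rule integrable_norm[OF 1])
    have cis: "(\<lambda>n. cis (v n)) \<longlonglongrightarrow> cis w" if "v \<longlonglongrightarrow> w" for v :: "nat \<Rightarrow> real" and w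
    proof -
      have "continuous_on UNIV (\<lambda>x. cis x)" by (rule continuous_on_cis[OF continuous_on_id])
      from continuous_on_tendsto_compose[OF this that] show ?thesis by simp
    qed
    show "AE \<xi> in lborel. (\<lambda>n. cis (fst (u n) * \<xi> + snd (u n) * \<Phi> \<xi>) * (indicator E \<xi> *\<^sub>R g \<xi>))
      \<longlonglongrightarrow> cis (fst p * \<xi> + snd p * \<Phi> \<xi>) * (indicator E \<xi> *\<^sub>R g \<xi>)"
    proof (rule AE_I2)
      fix \<xi> :: real
      have f: "(\<lambda>n. fst (u n)) \<longlonglongrightarrow> fst p" and s: "(\<lambda>n. snd (u n)) \<longlonglongrightarrow> snd p"
        using tendsto_fst[OF u] tendsto_snd[OF u] by simp_all
      have "(\<lambda>n. fst (u n) * \<xi> + snd (u n) * \<Phi> \<xi>) \<longlonglongrightarrow> fst p * \<xi> + snd p * \<Phi> \<xi>"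
        by (rule tendsto_add[OF tendsto_mult_right[OF f] tendsto_mult_right[OF s]])
      from cis[OF this]
      show "(\<lambda>n. cis (fst (u n) * \<xi> + snd (u n) * \<Phi> \<xi>) * (indicator E \<xi> *\<^sub>R g \<xi>))
        \<longlonglongrightarrow> cis (fst p * \<xi> + snd p * \<Phi> \<xi>) * (indicator E \<xi> *\<^sub>R g \<xi>)"
        by (rule tendsto_mult_right)
    qed
    show "(\<lambda>\<xi>. cis (fst p * \<xi> + snd p * \<Phi> \<xi>) * (indicator E \<xi> *\<^sub>R g \<xi>)) \<in> borel_measurable lborel" by measurable
    show "(\<lambda>\<xi>. cis (fst (u n) * \<xi> + snd (u n) * \<Phi> \<xi>) * (indicator E \<xi> *\<^sub>R g \<xi>)) \<in> borel_measurable lborel" for n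
      by measurable
  qed (auto simp: norm_mult)
  thus "((\<lambda>p. wave \<Phi> g E (fst p) (snd p)) \<circ> u) \<longlonglongrightarrow> wave \<Phi> g E (fst p) (snd p)"
    by (simp add: eq o_def)
qed

text \<open>
On the block the Sobolev weight is at least \<open>l powr (2 s)\<close>.
\<close>
lemma weighted_block_bound:
  assumes g[measurable]: "g \<in> borel_measurable borel"
    and W: "integrable lborel (\<lambda>\<xi>. (1 + \<xi>\<^sup>2) powr s * (cmod (g \<xi>))\<^sup>2)" and s: "s \<ge> 0" and l: "l > 0"
  shows "set_integrable lborel (dyadic_block l) (\<lambda>\<xi>. (cmod (g \<xi>))\<^sup>2)"
    and "(LINT \<xi>:dyadic_block l|lborel. (cmod (g \<xi>))\<^sup>2) \<le> l powr (- (2 * s)) * (LINT \<xi>|lborel. (1 + \<xi>\<^sup>2) powr s * (cmod (g \<xi>))\<^sup>2)"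
proof -
  have le: "indicator (dyadic_block l) \<xi> *\<^sub>R (cmod (g \<xi>))\<^sup>2 \<le> l powr (- (2 * s)) * ((1 + \<xi>\<^sup>2) powr s * (cmod (g \<xi>))\<^sup>2)" for \<xi>
  proof (cases "\<xi> \<in> dyadic_block l")
    case True
    hence "l \<le> \<bar>\<xi>\<bar>" by (simp add: dyadic_block_def)
    hence "l\<^sup>2 \<le> 1 + \<xi>\<^sup>2" using power_mono[of l "\<bar>\<xi>\<bar>" 2] l by simp
    hence "(l\<^sup>2) powr s \<le> (1 + \<xi>\<^sup>2) powr s" using s by (intro powr_mono2) auto
    moreover have "(l\<^sup>2) powr s = l powr (2 * s)"
    proof -
      have "l\<^sup>2 = l powr 2" using l by simp
      thus ?thesis by (simp only: powr_powr)
    qed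
    ultimately have "l powr (- (2 * s)) * (l powr (2 * s)) \<le> l powr (- (2 * s)) * (1 + \<xi>\<^sup>2) powr s"
      by (intro mult_left_mono) auto
    hence "1 \<le> l powr (- (2 * s)) * (1 + \<xi>\<^sup>2) powr s" using l by (simp flip: powr_add)
    from mult_right_mono[OF this, of "(cmod (g \<xi>))\<^sup>2"] True show ?thesis by (simp add: mult.assoc)
  qed simp
  have i: "integrable lborel (\<lambda>\<xi>. l powr (- (2 * s)) * ((1 + \<xi>\<^sup>2) powr s * (cmod (g \<xi>))\<^sup>2))" using W by simp
  show "set_integrable lborel (dyadic_block l) (\<lambda>\<xi>. (cmod (g \<xi>))\<^sup>2)"
    unfolding set_integrable_def
    by (rule Bochner_Integration.integrable_bound[OF i]) (use le in \<open>auto intro!: AE_I2 order.trans[OF _ abs_ge_self]\<close>)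
  show "(LINT \<xi>:dyadic_block l|lborel. (cmod (g \<xi>))\<^sup>2) \<le> l powr (- (2 * s)) * (LINT \<xi>|lborel. (1 + \<xi>\<^sup>2) powr s * (cmod (g \<xi>))\<^sup>2)"
    unfolding set_lebesgue_integral_def integral_mult_right_zero[symmetric]
    by (rule integral_mono'[OF i]) (use le in auto)
qed

lemma wave_bound_from_dense:
  assumes g: "set_integrable lborel E g" and [measurable]: "\<Phi> \<in> borel_measurable borel" "E \<in> sets borel"
    and D: "S \<subseteq> closure D" and le: "\<And>p. p \<in> D \<Longrightarrow> cmod (wave \<Phi> g E (x + fst p * snd p) (fst p)) \<le> C" and p: "p \<in> S"
  shows "cmod (wave \<Phi> g E (x + fst p * snd p) (fst p)) \<le> C"
proof -
  have c: "continuous_on UNIV (\<lambda>p. cmod (wave \<Phi> g E (x + fst p * snd p) (fst p)))"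
  proof (rule continuous_on_norm)
    have "continuous_on UNIV (\<lambda>p::real \<times> real. (x + fst p * snd p, fst p))" by (intro continuous_intros)
    from continuous_on_compose2[OF wave_continuous[OF g assms(2,3)] this]
    show "continuous_on UNIV (\<lambda>p. wave \<Phi> g E (x + fst p * snd p) (fst p))" by simp
  qed
  have "closed {p. cmod (wave \<Phi> g E (x + fst p * snd p) (fst p)) \<le> C}"
    by (intro closed_Collect_le c continuous_intros)
  moreover have "D \<subseteq> {p. cmod (wave \<Phi> g E (x + fst p * snd p) (fst p)) \<le> C}" using le by auto
  ultimately have "closure D \<subseteq> {p. cmod (wave \<Phi> g E (x + fst p * snd p) (fst p)) \<le> C}" by (rule closure_minimal[rotated])
  with D p show ?thesis by auto
qed

text \<open>
With \<open>\<epsilon> = 2 s - 1/2 - r/2 > 0\<close>, the squared maximal function of the \<open>n\<close>-th block has integral at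
most of order \<open>2 powr (- n \<epsilon>)\<close> over \<open>[-R, R]\<close>. Spending half of this gain, the sum \<open>H0\<close> of the squared
maximal functions with weights \<open>2 powr (n \<epsilon> / 2)\<close> is still integrable, hence finite almost everywhere,
and each single block is bounded by it. Integrability of \<open>H\<close> is needed again when the limit of the
partial integrals is identified.
\<close>
lemma dyadic_maximal_decay:
  assumes \<Phi>: "dispersive \<Phi> C1 C2" and \<Theta>: "\<Theta> \<subseteq> {-M..M}" and M: "M \<ge> 1"
    and g[measurable]: "g \<in> borel_measurable borel"
    and W: "integrable lborel (\<lambda>\<xi>. (1 + \<xi>\<^sup>2) powr s * (cmod (g \<xi>))\<^sup>2)"
    and gl: "\<And>l. set_integrable lborel (dyadic_block l) g"
    and s: "s > (upper_Minkowski_dim \<Theta> + 1) / 4" and R: "R \<ge> 0"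
  obtains q n0 H where "0 < q" "q < 1" "H \<in> borel_measurable borel" "\<And>x. H x \<ge> (0::real)"
    "set_integrable lborel {-R..R} H"
    "AE x in lborel. x \<in> {-R..R} \<longrightarrow> (\<forall>n\<ge>n0. \<forall>t\<in>{-1..1}. \<forall>\<theta>\<in>\<Theta>.
        cmod (wave \<Phi> g (dyadic_block (2 ^ n)) (x + t * \<theta>) t) \<le> H x * q ^ n)"
proof -
  note [measurable] = dispersive_measurable[OF \<Phi>]
  have d: "upper_Minkowski_dim \<Theta> < 4 * s - 1" using s by simp
  have M0: "M \<ge> 0" using M by simp
  obtain r n0 where r: "0 < r" "r < 4 * s - 1" and cov: "\<And>n::nat. n \<ge> n0 \<Longrightarrow>
      \<exists>A. finite A \<and> real (card A) \<le> (2 ^ n) powr (r / 2) \<and> \<Theta> \<subseteq> (\<Union>a\<in>A. {a..a + 1 / sqrt (2 ^ n)})"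
    using covering_at_dyadic_scales[OF \<Theta> M0 d] by blast
  have s0: "s \<ge> 0" using r by simp
  \<comment> \<open>Suprema are taken over a countable dense set of times and directions to stay measurable.\<close>
  obtain D where D: "countable D" "D \<subseteq> {-1..1::real} \<times> \<Theta>" "{-1..1} \<times> \<Theta> \<subseteq> closure D"
    by (rule separable[of "{-1..1::real} \<times> \<Theta>"]) (rule that, assumption+)
  define K where "K = maximal_const R M C1 C2 * (LINT \<xi>|lborel. (1 + \<xi>\<^sup>2) powr s * (cmod (g \<xi>))\<^sup>2)"
  have mc0: "maximal_const R M C1 C2 \<ge> 0" using kernel_const_nonneg[OF \<Phi> M] R by (simp add: maximal_const_def)
  have K0: "K \<ge> 0" unfolding K_def using mc0 by simp
  define \<epsilon> where "\<epsilon> = 2 * s - 1 / 2 - r / 2"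
  have \<epsilon>: "\<epsilon> > 0" using r by (simp add: \<epsilon>_def)
  define p where "p = 2 powr (- (\<epsilon> / 2))"
  have p: "0 < p" "p < 1" using \<epsilon> by (auto simp: p_def powr_less_one)
  have pp: "p * p = 2 powr (- \<epsilon>)" unfolding p_def by (simp flip: powr_add)
  define B where "B = (\<lambda>n x. SUP e\<in>D. wave_sq \<Phi> g (dyadic_block (2 ^ n)) e x)"
  have Bm[measurable]: "B n \<in> borel_measurable borel" for n
    unfolding B_def by (rule borel_measurable_SUP[OF D(1)]) measurable
  have Bint: "(\<integral>\<^sup>+x\<in>{-R..R}. B n x \<partial>lborel) \<le> ennreal (K * (p * p) ^ n)" if n: "n \<ge> n0" for n
  proof -
    define l :: real where "l = 2 ^ n"
    have l: "l \<ge> 1" by (simp add: l_def)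
    obtain A where A: "finite A" "real (card A) \<le> l powr (r / 2)" "\<Theta> \<subseteq> (\<Union>a\<in>A. {a..a + 1 / sqrt l})"
      using cov[OF n] unfolding l_def by blast
    define I where "I = (LINT \<xi>:dyadic_block l|lborel. (cmod (g \<xi>))\<^sup>2)"
    have I0: "I \<ge> 0" unfolding I_def set_lebesgue_integral_def by simp
    have l0: "l > 0" using l by simp
    note wb = weighted_block_bound[OF g W s0 l0]
    have "(\<integral>\<^sup>+x\<in>{-R..R}. B n x \<partial>lborel) \<le> ennreal (card A * (maximal_const R M C1 C2 * sqrt l * I))"
      unfolding B_def l_def[symmetric] I_def
      by (rule maximal_estimate_covering[OF \<Phi> l M R g wb(1) D(1,2) \<Theta> A(1,3)])
    also have "\<dots> \<le> ennreal (l powr (r / 2) * (maximal_const R M C1 C2 * sqrt l *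
        (l powr (- (2 * s)) * (LINT \<xi>|lborel. (1 + \<xi>\<^sup>2) powr s * (cmod (g \<xi>))\<^sup>2))))"
      using A(2) wb(2) mc0 l I0
      by (intro ennreal_leI mult_mono) (auto simp: I_def intro!: mult_nonneg_nonneg)
    also have "l powr (r / 2) * (maximal_const R M C1 C2 * sqrt l *
        (l powr (- (2 * s)) * (LINT \<xi>|lborel. (1 + \<xi>\<^sup>2) powr s * (cmod (g \<xi>))\<^sup>2)))
       = K * (l powr (r / 2) * l powr (1 / 2) * l powr (- (2 * s)))"
      using l by (simp add: K_def powr_half_sqrt)
    also have "l powr (r / 2) * l powr (1 / 2) * l powr (- (2 * s)) = l powr (- \<epsilon>)"
    proof -
      have "r / 2 + 1 / 2 + - (2 * s) = - \<epsilon>" by (simp add: \<epsilon>_def)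
      thus ?thesis by (simp only: flip: powr_add)
    qed
    also have "\<dots> = (p * p) ^ n"
      unfolding pp by (simp add: l_def powr_powr mult.commute flip: powr_realpow)
    finally show ?thesis .
  qed
  define H0 where "H0 = (\<lambda>x. \<Sum>k. ennreal ((1 / p) ^ (k + n0)) * B (k + n0) x)"
  have H0m[measurable]: "H0 \<in> borel_measurable borel" unfolding H0_def by measurable
  have "(\<integral>\<^sup>+x\<in>{-R..R}. H0 x \<partial>lborel) = (\<integral>\<^sup>+x. (\<Sum>k. ennreal ((1 / p) ^ (k + n0)) * (B (k + n0) x * indicator {-R..R} x)) \<partial>lborel)"
    unfolding H0_def by (intro nn_integral_cong) (simp add: mult.assoc flip: ennreal_suminf_multc)
  also have "\<dots> = (\<Sum>k. ennreal ((1 / p) ^ (k + n0)) * (\<integral>\<^sup>+x\<in>{-R..R}. B (k + n0) x \<partial>lborel))"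
    by (subst nn_integral_suminf, measurable) (intro suminf_cong nn_integral_cmult, measurable)
  also have "\<dots> \<le> (\<Sum>k. ennreal (K * p ^ (k + n0)))"
  proof (rule suminf_le)
    fix k
    have "ennreal ((1 / p) ^ (k + n0)) * (\<integral>\<^sup>+x\<in>{-R..R}. B (k + n0) x \<partial>lborel)
       \<le> ennreal ((1 / p) ^ (k + n0)) * ennreal (K * (p * p) ^ (k + n0))"
      by (intro mult_left_mono Bint) auto
    also have "\<dots> = ennreal ((1 / p) ^ (k + n0) * (K * (p * p) ^ (k + n0)))"
      using p K0 by (intro ennreal_mult[symmetric]) auto
    also have "(1 / p) ^ (k + n0) * (K * (p * p) ^ (k + n0)) = K * p ^ (k + n0)"
      using p by (simp add: power_mult_distrib power_one_over)
    finally show "ennreal ((1 / p) ^ (k + n0)) * (\<integral>\<^sup>+x\<in>{-R..R}. B (k + n0) x \<partial>lborel) \<le> ennreal (K * p ^ (k + n0))" .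
  qed auto
  also have "\<dots> = ennreal (\<Sum>k. K * p ^ (k + n0))"
    using p K0 by (intro suminf_ennreal2 summable_mult summable_ignore_initial_segment summable_geometric) auto
  also have "\<dots> < \<infinity>" by simp
  finally have H0fin: "(\<integral>\<^sup>+x\<in>{-R..R}. H0 x \<partial>lborel) < \<infinity>" .
  \<comment> \<open>Adding \<open>1\<close> turns the bound \<open>H0 x\<close> for the squares into one for the values: \<open>h \<le> (1 + h)\<^sup>2\<close>.\<close>
  define H where "H = (\<lambda>x. 1 + enn2real (H0 x))"
  have Hm[measurable]: "H \<in> borel_measurable borel" unfolding H_def by measurable
  have H0: "H x \<ge> 0" for x unfolding H_def by (simp add: add_nonneg_nonneg)
  have "set_integrable lborel {-R..R} (\<lambda>x. enn2real (H0 x))"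
    unfolding set_integrable_def
  proof (rule integrableI_nonneg)
    have "(\<integral>\<^sup>+x. ennreal (indicat_real {-R..R} x *\<^sub>R enn2real (H0 x)) \<partial>lborel) \<le> (\<integral>\<^sup>+x\<in>{-R..R}. H0 x \<partial>lborel)"
      by (intro nn_integral_mono) (auto simp: ennreal_enn2real_if split: split_indicator)
    thus "(\<integral>\<^sup>+x. ennreal (indicat_real {-R..R} x *\<^sub>R enn2real (H0 x)) \<partial>lborel) < \<infinity>"
      using H0fin by (rule order.strict_trans1)
  qed auto
  moreover have "set_integrable lborel {-R..R} (\<lambda>x. 1::real)"
    by (intro borel_integrable_atLeastAtMost' continuous_intros)
  ultimately have Hi: "set_integrable lborel {-R..R} H"
    unfolding H_def by (intro set_integral_add)
  define q where "q = sqrt p"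
  have q: "0 < q" "q < 1" "q\<^sup>2 = p" using p by (auto simp: q_def)
  have "AE x in lborel. H0 x * indicator {-R..R} x \<noteq> \<infinity>"
    by (rule nn_integral_PInf_AE) (use H0fin in auto)
  hence AE: "AE x in lborel. x \<in> {-R..R} \<longrightarrow> (\<forall>n\<ge>n0. \<forall>t\<in>{-1..1}. \<forall>\<theta>\<in>\<Theta>.
        cmod (wave \<Phi> g (dyadic_block (2 ^ n)) (x + t * \<theta>) t) \<le> H x * q ^ n)"
  proof eventually_elim
    case (elim x)
    show ?case
    proof (intro impI allI ballI)
      fix n :: nat and t \<theta> :: real assume x: "x \<in> {-R..R}" and n: "n \<ge> n0" and t: "t \<in> {-1..1}" and \<theta>: "\<theta> \<in> \<Theta>"
      from elim x have "H0 x \<noteq> top" by simp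
      then obtain h where h: "H0 x = ennreal h" "h \<ge> 0" by (cases "H0 x") auto
      have Hx: "H x = 1 + h" using h by (simp add: H_def)
      have "cmod (wave \<Phi> g (dyadic_block (2 ^ n)) (x + fst (t, \<theta>) * snd (t, \<theta>)) (fst (t, \<theta>))) \<le> H x * q ^ n"
      proof (rule wave_bound_from_dense[OF gl _ _ D(3)])
        fix e assume e: "e \<in> D"
        let ?w = "cmod (wave \<Phi> g (dyadic_block (2 ^ n)) (x + fst e * snd e) (fst e))"
        have "ennreal ((1 / p) ^ n) * ennreal (?w\<^sup>2) \<le> ennreal ((1 / p) ^ n) * B n x"
          unfolding B_def by (intro mult_left_mono SUP_upper e) simp
        also have "\<dots> \<le> H0 x"
        proof -
          have "(\<lambda>k. ennreal ((1 / p) ^ (k + n0)) * B (k + n0) x) (n - n0) \<le> H0 x"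
            unfolding H0_def using sum_le_suminf[of "\<lambda>k. ennreal ((1 / p) ^ (k + n0)) * B (k + n0) x" "{n - n0}"] by simp
          thus ?thesis using n by simp
        qed
        finally have "ennreal ((1 / p) ^ n * ?w\<^sup>2) \<le> ennreal h"
          using p h(1) by (simp add: ennreal_mult)
        hence "(1 / p) ^ n * ?w\<^sup>2 \<le> h" using h(2) by (simp add: ennreal_le_iff)
        hence "?w\<^sup>2 \<le> h * p ^ n" using p by (simp add: power_one_over field_simps)
        also have "\<dots> \<le> (1 + h)\<^sup>2 * p ^ n"
        proof (rule mult_right_mono)
          show "h \<le> (1 + h)\<^sup>2" using h(2) by (simp add: power2_sum)
        qed (use p in simp)
        also have "\<dots> = ((1 + h) * q ^ n)\<^sup>2"
          unfolding q(3)[symmetric] by (simp add: power_mult_distrib power_mult[symmetric] mult.commute)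
        finally show "?w \<le> H x * q ^ n"
          unfolding Hx by (rule power2_le_imp_le) (use h(2) q in auto)
      qed (use t \<theta> in auto)
      thus "cmod (wave \<Phi> g (dyadic_block (2 ^ n)) (x + t * \<theta>) t) \<le> H x * q ^ n" by simp
    qed
  qed
  show ?thesis by (rule that[OF q(1,2) Hm H0 Hi AE])
qed

section \<open>Convergence almost everywhere\<close>

lemma geometric_increments:
  fixes z :: "nat \<Rightarrow> complex"
  assumes d: "\<And>n. n \<ge> n0 \<Longrightarrow> cmod (z (Suc n) - z n) \<le> h * q ^ n" and q: "0 < q" "q < 1" and h: "h \<ge> 0"
  shows "convergent z" and "n \<ge> n0 \<Longrightarrow> cmod (z n - z n0) \<le> h / (1 - q)"
proof -
  have "summable (\<lambda>k. z (Suc k) - z k)"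
  proof (rule summable_comparison_test)
    show "\<exists>N. \<forall>n\<ge>N. norm (z (Suc n) - z n) \<le> h * q ^ n" using d by blast
    show "summable (\<lambda>n. h * q ^ n)" using q by (intro summable_mult summable_geometric) auto
  qed
  then obtain L where "(\<lambda>n. \<Sum>k<n. z (Suc k) - z k) \<longlonglongrightarrow> L" by (auto simp: summable_def sums_def)
  hence "(\<lambda>n. z n - z 0) \<longlonglongrightarrow> L" by (simp add: sum_lessThan_telescope[of z])
  from tendsto_add[OF this tendsto_const[of "z 0"]] show "convergent z" by (auto simp: convergent_def)
  assume "n \<ge> n0"
  hence "cmod (z n - z n0) \<le> h * (q ^ n0 - q ^ n) / (1 - q)"
  proof (induction n rule: dec_induct)
    case (step n)
    have "cmod (z (Suc n) - z n0) \<le> cmod (z (Suc n) - z n) + cmod (z n - z n0)"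
      using norm_triangle_ineq[of "z (Suc n) - z n" "z n - z n0"] by simp
    also have "\<dots> \<le> h * q ^ n + h * (q ^ n0 - q ^ n) / (1 - q)"
      using step d[of n] by simp
    also have "\<dots> = h * (q ^ n0 - q ^ Suc n) / (1 - q)" using q by (simp add: field_simps)
    finally show ?case .
  qed simp
  also have "\<dots> \<le> h / (1 - q)"
  proof (rule divide_right_mono)
    have "q ^ n0 - q ^ n \<le> 1" using power_le_one[of q n0] q zero_le_power[of q n] by linarith
    thus "h * (q ^ n0 - q ^ n) \<le> h" using h by (simp add: mult_left_le)
  qed (use q in simp)
  finally show "cmod (z n - z n0) \<le> h / (1 - q)" .
qed

lemma wave_dyadic_step:
  assumes g: "\<And>a b. set_integrable lborel {a..b} g" and [measurable]: "\<Phi> \<in> borel_measurable borel"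
  shows "wave \<Phi> g {-(2 ^ Suc n)..2 ^ Suc n} y t - wave \<Phi> g {-(2 ^ n)..2 ^ n} y t = wave \<Phi> g (dyadic_block (2 ^ n)) y t"
proof -
  let ?e = "\<lambda>\<xi>. cis (y * \<xi> + t * \<Phi> \<xi>) * g \<xi>"
  have i: "set_integrable lborel {a..b} ?e" for a b by (rule set_integrable_cis_mult[OF g]) measurable
  have ib: "set_integrable lborel (dyadic_block (2 ^ n)) ?e"
    by (rule set_integrable_subset[OF i[of "-(2 ^ Suc n)" "2 ^ Suc n"]]) (auto simp: dyadic_block_def abs_le_iff)
  have "{-(2 ^ Suc n)..2 ^ Suc n} = {-(2 ^ n)..2 ^ n} \<union> dyadic_block (2 ^ n :: real)"
  proof (rule set_eqI)
    fix \<xi> :: real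
    have "(2::real) ^ n > 0" by simp
    thus "\<xi> \<in> {-(2 ^ Suc n)..2 ^ Suc n} \<longleftrightarrow> \<xi> \<in> {-(2 ^ n)..2 ^ n} \<union> dyadic_block (2 ^ n)"
      by (auto simp: dyadic_block_def abs_if split: if_splits)
  qed
  moreover have "(LINT \<xi>:{-(2 ^ n)..2 ^ n} \<union> dyadic_block (2 ^ n :: real)|lborel. ?e \<xi>)
      = (LINT \<xi>:{-(2 ^ n)..2 ^ n}|lborel. ?e \<xi>) + (LINT \<xi>:dyadic_block (2 ^ n)|lborel. ?e \<xi>)"
    by (rule set_integral_Un[OF _ i ib]) (auto simp: dyadic_block_def)
  ultimately show ?thesis unfolding wave_def by simp
qed

lemma wave_norm_le:
  assumes g: "set_integrable lborel E g"
  shows "cmod (wave \<Phi> g E y t) \<le> (LINT \<xi>:E|lborel. cmod (g \<xi>))"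
  unfolding wave_def set_lebesgue_integral_def
proof (rule order.trans[OF integral_norm_bound], rule integral_mono')
  show "integrable lborel (\<lambda>\<xi>. indicat_real E \<xi> *\<^sub>R cmod (g \<xi>))"
    using integrable_norm[OF g[unfolded set_integrable_def]] by simp
qed (auto simp: norm_mult)

text \<open>
The partial inversion integrals converge almost everywhere because their dyadic increments are
geometrically small. The bound is integrable in \<open>x\<close>, so the integrals over every interval converge
to those of the limit; by the weak inversion formula they also converge to those of \<open>2 pi f\<close>.
\<close>
lemma AE_limit_of_partial_integrals:
  assumes f[measurable]: "f \<in> borel_measurable borel" and f2: "integrable lborel (\<lambda>x. (cmod (f x))\<^sup>2)"
    and g[measurable]: "g \<in> borel_measurable borel" and g2: "integrable lborel (\<lambda>x. (cmod (g x))\<^sup>2)"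
    and gf: "((\<lambda>R. \<integral>\<^sup>+\<xi>. ennreal ((cmod (g \<xi> - trunc_fourier f R \<xi>))\<^sup>2) \<partial>lborel) \<longlongrightarrow> 0) at_top"
    and [measurable]: "\<Phi> \<in> borel_measurable borel"
    and q: "0 < q" "q < 1" and H[measurable]: "H \<in> borel_measurable borel" and H0: "\<And>x. H x \<ge> (0::real)"
    and Hi: "set_integrable lborel {-R..R} H"
    and decay: "AE x in lborel. x \<in> {-R..R} \<longrightarrow> (\<forall>n\<ge>n0. cmod (wave \<Phi> g (dyadic_block (2 ^ n)) x 0) \<le> H x * q ^ n)"
  shows "AE x in lborel. x \<in> {-R..R} \<longrightarrow> (\<lambda>n. wave \<Phi> g {-(2 ^ n)..2 ^ n} x 0) \<longlonglongrightarrow> 2 * complex_of_real pi * f x"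
proof -
  have gi: "set_integrable lborel {a..b} g" for a b by (rule square_integrable_local[OF g g2])
  have fi: "set_integrable lborel {a..b} f" for a b by (rule square_integrable_local[OF f f2])
  define P where "P = (\<lambda>n x. wave \<Phi> g {-(2 ^ n)..2 ^ n} x 0)"
  have Pm[measurable]: "P n \<in> borel_measurable borel" for n unfolding P_def by measurable
  define L where "L = (\<lambda>x. lim (\<lambda>n. P n x))"
  have Lm[measurable]: "L \<in> borel_measurable borel" unfolding L_def by measurable
  define G0 where "G0 = (LINT \<xi>:{-(2 ^ n0)..2 ^ n0}|lborel. cmod (g \<xi>))"
  define D where "D = (\<lambda>x. G0 + H x / (1 - q))"
  have Di: "set_integrable lborel {a..b} D" if "{a..b} \<subseteq> {-R..R}" for a b
    unfolding D_def
    by (intro set_integral_add set_integrable_divide set_integrable_subset[OF Hi _ that])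
       (auto intro!: borel_integrable_atLeastAtMost' continuous_intros)
  have good: "AE x in lborel. x \<in> {-R..R} \<longrightarrow> (\<lambda>n. P n x) \<longlonglongrightarrow> L x \<and> (\<forall>n\<ge>n0. cmod (P n x) \<le> D x)"
    using decay
  proof eventually_elim
    case (elim x)
    show ?case
    proof
      assume x: "x \<in> {-R..R}"
      have inc: "cmod (P (Suc n) x - P n x) \<le> H x * q ^ n" if "n \<ge> n0" for n
        using elim x that wave_dyadic_step[OF gi, of \<Phi> n x 0] by (simp add: P_def)
      have "convergent (\<lambda>n. P n x)" by (rule geometric_increments(1)[OF inc q H0])
      moreover have "cmod (P n x) \<le> D x" if n: "n \<ge> n0" for n
      proof -
        have "cmod (P n x - P n0 x) \<le> H x / (1 - q)"
          by (rule geometric_increments(2)[OF inc q H0 n])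
        moreover have "cmod (P n0 x) \<le> G0" unfolding P_def G0_def by (rule wave_norm_le[OF gi])
        ultimately show ?thesis unfolding D_def using norm_triangle_ineq2[of "P n x" "P n0 x"] by linarith
      qed
      ultimately show "(\<lambda>n. P n x) \<longlonglongrightarrow> L x \<and> (\<forall>n\<ge>n0. cmod (P n x) \<le> D x)"
        by (simp add: L_def convergent_LIMSEQ_iff)
    qed
  qed
  have D0: "D x \<ge> 0" for x
    unfolding D_def G0_def set_lebesgue_integral_def using H0[of x] q by (intro add_nonneg_nonneg) auto
  have LD: "AE x in lborel. x \<in> {-R..R} \<longrightarrow> cmod (L x) \<le> D x"
    using good
  proof eventually_elim
    case (elim x)
    show ?case
    proof
      assume "x \<in> {-R..R}"
      with elim have "(\<lambda>n. P n x) \<longlonglongrightarrow> L x" "\<forall>n\<ge>n0. cmod (P n x) \<le> D x" by auto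
      thus "cmod (L x) \<le> D x"
        by (intro Lim_bounded[OF tendsto_norm, of _ _ n0]) auto
    qed
  qed
  have Li: "set_integrable lborel {-R..R} L"
    unfolding set_integrable_def
  proof (rule Bochner_Integration.integrable_bound)
    show "integrable lborel (\<lambda>x. indicat_real {-R..R} x *\<^sub>R D x)"
      using Di[of "-R" R] by (simp add: set_integrable_def)
    show "AE x in lborel. norm (indicat_real {-R..R} x *\<^sub>R L x) \<le> norm (indicat_real {-R..R} x *\<^sub>R D x)"
      using LD by eventually_elim (use D0 in \<open>auto split: split_indicator\<close>)
  qed measurable
  have int: "(LINT x:{a..b}|lborel. L x) = 2 * complex_of_real pi * (LINT x:{a..b}|lborel. f x)"
    if ab: "- R \<le> a" "a \<le> b" "b \<le> R" for a b
  proof (rule LIMSEQ_unique)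
    have sub: "{a..b} \<subseteq> {-R..R}" using ab by auto
    have "(\<lambda>n. LINT x|lborel. indicat_real {a..b} x *\<^sub>R P (n + n0) x) \<longlonglongrightarrow> (LINT x|lborel. indicat_real {a..b} x *\<^sub>R L x)"
    proof (rule integral_dominated_convergence)
      show "integrable lborel (\<lambda>x. indicat_real {a..b} x *\<^sub>R D x)"
        using Di[OF sub] by (simp add: set_integrable_def)
      show "AE x in lborel. (\<lambda>n. indicat_real {a..b} x *\<^sub>R P (n + n0) x) \<longlonglongrightarrow> indicat_real {a..b} x *\<^sub>R L x"
        using good
      proof eventually_elim
        case (elim x)
        show ?case
        proof (cases "x \<in> {a..b}")
          case True
          with elim sub have "(\<lambda>n. P n x) \<longlonglongrightarrow> L x" by auto
          from LIMSEQ_ignore_initial_segment[OF this, of n0] True show ?thesis by simp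
        qed simp
      qed
      show "AE x in lborel. norm (indicat_real {a..b} x *\<^sub>R P (n + n0) x) \<le> indicat_real {a..b} x *\<^sub>R D x" for n
        using good by eventually_elim (use sub in \<open>auto split: split_indicator\<close>)
    qed measurable
    thus "(\<lambda>n. LINT x:{a..b}|lborel. P (n + n0) x) \<longlonglongrightarrow> (LINT x:{a..b}|lborel. L x)"
      by (simp add: set_lebesgue_integral_def)
    have "filterlim (\<lambda>n::nat. (2::real) ^ (n + n0)) at_top sequentially"
    proof (rule filterlim_at_top_mono[OF filterlim_real_sequentially])
      have "real n \<le> 2 ^ (n + n0)" for n
        using less_imp_le[OF of_nat_less_two_power[of n, where 'a = real]] power_increasing[of n "n + n0" "2::real"] by linarith
      thus "\<forall>\<^sub>F n in sequentially. real n \<le> 2 ^ (n + n0)" by simp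
    qed
    from filterlim_compose[OF weak_inversion[OF f f2 g g2 gf ab(2)] this]
    have "(\<lambda>n. LINT \<xi>:{-(2 ^ (n + n0))..2 ^ (n + n0)}|lborel. g \<xi> * interval_transform a b \<xi>)
       \<longlonglongrightarrow> 2 * complex_of_real pi * (LINT x:{a..b}|lborel. f x)" .
    thus "(\<lambda>n. LINT x:{a..b}|lborel. P (n + n0) x) \<longlonglongrightarrow> 2 * complex_of_real pi * (LINT x:{a..b}|lborel. f x)"
      unfolding P_def wave_def integral_of_wave_over_interval[OF g g2, symmetric] by simp
  qed
  have "AE x in lborel. x \<in> {-R..R} \<longrightarrow> L x - 2 * complex_of_real pi * f x = 0"
  proof (rule AE_zero_of_interval_integrals)
    have fi': "set_integrable lborel {a..b} (\<lambda>x. 2 * complex_of_real pi * f x)" for a b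
      using fi by (intro set_integrable_mult_right) auto
    show "set_integrable lborel {-R..R} (\<lambda>x. L x - 2 * complex_of_real pi * f x)"
      by (rule set_integral_diff(1)[OF Li fi'])
    fix a b assume ab: "- R \<le> a" "a \<le> b" "b \<le> R"
    have "set_integrable lborel {a..b} L" by (rule set_integrable_subset[OF Li]) (use ab in auto)
    from set_integral_diff(2)[OF this fi'[of a b]] int[OF ab]
    show "(LINT x:{a..b}|lborel. L x - 2 * complex_of_real pi * f x) = 0" by simp
  qed
  with good show ?thesis
    by eventually_elim (auto simp: P_def)
qed

text \<open>
Functions that are measurable for the completed measure are replaced by Borel functions throughout,
so that products of measures can be formed over \<open>lborel\<close>.
\<close>
lemma borel_representative:
  fixes f :: "real \<Rightarrow> complex"
  assumes f: "f \<in> borel_measurable lebesgue"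
  obtains f0 where "f0 \<in> borel_measurable borel" "AE x in lborel. f x = f0 x"
proof -
  have "(\<lambda>x. Re (f x)) \<in> borel_measurable lebesgue" "(\<lambda>x. Im (f x)) \<in> borel_measurable lebesgue"
    using f by measurable
  then obtain u v where uv[measurable]: "u \<in> borel_measurable lborel" "v \<in> borel_measurable lborel"
    and ae: "AE x in lborel. Re (f x) = u x" "AE x in lborel. Im (f x) = v x"
    using completion_ex_borel_measurable_real[of "\<lambda>x. Re (f x)" lborel]
      completion_ex_borel_measurable_real[of "\<lambda>x. Im (f x)" lborel] by blast
  show ?thesis
  proof (rule that)
    show "(\<lambda>x. Complex (u x) (v x)) \<in> borel_measurable borel"
      unfolding complex_eq_iff Complex_eq using uv by measurable
    from ae show "AE x in lborel. f x = Complex (u x) (v x)"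
      by eventually_elim (simp add: complex_eq_iff)
  qed
qed

lemma L2_borel_representative:
  assumes "f \<in> L2"
  obtains f0 where "f0 \<in> borel_measurable borel" "AE x in lborel. f x = f0 x"
    "integrable lborel (\<lambda>x. (cmod (f0 x))\<^sup>2)"
proof -
  have f[measurable]: "f \<in> borel_measurable lebesgue" and f2: "integrable lebesgue (\<lambda>x. (cmod (f x))\<^sup>2)"
    using assms by (auto simp: L2_def)
  obtain f0 where f0[measurable]: "f0 \<in> borel_measurable borel" and ae: "AE x in lborel. f x = f0 x"
    using borel_representative[OF f] by blast
  have f0l: "f0 \<in> borel_measurable lebesgue" by (rule measurable_completion) simp
  have "integrable lebesgue (\<lambda>x. (cmod (f0 x))\<^sup>2)"
  proof (rule integrable_cong_AE_imp[OF f2])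
    show "AE x in lebesgue. (cmod (f x))\<^sup>2 = (cmod (f0 x))\<^sup>2"
      using AE_completion[OF ae] by eventually_elim simp
  qed (use f0l in measurable)
  hence "integrable lborel (\<lambda>x. (cmod (f0 x))\<^sup>2)" by (subst (asm) integrable_completion) auto
  thus ?thesis using that f0 ae by blast
qed

lemma lebesgue_LINT_eq:
  fixes f f0 :: "real \<Rightarrow> complex"
  assumes f: "f \<in> borel_measurable lebesgue" and f0: "f0 \<in> borel_measurable borel"
    and ae: "AE x in lborel. f x = f0 x"
  shows "(LINT x|lebesgue. f x) = (LINT x|lborel. f0 x)"
proof -
  have f0l: "f0 \<in> borel_measurable lebesgue" by (rule measurable_completion) (use f0 in simp)
  have "(LINT x|lebesgue. f x) = (LINT x|lebesgue. f0 x)"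
    by (rule integral_cong_AE[OF f f0l AE_completion[OF ae]])
  also have "\<dots> = (LINT x|lborel. f0 x)" by (rule integral_completion) (use f0 in simp)
  finally show ?thesis .
qed

lemma fourier_integral_truncation:
  assumes f[measurable]: "f \<in> borel_measurable lebesgue" and f0[measurable]: "f0 \<in> borel_measurable borel"
    and ae: "AE x in lborel. f x = f0 x"
  shows "fourier_integral (\<lambda>x. indicator {-R..R} x *\<^sub>R f x) \<xi> = trunc_fourier f0 R \<xi>"
proof -
  have e: "exp (- \<i> * complex_of_real (x * \<xi>)) = cis (- (x * \<xi>))" for x by (simp add: cis_conv_exp)
  have [measurable]: "(\<lambda>x. cis (- (x * \<xi>))) \<in> borel_measurable lebesgue"
    by (rule measurable_completion) measurable
  have [measurable]: "indicator {-R..R} \<in> borel_measurable lebesgue"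
    by (rule measurable_completion) measurable
  show ?thesis
    unfolding fourier_integral_def trunc_fourier_def e set_lebesgue_integral_def
  proof (rule lebesgue_LINT_eq)
    show "(\<lambda>x. cis (- (x * \<xi>)) * (indicator {-R..R} x *\<^sub>R f x)) \<in> borel_measurable lebesgue" by measurable
    show "AE x in lborel. cis (- (x * \<xi>)) * (indicator {-R..R} x *\<^sub>R f x) = indicator {-R..R} x *\<^sub>R (cis (- (x * \<xi>)) * f0 x)"
      using ae by eventually_elim simp
  qed measurable
qed

lemma nn_integral_lebesgue_eq:
  assumes ae: "AE x in lborel. f x = f0 x"
  shows "(\<integral>\<^sup>+x. f x \<partial>lebesgue) = (\<integral>\<^sup>+x. f0 x \<partial>lborel)"
proof -
  have "(\<integral>\<^sup>+x. f x \<partial>lebesgue) = (\<integral>\<^sup>+x. f x \<partial>lborel)" by (rule nn_integral_completion)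
  also have "\<dots> = (\<integral>\<^sup>+x. f0 x \<partial>lborel)" by (rule nn_integral_cong_AE[OF ae])
  finally show ?thesis .
qed

text \<open>
The defining property of the choice operator needs a witness: the extension constructed above,
which is square integrable because the truncation to the empty interval \<open>[1, -1]\<close> is zero.
\<close>
lemma is_fourier_L2_fourier:
  assumes f: "f \<in> L2"
  shows "is_fourier_L2 f (fourier f)"
proof -
  have fm: "f \<in> borel_measurable lebesgue" using f by (simp add: L2_def)
  obtain f0 where f0[measurable]: "f0 \<in> borel_measurable borel" and ae: "AE x in lborel. f x = f0 x"
    and f2: "integrable lborel (\<lambda>x. (cmod (f0 x))\<^sup>2)" using L2_borel_representative[OF f] by blast
  obtain g where g[measurable]: "g \<in> borel_measurable borel" and le:
    "\<And>R. (\<integral>\<^sup>+\<xi>. ennreal ((cmod (g \<xi> - trunc_fourier f0 R \<xi>))\<^sup>2) \<partial>lborel) \<le> ennreal (2 * pi * tail_sq f0 R)"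
    using Plancherel_extension_exists[OF f0 f2] by blast
  have gl: "g \<in> borel_measurable lebesgue" by (rule measurable_completion) simp
  have g2: "integrable lborel (\<lambda>\<xi>. (cmod (g \<xi>))\<^sup>2)"
  proof -
    have "trunc_fourier f0 (-1) \<xi> = 0" for \<xi> by (simp add: trunc_fourier_def set_lebesgue_integral_def)
    hence "(\<integral>\<^sup>+\<xi>. ennreal ((cmod (g \<xi>))\<^sup>2) \<partial>lborel) \<le> ennreal (2 * pi * tail_sq f0 (-1))" using le[of "-1"] by simp
    thus ?thesis by (intro integrableI_nonneg) (auto intro: order.strict_trans1)
  qed
  have "is_fourier_L2 f g"
    unfolding is_fourier_L2_def fourier_integral_truncation[OF fm f0 ae]
  proof
    show "g \<in> L2" unfolding L2_def using gl g2 by (auto simp: integrable_completion)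
    show "((\<lambda>R. \<integral>\<^sup>+ \<xi>. ennreal ((cmod (g \<xi> - trunc_fourier f0 R \<xi>))\<^sup>2) \<partial>lebesgue) \<longlongrightarrow> 0) at_top"
    proof (rule tendsto_sandwich[where f = "\<lambda>_. 0" and h = "\<lambda>R. ennreal (2 * pi * tail_sq f0 R)"])
      show "\<forall>\<^sub>F R in at_top. (\<integral>\<^sup>+ \<xi>. ennreal ((cmod (g \<xi> - trunc_fourier f0 R \<xi>))\<^sup>2) \<partial>lebesgue) \<le> ennreal (2 * pi * tail_sq f0 R)"
        using le by (simp add: nn_integral_completion)
      have "((\<lambda>R. 2 * pi * tail_sq f0 R) \<longlongrightarrow> 2 * pi * 0) at_top"
        by (intro tendsto_mult tendsto_const tail_sq_tendsto_0[OF f0 f2])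
      from tendsto_ennrealI[OF this] show "((\<lambda>R. ennreal (2 * pi * tail_sq f0 R)) \<longlongrightarrow> 0) at_top" by simp
    qed auto
  qed
  thus ?thesis unfolding fourier_def by (rule someI[of "is_fourier_L2 f"])
qed

lemma evolution_partial_eq_wave:
  assumes F: "fourier f \<in> borel_measurable lebesgue" and g[measurable]: "g \<in> borel_measurable borel"
    and ae: "AE \<xi> in lborel. fourier f \<xi> = g \<xi>" and \<Phi>[measurable]: "\<Phi> \<in> borel_measurable borel"
  shows "evolution_partial \<Phi> t f x N = 1 / (2 * complex_of_real pi) * wave \<Phi> g {-(2 ^ N)..2 ^ N} x t"
proof -
  have e: "exp (\<i> * complex_of_real (x * \<xi> + t * \<Phi> \<xi>)) = cis (x * \<xi> + t * \<Phi> \<xi>)" for \<xi> by (simp add: cis_conv_exp)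
  note [measurable] = F
  have [measurable]: "(\<lambda>\<xi>. cis (x * \<xi> + t * \<Phi> \<xi>)) \<in> borel_measurable lebesgue"
    by (rule measurable_completion) measurable
  have [measurable]: "indicator {-(2 ^ N)..2 ^ N :: real} \<in> borel_measurable lebesgue"
    by (rule measurable_completion) measurable
  have "(LINT \<xi>:{-(2 ^ N)..2 ^ N}|lebesgue. cis (x * \<xi> + t * \<Phi> \<xi>) * fourier f \<xi>) = wave \<Phi> g {-(2 ^ N)..2 ^ N} x t"
    unfolding wave_def set_lebesgue_integral_def
  proof (rule lebesgue_LINT_eq)
    show "(\<lambda>\<xi>. indicat_real {-(2 ^ N)..2 ^ N} \<xi> *\<^sub>R (cis (x * \<xi> + t * \<Phi> \<xi>) * fourier f \<xi>)) \<in> borel_measurable lebesgue"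
      by measurable
    show "AE \<xi> in lborel. indicat_real {-(2 ^ N)..2 ^ N} \<xi> *\<^sub>R (cis (x * \<xi> + t * \<Phi> \<xi>) * fourier f \<xi>) =
        indicat_real {-(2 ^ N)..2 ^ N} \<xi> *\<^sub>R (cis (x * \<xi> + t * \<Phi> \<xi>) * g \<xi>)"
      using ae by eventually_elim simp
  qed measurable
  thus ?thesis unfolding evolution_partial_def e by simp
qed

text \<open>
The partial integrals are continuous and converge uniformly on the approach region \<open>X\<close>, so the limit
in \<open>n\<close> and the limit at \<open>(x, 0)\<close> may be interchanged.
\<close>
lemma evolution_tendsto_at_point:
  fixes X :: "(real \<times> real) set"
  assumes g: "\<And>a b. set_integrable lborel {a..b} g" and \<Phi>: "\<Phi> \<in> borel_measurable borel"
    and ep: "\<And>t y N. evolution_partial \<Phi> t f y N = 1 / (2 * complex_of_real pi) * wave \<Phi> g {-(2 ^ N)..2 ^ N} y t"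
    and q: "0 < q" "q < 1" and h: "h \<ge> 0"
    and decay: "\<And>n y t. n \<ge> n0 \<Longrightarrow> (y, t) \<in> X \<Longrightarrow> cmod (wave \<Phi> g (dyadic_block (2 ^ n)) y t) \<le> h * q ^ n"
    and lim: "(\<lambda>n. wave \<Phi> g {-(2 ^ n)..2 ^ n} x 0) \<longlonglongrightarrow> 2 * complex_of_real pi * c"
  shows "((\<lambda>(y, t). evolution \<Phi> t f y) \<longlongrightarrow> c) (at (x, 0) within X)"
proof -
  define F where "F = (\<lambda>n p. wave \<Phi> g {-(2 ^ n)..2 ^ n} (fst p) (snd p))"
  have d: "F (Suc n) p - F n p = wave \<Phi> g (dyadic_block (2 ^ n)) (fst p) (snd p)" for n p
    unfolding F_def by (rule wave_dyadic_step[OF g \<Phi>])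
  define S where "S = (\<lambda>p. (\<Sum>n. F (Suc n) p - F n p) + F 0 p)"
  have "uniform_limit X (\<lambda>n p. \<Sum>i<n. F (Suc i) p - F i p) (\<lambda>p. \<Sum>n. F (Suc n) p - F n p) sequentially"
  proof (rule Weierstrass_m_test_ev)
    show "\<forall>\<^sub>F n in sequentially. \<forall>p\<in>X. norm (F (Suc n) p - F n p) \<le> h * q ^ n"
      using eventually_ge_at_top[of n0] by eventually_elim (auto simp: d decay)
    show "summable (\<lambda>n. h * q ^ n)" using q by (intro summable_mult summable_geometric) auto
  qed
  from uniform_limit_add[OF this uniform_limit_const[where c = "F 0"]]
  have ul: "uniform_limit X F S sequentially"
    by (simp add: S_def sum_lessThan_telescope[of "\<lambda>i. F i _"])
  have "(S \<longlongrightarrow> 2 * complex_of_real pi * c) (at (x, 0) within X)"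
  proof (rule swap_uniform_limit[OF _ lim ul])
    have "(F n \<longlongrightarrow> F n (x, 0)) (at (x, 0) within X)" for n
    proof -
      have "continuous_on UNIV (F n)" unfolding F_def by (rule wave_continuous[OF g \<Phi>]) simp
      hence "continuous (at (x, 0)) (F n)" by (simp add: continuous_on_eq_continuous_at)
      hence "continuous (at (x, 0) within X) (F n)" by (rule continuous_at_imp_continuous_within)
      thus ?thesis by (simp add: continuous_within)
    qed
    thus "\<forall>\<^sub>F n in sequentially. (F n \<longlongrightarrow> wave \<Phi> g {-(2 ^ n)..2 ^ n} x 0) (at (x, 0) within X)"
      by (simp add: F_def)
  qed simp
  from tendsto_mult_left[OF this, of "1 / (2 * complex_of_real pi)"]
  have "((\<lambda>p. 1 / (2 * complex_of_real pi) * S p) \<longlongrightarrow> c) (at (x, 0) within X)" by simp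
  moreover have "\<forall>\<^sub>F p in at (x, 0) within X. 1 / (2 * complex_of_real pi) * S p = (case p of (y, t) \<Rightarrow> evolution \<Phi> t f y)"
    unfolding eventually_at_filter
  proof (intro always_eventually allI impI)
    fix p assume p: "p \<in> X"
    obtain y t where yt: "p = (y, t)" by (cases p)
    have "(\<lambda>n. F n p) \<longlonglongrightarrow> S p" by (rule tendsto_uniform_limitI[OF ul p])
    hence "(\<lambda>n. evolution_partial \<Phi> t f y n) \<longlonglongrightarrow> 1 / (2 * complex_of_real pi) * S p"
      unfolding ep F_def yt by (intro tendsto_mult_left) simp
    hence "convergent (evolution_partial \<Phi> t f y)" "lim (evolution_partial \<Phi> t f y) = 1 / (2 * complex_of_real pi) * S p"
      by (auto simp: convergent_def limI)
    thus "1 / (2 * complex_of_real pi) * S p = (case p of (y, t) \<Rightarrow> evolution \<Phi> t f y)"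
      by (simp add: evolution_def yt)
  qed
  ultimately show ?thesis by (rule Lim_transform_eventually)
qed

theorem corollary2:
  fixes \<Theta> :: "real set" and \<Phi> :: "real \<Rightarrow> real" and C1 C2 s :: real
    and f :: "real \<Rightarrow> complex"
  assumes "compact \<Theta>"
    and "C2_function \<Phi>"
    and "C1 > 0" and "C2 > 0"
    and "\<And>\<xi>. \<bar>\<xi>\<bar> \<ge> 1 \<Longrightarrow> \<bar>\<xi>\<bar> * \<bar>deriv (deriv \<Phi>) \<xi>\<bar> \<ge> C1"
    and "\<And>\<xi>. \<bar>\<xi>\<bar> \<ge> 1 \<Longrightarrow> \<bar>\<xi>\<bar> * \<bar>deriv (deriv \<Phi>) \<xi>\<bar> \<ge> C2 * \<bar>deriv \<Phi> \<xi>\<bar>"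
    and "s > (upper_Minkowski_dim \<Theta> + 1) / 4"
    and "f \<in> Sobolev s"
  shows "AE x in lebesgue.
    ((\<lambda>(y, t). evolution \<Phi> t f y) \<longlongrightarrow> f x)
      (at (x, 0) within {(y, t). t \<in> {-1..1} \<and> y - x \<in> (\<lambda>\<theta>. t * \<theta>) ` \<Theta>})"
proof (cases "\<Theta> = {}")
  case True
  thus ?thesis by simp
next
  case False
  then obtain \<theta>0 where \<theta>0: "\<theta>0 \<in> \<Theta>" by blast
  have \<Phi>: "dispersive \<Phi> C1 C2" unfolding dispersive_def using assms(2-6) by blast
  have \<Phi>m[measurable]: "\<Phi> \<in> borel_measurable borel" by (rule dispersive_measurable[OF \<Phi>])
  have "bounded \<Theta>" using assms(1) by (rule compact_imp_bounded)
  then obtain m where m: "\<And>\<theta>. \<theta> \<in> \<Theta> \<Longrightarrow> \<bar>\<theta>\<bar> \<le> m" unfolding bounded_iff by auto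
  define M where "M = max 1 m"
  have M: "M \<ge> 1" "\<Theta> \<subseteq> {-M..M}" using m unfolding M_def by (force simp: abs_le_iff)+
  have fL: "f \<in> L2" and wL: "(\<lambda>\<xi>. (1 + \<xi>\<^sup>2) powr (s / 2) *\<^sub>R fourier f \<xi>) \<in> L2"
    using assms(8) by (auto simp: Sobolev_def)
  have fm: "f \<in> borel_measurable lebesgue" using fL by (simp add: L2_def)
  \<comment> \<open>Fix Borel representatives \<open>f0\<close> of \<open>f\<close> and \<open>g\<close> of its transform.\<close>
  obtain f0 where f0[measurable]: "f0 \<in> borel_measurable borel" and fae: "AE x in lborel. f x = f0 x"
    and f2: "integrable lborel (\<lambda>x. (cmod (f0 x))\<^sup>2)" using L2_borel_representative[OF fL] by blast
  note isF = is_fourier_L2_fourier[OF fL]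
  have FL: "fourier f \<in> L2" using isF by (simp add: is_fourier_L2_def)
  have Fm: "fourier f \<in> borel_measurable lebesgue" using FL by (simp add: L2_def)
  obtain g where g[measurable]: "g \<in> borel_measurable borel" and gae: "AE \<xi> in lborel. fourier f \<xi> = g \<xi>"
    and g2: "integrable lborel (\<lambda>\<xi>. (cmod (g \<xi>))\<^sup>2)" using L2_borel_representative[OF FL] by blast
  have gf: "((\<lambda>R. \<integral>\<^sup>+\<xi>. ennreal ((cmod (g \<xi> - trunc_fourier f0 R \<xi>))\<^sup>2) \<partial>lborel) \<longlongrightarrow> 0) at_top"
  proof -
    have "(\<integral>\<^sup>+\<xi>. ennreal ((cmod (fourier f \<xi> - trunc_fourier f0 R \<xi>))\<^sup>2) \<partial>lebesgue)
       = (\<integral>\<^sup>+\<xi>. ennreal ((cmod (g \<xi> - trunc_fourier f0 R \<xi>))\<^sup>2) \<partial>lborel)" for R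
      by (rule nn_integral_lebesgue_eq) (use gae in eventually_elim, simp)
    thus ?thesis using isF by (simp add: is_fourier_L2_def fourier_integral_truncation[OF fm f0 fae])
  qed
  have W: "integrable lborel (\<lambda>\<xi>. (1 + \<xi>\<^sup>2) powr s * (cmod (g \<xi>))\<^sup>2)"
  proof -
    have "integrable lebesgue (\<lambda>\<xi>. (cmod ((1 + \<xi>\<^sup>2) powr (s / 2) *\<^sub>R fourier f \<xi>))\<^sup>2)"
      using wL by (simp add: L2_def)
    also have "(\<lambda>\<xi>. (cmod ((1 + \<xi>\<^sup>2) powr (s / 2) *\<^sub>R fourier f \<xi>))\<^sup>2) = (\<lambda>\<xi>. (1 + \<xi>\<^sup>2) powr s * (cmod (fourier f \<xi>))\<^sup>2)"
    proof
      fix \<xi> :: real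
      have "((1 + \<xi>\<^sup>2) powr (s / 2))\<^sup>2 = (1 + \<xi>\<^sup>2) powr s"
        by (simp add: power2_eq_square flip: powr_add)
      thus "(cmod ((1 + \<xi>\<^sup>2) powr (s / 2) *\<^sub>R fourier f \<xi>))\<^sup>2 = (1 + \<xi>\<^sup>2) powr s * (cmod (fourier f \<xi>))\<^sup>2"
        by (simp add: power_mult_distrib)
    qed
    finally have 1: "integrable lebesgue (\<lambda>\<xi>. (1 + \<xi>\<^sup>2) powr s * (cmod (fourier f \<xi>))\<^sup>2)" .
    have 2: "(\<lambda>\<xi>. (1 + \<xi>\<^sup>2) powr s * (cmod (g \<xi>))\<^sup>2) \<in> borel_measurable lborel" by measurable
    have "integrable lebesgue (\<lambda>\<xi>. (1 + \<xi>\<^sup>2) powr s * (cmod (g \<xi>))\<^sup>2)"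
    proof (rule integrable_cong_AE_imp[OF 1 measurable_completion[OF 2]])
      show "AE \<xi> in lebesgue. (1 + \<xi>\<^sup>2) powr s * (cmod (fourier f \<xi>))\<^sup>2 = (1 + \<xi>\<^sup>2) powr s * (cmod (g \<xi>))\<^sup>2"
        using AE_completion[OF gae] by eventually_elim simp
    qed
    thus ?thesis using 2 by (simp add: integrable_completion)
  qed
  have gi: "set_integrable lborel {a..b} g" for a b by (rule square_integrable_local[OF g g2])
  have gb: "set_integrable lborel (dyadic_block l) g" for l
    by (rule set_integrable_subset[OF gi[of "-(2 * l)" "2 * l"]]) (auto simp: dyadic_block_def abs_le_iff)
  have ep: "evolution_partial \<Phi> t f y N = 1 / (2 * complex_of_real pi) * wave \<Phi> g {-(2 ^ N)..2 ^ N} y t" for t y N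
    by (rule evolution_partial_eq_wave[OF Fm g gae \<Phi>m])
  let ?X = "\<lambda>x. {(y, t). t \<in> {-1..1} \<and> y - x \<in> (\<lambda>\<theta>. t * \<theta>) ` \<Theta>}"
  \<comment> \<open>The maximal estimates are local in space, so the line is exhausted by the intervals \<open>[-k, k]\<close>.\<close>
  have local: "AE x in lborel. x \<in> {-real k..real k} \<longrightarrow>
      ((\<lambda>(y, t). evolution \<Phi> t f y) \<longlongrightarrow> f x) (at (x, 0) within ?X x)" for k :: nat
  proof -
    obtain q n0 H where q: "0 < q" "q < 1" and H[measurable]: "H \<in> borel_measurable borel" and H0: "\<And>x. H x \<ge> (0::real)"
      and Hi: "set_integrable lborel {-real k..real k} H"
      and decay: "AE x in lborel. x \<in> {-real k..real k} \<longrightarrow> (\<forall>n\<ge>n0. \<forall>t\<in>{-1..1}. \<forall>\<theta>\<in>\<Theta>.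
        cmod (wave \<Phi> g (dyadic_block (2 ^ n)) (x + t * \<theta>) t) \<le> H x * q ^ n)"
      by (rule dyadic_maximal_decay[OF \<Phi> M(2,1) g W gb assms(7) of_nat_0_le_iff[of k]]) (rule that, assumption+)
    \<comment> \<open>At time \<open>0\<close> every direction leads to \<open>x\<close> itself; this is where a direction has to exist.\<close>
    have decay0: "AE x in lborel. x \<in> {-real k..real k} \<longrightarrow> (\<forall>n\<ge>n0. cmod (wave \<Phi> g (dyadic_block (2 ^ n)) x 0) \<le> H x * q ^ n)"
      using decay
    proof eventually_elim
      case (elim x)
      show ?case
      proof (intro impI allI)
        fix n assume "x \<in> {-real k..real k}" "n \<ge> n0"
        with elim have "\<forall>t\<in>{-1..1}. \<forall>\<theta>\<in>\<Theta>. cmod (wave \<Phi> g (dyadic_block (2 ^ n)) (x + t * \<theta>) t) \<le> H x * q ^ n" by blast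
        from bspec[OF bspec[OF this, of 0] \<theta>0] show "cmod (wave \<Phi> g (dyadic_block (2 ^ n)) x 0) \<le> H x * q ^ n" by simp
      qed
    qed
    from AE_limit_of_partial_integrals[OF f0 f2 g g2 gf \<Phi>m q H H0 Hi decay0] decay fae
    show ?thesis
    proof eventually_elim
      case (elim x)
      show ?case
      proof
        assume x: "x \<in> {-real k..real k}"
        show "((\<lambda>(y, t). evolution \<Phi> t f y) \<longlongrightarrow> f x) (at (x, 0) within ?X x)"
        proof (rule evolution_tendsto_at_point[OF gi \<Phi>m ep q H0[of x]])
          show "(\<lambda>n. wave \<Phi> g {-(2 ^ n)..2 ^ n} x 0) \<longlonglongrightarrow> 2 * complex_of_real pi * f x"
            using elim x by simp
          fix n y t assume n: "n \<ge> n0" and "(y, t) \<in> ?X x"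
          then obtain \<theta> where \<theta>: "\<theta> \<in> \<Theta>" "t \<in> {-1..1}" "y = x + t * \<theta>" by (auto simp: algebra_simps)
          with elim(2) x n show "cmod (wave \<Phi> g (dyadic_block (2 ^ n)) y t) \<le> H x * q ^ n" by blast
        qed
      qed
    qed
  qed
  have "AE x in lborel. \<forall>k::nat. x \<in> {-real k..real k} \<longrightarrow>
      ((\<lambda>(y, t). evolution \<Phi> t f y) \<longlongrightarrow> f x) (at (x, 0) within ?X x)"
    by (intro AE_all_countable[THEN iffD2] allI local)
  hence "AE x in lborel. ((\<lambda>(y, t). evolution \<Phi> t f y) \<longlongrightarrow> f x) (at (x, 0) within ?X x)"
  proof eventually_elim
    case (elim x)
    obtain k :: nat where "\<bar>x\<bar> \<le> real k" using real_arch_simple by blast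
    hence "x \<in> {-real k..real k}" by (simp add: abs_le_iff)
    with elim show ?case by blast
  qed
  thus ?thesis by (rule AE_completion)
qed

end
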